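(* Let $I\subset\mathbb{R}$ be an open interval, $\alpha<\beta$ with $[\alpha,\beta]\subset I$. Let $D\in C^1(I)$ satisfy $D(u)\ge d>0$ for all $u\in I$ and some constant $d$, and let $f\in C^2(I)$ satisfy $f(\alpha)=f(\beta)=0$, $f'(\alpha)>0$, $f'(\beta)>0$. Assume moreover that $$\int_\alpha^\beta f(s)D(s)\,ds=0,\qquad G(u):=\int_\alpha^u f(s)D(s)\,ds>0\quad\text{for all }u\in I,\ u\ne\alpha,\beta .$$ Let $\theta_\pm(r)$ and $\delta_\pm(r)$ be the functions of $r=\varepsilon/\ell$ defined in the context. Then there exists $r_0>0$ such that for $r\in(0,r_0)$ \begin{align*} \theta_-(r)&=\tfrac12A_\alpha^2D(\alpha)^2K_\alpha^2\exp\left(-\tfrac{A_\alpha}{r}\right)\left(1+\mathcal{O}\left\{r^{-1}\exp\left(-\tfrac{A_\alpha}{2r}\right)\right\}\right),\\ \theta_+(r)&=\tfrac12A_\beta^2D(\beta)^2K_\beta^2\exp\left(-\tfrac{A_\beta}{r}\right)\left(1+\mathcal{O}\left\{r^{-1}\exp\left(-\tfrac{A_\beta}{2r}\right)\right\}\right),\\ \delta_-(r)&=K_\alpha\exp\left(-\tfrac{A_\alpha}{2r}\right)\left(1+\mathcal{O}\left\{r^{-1}\exp\left(-\tfrac{A_\alpha}{2r}\right)\right\}\right),\\ \delta_+(r)&=K_\beta\exp\left(-\tfrac{A_\beta}{2r}\right)\left(1+\mathcal{O}\left\{r^{-1}\exp\left(-\tfrac{A_\beta}{2r}\right)\right\}\right),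 \end{align*} where $$A_\gamma:=\frac{\sqrt{G''(\gamma)}}{D(\gamma)}\quad\text{for }\gamma=\alpha,\beta,$$ $$K_\alpha:=(\beta-\alpha)\exp\left\{\int_{\alpha}^{\frac{\alpha+\beta}{2}}\left(\frac{A_\alpha D(t)}{\sqrt{2G(t)}}-\frac{1}{t-\alpha}\right)dt\right\},\qquad K_\beta:=(\beta-\alpha)\exp\left\{\int_{\frac{\alpha+\beta}{2}}^{\beta}\left(\frac{A_\beta D(t)}{\sqrt{2G(t)}}-\frac{1}{\beta-t}\right)dt\right\}.$$
   Context: For $\varepsilon,\ell>0$ consider the boundary value problem $$\varepsilon^2(D(\varphi)\varphi_x)_x-f(\varphi)=0\ \text{ in }(-\tfrac{\ell}{2},\tfrac{\ell}{2}),\qquad \varphi(-\tfrac{\ell}{2})=\varphi(\tfrac{\ell}{2})=\tfrac{\alpha+\beta}{2}.$$ There are constants $\rho_0,\eta>0$ such that whenever $\varepsilon/\ell<\rho_0$ this problem has exactly one solution, denoted $\varphi(\cdot,\ell,+1)$, with $\varphi>\frac{\alpha+\beta}2$ in $(-\frac\ell2,\frac\ell2)$ and $|\varphi(0)-\beta|<\eta$, and exactly one solution, denoted $\varphi(\cdot,\ell,-1)$, with $\varphi<\frac{\alpha+\beta}2$ in $(-\frac\ell2,\frac\ell2)$ and $|\varphi(0)-\alpha|<\eta$. The values $\varphi(0,\ell,\pm1)$ depend on $\varepsilon,\ell$ only through $r=\varepsilon/\ell$ (and tend to $\beta$, respectively $\alpha$, as $r\to0^+$). Define $$\theta_\pm(r):=G(\varphi(0,\ell,\pm1)),\qquad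 \delta_+(r):=\beta-\varphi(0,\ell,+1),\qquad \delta_-(r):=\varphi(0,\ell,-1)-\alpha .$$ The symbol $\mathcal{O}\{g(r)\}$ denotes a quantity bounded in absolute value by $Cg(r)$ for all $r\in(0,r_0)$, with $C$ independent of $r$. *)

theory Defs
  imports "HOL-Analysis.Analysis"
begin

text \<open>
  The parameters are the interval \<open>I\<close>, the diffusivity \<open>D\<close>, the reaction term \<open>f\<close> and its
  zeros \<open>\<alpha> < \<beta>\<close>. The interval integral is oriented, so the potential is also the intended one
  for arguments to the left of \<open>\<alpha>\<close>.
\<close>

definition potential :: "(real \<Rightarrow> real) \<Rightarrow> (real \<Rightarrow> real) \<Rightarrow> real \<Rightarrow> real \<Rightarrow> real" where
  "potential D f \<alpha> u = (LBINT s=\<alpha>..u. f s * D s)"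

text \<open>
  Classical solutions of the boundary value problem, continuous up to the boundary. Since \<open>D\<close> is
  \<open>C\<^sup>1\<close> and positive, the equation makes every such solution \<open>C\<^sup>2\<close> in the open interval.
  Functions live on the closed interval (extensionally), so that uniqueness can be expressed by
  \<open>\<exists>!\<close>; they take values in \<open>I\<close>, the domain of \<open>D\<close> and \<open>f\<close>.
\<close>

definition bvp_solution ::
  "real set \<Rightarrow> (real \<Rightarrow> real) \<Rightarrow> (real \<Rightarrow> real) \<Rightarrow> real \<Rightarrow> real \<Rightarrow> real \<Rightarrow> real \<Rightarrow> (real \<Rightarrow> real) \<Rightarrow> bool"
where
  "bvp_solution I D f \<alpha> \<beta> \<epsilon> l \<phi> \<longleftrightarrow>
     \<phi> \<in> {-(l/2)..l/2} \<rightarrow>\<^sub>E I \<and>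
     continuous_on {-(l/2)..l/2} \<phi> \<and>
     (\<forall>x\<in>{-(l/2)<..<l/2}.
        \<phi> differentiable (at x) \<and>
        (\<lambda>y. D (\<phi> y) * deriv \<phi> y) differentiable (at x) \<and>
        \<epsilon>\<^sup>2 * deriv (\<lambda>y. D (\<phi> y) * deriv \<phi> y) x - f (\<phi> x) = 0) \<and>
     \<phi> (-(l/2)) = (\<alpha> + \<beta>) / 2 \<and> \<phi> (l/2) = (\<alpha> + \<beta>) / 2"

definition upper_solution ::
  "real set \<Rightarrow> (real \<Rightarrow> real) \<Rightarrow> (real \<Rightarrow> real) \<Rightarrow> real \<Rightarrow> real \<Rightarrow> real \<Rightarrow> real \<Rightarrow> real \<Rightarrow> (real \<Rightarrow> real) \<Rightarrow> bool"
where
  "upper_solution I D f \<alpha> \<beta> \<eta> \<epsilon> l \<phi> \<longleftrightarrow>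
     bvp_solution I D f \<alpha> \<beta> \<epsilon> l \<phi> \<and>
     (\<forall>x\<in>{-(l/2)<..<l/2}. \<phi> x > (\<alpha> + \<beta>) / 2) \<and> \<bar>\<phi> 0 - \<beta>\<bar> < \<eta>"

definition lower_solution ::
  "real set \<Rightarrow> (real \<Rightarrow> real) \<Rightarrow> (real \<Rightarrow> real) \<Rightarrow> real \<Rightarrow> real \<Rightarrow> real \<Rightarrow> real \<Rightarrow> real \<Rightarrow> (real \<Rightarrow> real) \<Rightarrow> bool"
where
  "lower_solution I D f \<alpha> \<beta> \<eta> \<epsilon> l \<phi> \<longleftrightarrow>
     bvp_solution I D f \<alpha> \<beta> \<epsilon> l \<phi> \<and>
     (\<forall>x\<in>{-(l/2)<..<l/2}. \<phi> x < (\<alpha> + \<beta>) / 2) \<and> \<bar>\<phi> 0 - \<alpha>\<bar> < \<eta>"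

definition admissible_constants ::
  "real set \<Rightarrow> (real \<Rightarrow> real) \<Rightarrow> (real \<Rightarrow> real) \<Rightarrow> real \<Rightarrow> real \<Rightarrow> real \<Rightarrow> real \<Rightarrow> bool"
where
  "admissible_constants I D f \<alpha> \<beta> \<rho>\<^sub>0 \<eta> \<longleftrightarrow>
     \<rho>\<^sub>0 > 0 \<and> \<eta> > 0 \<and>
     (\<forall>\<epsilon>>0. \<forall>l>0. \<epsilon> / l < \<rho>\<^sub>0 \<longrightarrow>
        (\<exists>!\<phi>. upper_solution I D f \<alpha> \<beta> \<eta> \<epsilon> l \<phi>) \<and>
        (\<exists>!\<phi>. lower_solution I D f \<alpha> \<beta> \<eta> \<epsilon> l \<phi>))"

text \<open>\<open>phi_plus\<close> and \<open>phi_minus\<close> are meaningful for admissible constants and \<open>\<epsilon> / l < \<rho>\<^sub>0\<close>.\<close>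

definition phi_plus ::
  "real set \<Rightarrow> (real \<Rightarrow> real) \<Rightarrow> (real \<Rightarrow> real) \<Rightarrow> real \<Rightarrow> real \<Rightarrow> real \<Rightarrow> real \<Rightarrow> real \<Rightarrow> real \<Rightarrow> real"
where
  "phi_plus I D f \<alpha> \<beta> \<eta> \<epsilon> l = (THE \<phi>. upper_solution I D f \<alpha> \<beta> \<eta> \<epsilon> l \<phi>)"

definition phi_minus ::
  "real set \<Rightarrow> (real \<Rightarrow> real) \<Rightarrow> (real \<Rightarrow> real) \<Rightarrow> real \<Rightarrow> real \<Rightarrow> real \<Rightarrow> real \<Rightarrow> real \<Rightarrow> real \<Rightarrow> real"
where
  "phi_minus I D f \<alpha> \<beta> \<eta> \<epsilon> l = (THE \<phi>. lower_solution I D f \<alpha> \<beta> \<eta> \<epsilon> l \<phi>)"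

text \<open>
  The following quantities depend on \<open>\<epsilon>\<close> and \<open>l\<close> only through \<open>\<epsilon> / l\<close> (by rescaling \<open>x\<close>);
  they are kept as functions of both, so that no representative has to be singled out.
\<close>

definition theta_plus ::
  "real set \<Rightarrow> (real \<Rightarrow> real) \<Rightarrow> (real \<Rightarrow> real) \<Rightarrow> real \<Rightarrow> real \<Rightarrow> real \<Rightarrow> real \<Rightarrow> real \<Rightarrow> real"
where
  "theta_plus I D f \<alpha> \<beta> \<eta> \<epsilon> l = potential D f \<alpha> (phi_plus I D f \<alpha> \<beta> \<eta> \<epsilon> l 0)"

definition theta_minus ::
  "real set \<Rightarrow> (real \<Rightarrow> real) \<Rightarrow> (real \<Rightarrow> real) \<Rightarrow> real \<Rightarrow> real \<Rightarrow> real \<Rightarrow> real \<Rightarrow> real \<Rightarrow> real"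
where
  "theta_minus I D f \<alpha> \<beta> \<eta> \<epsilon> l = potential D f \<alpha> (phi_minus I D f \<alpha> \<beta> \<eta> \<epsilon> l 0)"

definition delta_plus ::
  "real set \<Rightarrow> (real \<Rightarrow> real) \<Rightarrow> (real \<Rightarrow> real) \<Rightarrow> real \<Rightarrow> real \<Rightarrow> real \<Rightarrow> real \<Rightarrow> real \<Rightarrow> real"
where
  "delta_plus I D f \<alpha> \<beta> \<eta> \<epsilon> l = \<beta> - phi_plus I D f \<alpha> \<beta> \<eta> \<epsilon> l 0"

definition delta_minus ::
  "real set \<Rightarrow> (real \<Rightarrow> real) \<Rightarrow> (real \<Rightarrow> real) \<Rightarrow> real \<Rightarrow> real \<Rightarrow> real \<Rightarrow> real \<Rightarrow> real \<Rightarrow> real"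
where
  "delta_minus I D f \<alpha> \<beta> \<eta> \<epsilon> l = phi_minus I D f \<alpha> \<beta> \<eta> \<epsilon> l 0 - \<alpha>"

definition A_coeff :: "(real \<Rightarrow> real) \<Rightarrow> (real \<Rightarrow> real) \<Rightarrow> real \<Rightarrow> real \<Rightarrow> real" where
  "A_coeff D f \<alpha> \<gamma> = sqrt (deriv (deriv (potential D f \<alpha>)) \<gamma>) / D \<gamma>"

definition K_alpha :: "(real \<Rightarrow> real) \<Rightarrow> (real \<Rightarrow> real) \<Rightarrow> real \<Rightarrow> real \<Rightarrow> real" where
  "K_alpha D f \<alpha> \<beta> = (\<beta> - \<alpha>) *
     exp (LBINT t=\<alpha>..(\<alpha> + \<beta>) / 2.
       A_coeff D f \<alpha> \<alpha> * D t / sqrt (2 * potential D f \<alpha> t) - 1 / (t - \<alpha>))"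

definition K_beta :: "(real \<Rightarrow> real) \<Rightarrow> (real \<Rightarrow> real) \<Rightarrow> real \<Rightarrow> real \<Rightarrow> real" where
  "K_beta D f \<alpha> \<beta> = (\<beta> - \<alpha>) *
     exp (LBINT t=(\<alpha> + \<beta>) / 2..\<beta>.
       A_coeff D f \<alpha> \<beta> * D t / sqrt (2 * potential D f \<alpha> t) - 1 / (\<beta> - t))"

text \<open>
  \<open>Q = M(r) (1 + \<O>{g(r)})\<close> for \<open>r = \<epsilon> / l \<in> (0, r\<^sub>0)\<close>, the bound holding on the whole interval.
  The relative error \<open>E\<close> is a function of \<open>r\<close> alone, hence so is \<open>Q\<close>.
\<close>

definition asymptotic_below ::
  "real \<Rightarrow> (real \<Rightarrow> real \<Rightarrow> real) \<Rightarrow> (real \<Rightarrow> real) \<Rightarrow> (real \<Rightarrow> real) \<Rightarrow> bool"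
where
  "asymptotic_below r\<^sub>0 Q M g \<longleftrightarrow>
     (\<exists>E :: real \<Rightarrow> real.
        (\<exists>C. \<forall>r\<in>{0<..<r\<^sub>0}. \<bar>E r\<bar> \<le> C * g r) \<and>
        (\<forall>\<epsilon>>0. \<forall>l>0. \<epsilon> / l < r\<^sub>0 \<longrightarrow> Q \<epsilon> l = M (\<epsilon> / l) * (1 + E (\<epsilon> / l))))"

end

theory Submission
  imports Defs "HOL-Real_Asymp.Real_Asymp"
begin

text \<open>
  Multiplying the equation by \<open>D(\<phi>) \<phi>'\<close> gives the first integral
  \<open>\<epsilon>\<^sup>2 (D(\<phi>) \<phi>')\<^sup>2 / 2 = G(\<phi>) - G(\<phi>\<^sub>0)\<close>, where \<open>\<phi>\<^sub>0\<close> is the extremal value of \<open>\<phi>\<close>. A solution near \<open>\<gamma> \<in> {\<alpha>, \<beta>}\<close> is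
  thus determined by the distance \<open>\<delta> = \<bar>\<phi>\<^sub>0 - \<gamma>\<bar>\<close>. In terms of the distance \<open>s = \<bar>\<phi> - \<gamma>\<bar>\<close> and of
  \<open>H s = G(\<phi>)\<close>, separation of variables shows that \<open>\<delta>\<close> and \<open>r = \<epsilon> / l\<close> are related by \<open>T \<delta> = 1 / (2 r)\<close>, where the
  time map \<open>T \<delta>\<close> is the integral of \<open>D / sqrt (2 (H s - H \<delta>))\<close> from \<open>\<delta>\<close> to \<open>h = (\<beta> - \<alpha>) / 2\<close>.

  The inverse square root at \<open>s = \<delta>\<close> and the logarithmic divergence for \<open>\<delta> \<rightarrow> 0\<close> are resolved together.
  Because \<open>H\<close> has a nondegenerate zero, \<open>H s - H \<delta> = (s\<^sup>2 - \<delta>\<^sup>2) R s \<delta>\<close> with \<open>R\<close> bounded above and below by positive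
  constants, and \<open>s = \<delta> cosh z\<close> turns the time map into the integral of a continuous function over an interval
  of length \<open>arcosh (h / \<delta>)\<close>. The same coordinate \<open>z\<close> regularises the differential equation at its
  turning point, so a solution is obtained by inverting a primitive (\<open>solution_exists\<close>). Conversely,
  every solution close enough to \<open>\<gamma>\<close> at the centre has its only extremum there and follows the time
  map on both sides (\<open>sol_symmetric\<close>). Strict monotonicity of \<open>T\<close> for small \<open>\<delta>\<close> (\<open>T_strict_antimono\<close>)
  therefore gives uniqueness. The reaction term may change its sign between the boundary value and \<open>\<gamma>\<close>;
  both directions rest on the fact that \<open>H \<delta>\<close> lies below all values of \<open>H\<close> on \<open>(\<delta>, h]\<close> if \<open>\<delta>\<close> is small.

  For the expansion, subtract the singular part of the limiting integrand. This gives
  \<open>A T \<delta> = ln (K / \<delta>) + O(\<delta> (1 + T \<delta>))\<close> (\<open>T_asymptotic\<close>), where the convergent remainder is exactly the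
  integral in the exponent of \<open>K\<close>. Solving \<open>T \<delta> = 1 / (2 r)\<close> for \<open>\<delta>\<close> yields the expansion of \<open>\<delta>\<close>, and inserting
  it into \<open>H \<delta> = G''(\<gamma>) \<delta>\<^sup>2 / 2 (1 + O(\<delta>))\<close> yields that of \<open>\<theta>\<close> (\<open>delta_asymptotic\<close>).
\<close>

section \<open>Elementary inequalities\<close>

text \<open>
  The integral of a function bounded by \<open>B x\<close> over \<open>[a, b]\<close> is at most \<open>B (b\<^sup>2 - a\<^sup>2) / 2\<close>. The potential
  is quadratic at a zero of the reaction term, so all differences of potentials below are compared
  with \<open>b\<^sup>2 - a\<^sup>2\<close>, the factor that cancels the square-root singularity of the time map.
\<close>

lemma bounded_by_quadratic_derivative:
  fixes f f' :: "real \<Rightarrow> real"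
  assumes "0 \<le> a" "a \<le> b"
    and "\<And>x. a \<le> x \<Longrightarrow> x \<le> b \<Longrightarrow> (f has_real_derivative f' x) (at x)"
    and "\<And>x. a \<le> x \<Longrightarrow> x \<le> b \<Longrightarrow> \<bar>f' x\<bar> \<le> B * x"
  shows "\<bar>f b - f a\<bar> \<le> B * (b\<^sup>2 - a\<^sup>2) / 2"
proof -
  have "f b - B * b\<^sup>2 / 2 \<le> f a - B * a\<^sup>2 / 2"
  proof (rule DERIV_nonpos_imp_nonincreasing[OF \<open>a \<le> b\<close>])
    fix x assume x: "a \<le> x" "x \<le> b"
    have "((\<lambda>x. f x - B * x\<^sup>2 / 2) has_real_derivative f' x - B * x) (at x)"
      by (auto intro!: derivative_eq_intros assms(3) x)
    moreover have "f' x - B * x \<le> 0" using assms(4)[OF x] by linarith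
    ultimately show "\<exists>y. ((\<lambda>x. f x - B * x\<^sup>2 / 2) has_real_derivative y) (at x) \<and> y \<le> 0" by blast
  qed
  moreover have "f a + B * a\<^sup>2 / 2 \<le> f b + B * b\<^sup>2 / 2"
  proof (rule DERIV_nonneg_imp_nondecreasing[OF \<open>a \<le> b\<close>])
    fix x assume x: "a \<le> x" "x \<le> b"
    have "((\<lambda>x. f x + B * x\<^sup>2 / 2) has_real_derivative f' x + B * x) (at x)"
      by (auto intro!: derivative_eq_intros assms(3) x)
    moreover have "f' x + B * x \<ge> 0" using assms(4)[OF x] by linarith
    ultimately show "\<exists>y. ((\<lambda>x. f x + B * x\<^sup>2 / 2) has_real_derivative y) (at x) \<and> 0 \<le> y" by blast
  qed
  ultimately have "f b - f a \<le> B * b\<^sup>2 / 2 - B * a\<^sup>2 / 2" "f a - f b \<le> B * b\<^sup>2 / 2 - B * a\<^sup>2 / 2"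
    by linarith+
  then show ?thesis by (simp add: abs_le_iff right_diff_distrib diff_divide_distrib)
qed

lemma quotient_sqrt_Lipschitz:
  fixes D1 D2 R1 R2 m M :: real
  assumes "m > 0" "m / 2 \<le> R1" "m / 2 \<le> R2" "0 \<le> D1" "D1 \<le> M" "0 \<le> D2" "D2 \<le> M"
  shows "\<bar>D1 / sqrt (2 * R1) - D2 / sqrt (2 * R2)\<bar>
    \<le> (1 / sqrt m + M / (m * sqrt m)) * (\<bar>D1 - D2\<bar> + \<bar>R1 - R2\<bar>)"
proof -
  define a b c where "a = sqrt (2 * R1)" "b = sqrt (2 * R2)" "c = sqrt m"
  have c: "c > 0" "c * c = m" using assms by (auto simp: a_b_c_def)
  have ab: "c \<le> a" "c \<le> b" using assms by (auto simp: a_b_c_def)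
  have sq: "a * a = 2 * R1" "b * b = 2 * R2" using assms by (auto simp: a_b_c_def)
  have pos: "a > 0" "b > 0" using c ab by auto
  have "D1 / a - D2 / b = (D1 - D2) / a + D2 * (b * b - a * a) / (a * b * (a + b))"
  proof -
    have "D2 * (b * b - a * a) / (a * b * (a + b)) = D2 * ((b - a) * (a + b)) / ((a * b) * (a + b))"
      by (simp add: algebra_simps)
    also have "\<dots> = D2 * (b - a) / (a * b)" using pos by simp
    also have "\<dots> = D2 / a - D2 / b" using pos by (simp add: field_simps)
    finally show ?thesis by (simp add: diff_divide_distrib)
  qed
  also have "b * b - a * a = 2 * (R2 - R1)" using sq by simp
  finally have eq: "D1 / a - D2 / b = (D1 - D2) / a + D2 * (2 * (R2 - R1)) / (a * b * (a + b))" .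
  have "\<bar>(D1 - D2) / a\<bar> \<le> \<bar>D1 - D2\<bar> / c"
    using ab c pos by (simp add: abs_divide frac_le)
  moreover have "\<bar>D2 * (2 * (R2 - R1)) / (a * b * (a + b))\<bar> \<le> M / (m * c) * \<bar>R1 - R2\<bar>"
  proof -
    have "m * (c + c) \<le> a * b * (a + b)"
      unfolding c(2)[symmetric] using ab c pos by (intro mult_mono) auto
    then have "\<bar>D2 * (2 * (R2 - R1))\<bar> / (a * b * (a + b)) \<le> (M * (2 * \<bar>R1 - R2\<bar>)) / (m * (c + c))"
      using assms c pos by (intro frac_le) (auto simp: abs_mult abs_minus_commute[of R2 R1] simp del: right_diff_distrib_numeral intro!: mult_mono)
    moreover have "(M * (2 * \<bar>R1 - R2\<bar>)) / (m * (c + c)) = M / (m * c) * \<bar>R1 - R2\<bar>"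
      using c by (simp add: field_simps)
    moreover have "\<bar>D2 * (2 * (R2 - R1)) / (a * b * (a + b))\<bar> = \<bar>D2 * (2 * (R2 - R1))\<bar> / (a * b * (a + b))"
      unfolding abs_divide using pos by (simp add: abs_of_pos)
    ultimately show ?thesis by (simp only:)
  qed
  ultimately have "\<bar>D1 / a - D2 / b\<bar> \<le> \<bar>D1 - D2\<bar> / c + M / (m * c) * \<bar>R1 - R2\<bar>"
    unfolding eq by linarith
  also have "\<dots> \<le> (1 / c + M / (m * c)) * (\<bar>D1 - D2\<bar> + \<bar>R1 - R2\<bar>)"
  proof -
    have "0 \<le> M / (m * c) * \<bar>D1 - D2\<bar>" "0 \<le> 1 / c * \<bar>R1 - R2\<bar>" using assms c by auto
    then show ?thesis by (simp add: algebra_simps)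
  qed
  finally show ?thesis by (simp add: a_b_c_def)
qed

section \<open>Potentials with a nondegenerate zero\<close>

text \<open>
  Both zeros of the reaction term are treated at once through the distance \<open>s\<close> to the zero under
  consideration: \<open>H\<close> is the potential, \<open>F\<close> the reaction term and \<open>D\<close> the diffusivity as functions of \<open>s\<close>,
  and \<open>h\<close> is the distance from the zero to the midpoint of the two zeros. The function \<open>k\<close> is the
  continuous extension of \<open>F D / s\<close> to \<open>s = 0\<close>, where its value is the second derivative of the
  potential. The estimates rest on the Lipschitz continuity of \<open>D\<close> and \<open>k\<close>.
  The positivity of \<open>H\<close> also covers negative \<open>s\<close>, that is, values on the far side of the zero: it keeps
  solutions from going there.
\<close>

locale half_well =
  fixes J :: "real set" and D F H k :: "real \<Rightarrow> real" and h d L M m :: real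
  assumes h_pos: "h > 0" and sub: "{0..h} \<subseteq> J"
    and d_pos: "d > 0" and D_ge: "\<And>s. s \<in> J \<Longrightarrow> d \<le> D s"
    and H_deriv: "\<And>s. s \<in> J \<Longrightarrow> (H has_real_derivative F s * D s) (at s)"
    and H_0: "H 0 = 0"
    and H_pos: "\<And>s. s \<in> J \<Longrightarrow> s \<noteq> 0 \<Longrightarrow> s \<le> h \<Longrightarrow> 0 < H s"
    and FD_eq: "\<And>s. s \<in> {0..h} \<Longrightarrow> F s * D s = s * k s"
    and L_nonneg: "0 \<le> L"
    and D_Lip: "\<And>s t. s \<in> {0..h} \<Longrightarrow> t \<in> {0..h} \<Longrightarrow> \<bar>D s - D t\<bar> \<le> L * \<bar>s - t\<bar>"
    and k_Lip: "\<And>s t. s \<in> {0..h} \<Longrightarrow> t \<in> {0..h} \<Longrightarrow> \<bar>k s - k t\<bar> \<le> L * \<bar>s - t\<bar>"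
    and D_le: "\<And>s. s \<in> {0..h} \<Longrightarrow> D s \<le> M"
    and k_le: "\<And>s. s \<in> {0..h} \<Longrightarrow> \<bar>k s\<bar> \<le> M"
    and m_pos: "m > 0" and H_ge: "\<And>s. s \<in> {0..h} \<Longrightarrow> m * s\<^sup>2 \<le> H s"
begin

text \<open>
  Below the threshold \<open>e\<close> the energy level \<open>H \<delta>\<close> is attained on \<open>[\<delta>, h]\<close> at \<open>\<delta>\<close> only, with the uniform
  gap \<open>H s - H \<delta> \<ge> m (s\<^sup>2 - \<delta>\<^sup>2) / 2\<close>.
\<close>

definition e :: real where "e = min h (m / (L + 1))"

definition \<rho> :: "real \<Rightarrow> real" where "\<rho> s = (if s = 0 then k 0 / 2 else H s / s\<^sup>2)"

text \<open>
  \<open>R s \<delta>\<close> is the difference quotient of the potential in the variable \<open>s\<^sup>2\<close>, so that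
  \<open>D / sqrt (2 (H s - H \<delta>))\<close> is \<open>Q s \<delta> / sqrt (s\<^sup>2 - \<delta>\<^sup>2)\<close> with a bounded, continuous \<open>Q\<close>. \<open>Q0\<close> is the
  limit of \<open>Q\<close> for \<open>\<delta> \<rightarrow> 0\<close>, and \<open>B\<close> is a Lipschitz constant for all these functions.
\<close>

definition R :: "real \<Rightarrow> real \<Rightarrow> real" where
  "R s \<delta> = (if s = \<delta> then k \<delta> / 2 else (H s - H \<delta>) / (s\<^sup>2 - \<delta>\<^sup>2))"

definition Q :: "real \<Rightarrow> real \<Rightarrow> real" where "Q s \<delta> = D s / sqrt (2 * R s \<delta>)"
definition Q0 :: "real \<Rightarrow> real" where "Q0 s = D s / sqrt (2 * \<rho> s)"
definition B :: real where "B = 2 * (1 / sqrt m + M / (m * sqrt m)) * L"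

lemma in_J: "0 \<le> s \<Longrightarrow> s \<le> h \<Longrightarrow> s \<in> J" using sub by auto

lemma M_pos: "M > 0" using D_ge[of 0] D_le[of 0] d_pos h_pos in_J[of 0] by simp

lemma B_nonneg: "B \<ge> 0"
  unfolding B_def using L_nonneg m_pos M_pos by (intro mult_nonneg_nonneg add_nonneg_nonneg) auto

lemma e_pos: "e > 0" and e_le: "e \<le> h"
  unfolding e_def using h_pos m_pos L_nonneg by auto

lemma less_e: "\<delta> < e \<Longrightarrow> 0 < \<delta> \<Longrightarrow> L * \<delta> < m"
proof -
  assume a: "\<delta> < e" "0 < \<delta>"
  then have "\<delta> * (L + 1) < m" unfolding e_def using L_nonneg by (simp add: pos_less_divide_eq)
  then show ?thesis using a by (simp add: algebra_simps)
qed

lemma H_quadratic: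
  assumes "0 \<le> a" "a \<le> b" "b \<le> h" "\<And>x. a \<le> x \<Longrightarrow> x \<le> b \<Longrightarrow> \<bar>k x - c\<bar> \<le> C"
  shows "\<bar>H b - H a - c * (b\<^sup>2 - a\<^sup>2) / 2\<bar> \<le> C * (b\<^sup>2 - a\<^sup>2) / 2"
proof -
  have "\<bar>(H b - c * b\<^sup>2 / 2) - (H a - c * a\<^sup>2 / 2)\<bar> \<le> C * (b\<^sup>2 - a\<^sup>2) / 2"
  proof (rule bounded_by_quadratic_derivative[where f' = "\<lambda>x. F x * D x - c * x"])
    fix x assume x: "a \<le> x" "x \<le> b"
    show "((\<lambda>x. H x - c * x\<^sup>2 / 2) has_real_derivative F x * D x - c * x) (at x)"
      using x assms by (auto intro!: derivative_eq_intros H_deriv in_J)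
    have "F x * D x - c * x = x * (k x - c)" using FD_eq[of x] x assms by (simp add: algebra_simps)
    then have "\<bar>F x * D x - c * x\<bar> = \<bar>k x - c\<bar> * x" using x assms(1) by (simp add: abs_mult)
    also have "\<dots> \<le> C * x" using assms(4)[OF x] x assms(1) by (intro mult_right_mono) auto
    finally show "\<bar>F x * D x - c * x\<bar> \<le> C * x" .
  qed (use assms in auto)
  then show ?thesis by (simp add: algebra_simps diff_divide_distrib)
qed

text \<open>
  The scaled potential \<open>H (p x) / p\<^sup>2\<close> has the derivative \<open>x k (p x)\<close>, which is Lipschitz continuous in
  the scale \<open>p\<close>. Integration keeps the factor \<open>b\<^sup>2 - a\<^sup>2\<close>, by which differences of the potential are divided
  in the time map.
\<close>

lemma H_scaled:
  assumes "0 < p" "0 < q" "0 \<le> a" "a \<le> b" "p * b \<le> h" "q * b \<le> h"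
  shows "\<bar>(H (p * b) - H (p * a)) / p\<^sup>2 - (H (q * b) - H (q * a)) / q\<^sup>2\<bar>
    \<le> L * \<bar>p - q\<bar> * b * (b\<^sup>2 - a\<^sup>2) / 2"
proof -
  have "\<bar>(H (p * b) / p\<^sup>2 - H (q * b) / q\<^sup>2) - (H (p * a) / p\<^sup>2 - H (q * a) / q\<^sup>2)\<bar>
     \<le> (L * \<bar>p - q\<bar> * b) * (b\<^sup>2 - a\<^sup>2) / 2"
  proof (rule bounded_by_quadratic_derivative[where f = "\<lambda>x. H (p * x) / p\<^sup>2 - H (q * x) / q\<^sup>2"
        and f' = "\<lambda>x. x * (k (p * x) - k (q * x))"])
    fix x assume x: "a \<le> x" "x \<le> b"
    have px: "0 \<le> p * x" "p * x \<le> h" "0 \<le> q * x" "q * x \<le> h"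
      using x assms by (auto intro: order_trans[OF mult_left_mono])
    have "((\<lambda>x. H (p * x) / p\<^sup>2 - H (q * x) / q\<^sup>2) has_real_derivative
      (F (p * x) * D (p * x)) * p / p\<^sup>2 - (F (q * x) * D (q * x)) * q / q\<^sup>2) (at x)"
      by (rule DERIV_diff[OF DERIV_cdivide[OF DERIV_chain2[OF H_deriv[OF in_J]]]
            DERIV_cdivide[OF DERIV_chain2[OF H_deriv[OF in_J]]]])
         (auto intro!: derivative_eq_intros px)
    moreover have "(F (p * x) * D (p * x)) * p / p\<^sup>2 - (F (q * x) * D (q * x)) * q / q\<^sup>2 = x * (k (p * x) - k (q * x))"
      using FD_eq[of "p * x"] FD_eq[of "q * x"] px assms by (simp add: power2_eq_square field_simps)
    ultimately show "((\<lambda>x. H (p * x) / p\<^sup>2 - H (q * x) / q\<^sup>2) has_real_derivative x * (k (p * x) - k (q * x))) (at x)"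
      by simp
    have "\<bar>k (p * x) - k (q * x)\<bar> \<le> L * \<bar>p * x - q * x\<bar>" using k_Lip px by auto
    also have "\<bar>p * x - q * x\<bar> = \<bar>p - q\<bar> * x" using x assms
      by (metis abs_mult abs_of_nonneg left_diff_distrib order_trans)
    also have "L * (\<bar>p - q\<bar> * x) \<le> L * (\<bar>p - q\<bar> * b)" using x L_nonneg by (intro mult_left_mono) auto
    finally show "\<bar>x * (k (p * x) - k (q * x))\<bar> \<le> L * \<bar>p - q\<bar> * b * x"
      using mult_left_mono[of "\<bar>k (p * x) - k (q * x)\<bar>" "L * (\<bar>p - q\<bar> * b)" x] x assms(3)
      unfolding abs_mult by (simp add: mult_ac)
  qed (use assms in auto)
  then show ?thesis by (simp add: algebra_simps diff_divide_distrib)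
qed

lemma rho_0_close: "0 \<le> s \<Longrightarrow> s \<le> h \<Longrightarrow> \<bar>\<rho> s - \<rho> 0\<bar> \<le> L * s / 2"
proof (cases "s = 0")
  case False
  assume s: "0 \<le> s" "s \<le> h"
  have "\<bar>H s - H 0 - k 0 * (s\<^sup>2 - 0\<^sup>2) / 2\<bar> \<le> (L * s) * (s\<^sup>2 - 0\<^sup>2) / 2"
  proof (rule H_quadratic)
    fix x assume x: "0 \<le> x" "x \<le> s"
    have "\<bar>k x - k 0\<bar> \<le> L * \<bar>x - 0\<bar>" using x s by (intro k_Lip) auto
    also have "\<dots> \<le> L * s" using x L_nonneg by (auto intro: mult_left_mono)
    finally show "\<bar>k x - k 0\<bar> \<le> L * s" .
  qed (use s in auto)
  then have "\<bar>H s - k 0 * s\<^sup>2 / 2\<bar> / s\<^sup>2 \<le> L * s * s\<^sup>2 / 2 / s\<^sup>2"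
    using H_0 by (intro divide_right_mono) auto
  also have "\<bar>H s - k 0 * s\<^sup>2 / 2\<bar> / s\<^sup>2 = \<bar>(H s - k 0 * s\<^sup>2 / 2) / s\<^sup>2\<bar>" by simp
  also have "(H s - k 0 * s\<^sup>2 / 2) / s\<^sup>2 = \<rho> s - \<rho> 0" using False by (simp add: \<rho>_def field_simps)
  finally show ?thesis using False by simp
qed auto

lemma rho_Lip:
  assumes "0 < s" "s \<le> h" "0 < t" "t \<le> h"
  shows "\<bar>\<rho> s - \<rho> t\<bar> \<le> L * \<bar>s - t\<bar> / 2"
  using H_scaled[of s t 0 1] assms H_0 by (simp add: \<rho>_def)

text \<open>
  Only \<open>\<rho> 0\<close> needs an argument: it is the limit of the values \<open>\<rho> s\<close>, which are at least \<open>m\<close>.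
\<close>

lemma rho_ge: "0 \<le> s \<Longrightarrow> s \<le> h \<Longrightarrow> m \<le> \<rho> s"
proof (cases "s = 0")
  case False
  assume s: "0 \<le> s" "s \<le> h"
  then show ?thesis using H_ge[of s] False by (simp add: \<rho>_def pos_le_divide_eq)
next
  case True
  have "m \<le> \<rho> 0"
  proof (rule field_le_epsilon)
    fix t :: real assume t: "0 < t"
    define s where "s = min h (t / (L + 1))"
    have s: "0 < s" "s \<le> h" using t h_pos L_nonneg by (auto simp: s_def)
    have "s \<le> t / (L + 1)" by (simp add: s_def)
    then have "s * (L + 1) \<le> t" using L_nonneg by (simp add: pos_le_divide_eq)
    then have "L * s \<le> t" using s by (simp add: algebra_simps)
    moreover have "m \<le> \<rho> s" using H_ge[of s] s by (simp add: \<rho>_def pos_le_divide_eq)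
    moreover have "\<bar>\<rho> s - \<rho> 0\<bar> \<le> L * s / 2" using s rho_0_close by simp
    moreover have "0 \<le> L * s" using L_nonneg s by simp
    ultimately show "m \<le> \<rho> 0 + t" by linarith
  qed
  then show ?thesis using True by simp
qed

text \<open>
  The identity \<open>R s \<delta> = \<rho> s + \<delta>\<^sup>2 (\<rho> s - \<rho> \<delta>) / (s\<^sup>2 - \<delta>\<^sup>2)\<close> turns the Lipschitz continuity of \<open>\<rho>\<close> into an
  error of order \<open>\<delta>\<close>, uniformly up to \<open>s = \<delta>\<close>. In particular \<open>R\<close> inherits a positive lower bound from \<open>\<rho>\<close>,
  however many wells the potential has between \<open>\<delta>\<close> and \<open>h\<close>.
\<close>

lemma R_close_rho:
  assumes "0 < \<delta>" "\<delta> \<le> s" "s \<le> h"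
  shows "\<bar>R s \<delta> - \<rho> s\<bar> \<le> L * \<delta> / 2"
proof (cases "s = \<delta>")
  case True
  have "\<bar>H \<delta> - H 0 - k \<delta> * (\<delta>\<^sup>2 - 0\<^sup>2) / 2\<bar> \<le> (L * \<delta>) * (\<delta>\<^sup>2 - 0\<^sup>2) / 2"
  proof (rule H_quadratic)
    fix x assume x: "0 \<le> x" "x \<le> \<delta>"
    have "\<bar>k x - k \<delta>\<bar> \<le> L * \<bar>x - \<delta>\<bar>" using x assms by (intro k_Lip) auto
    also have "\<dots> \<le> L * \<delta>" using x L_nonneg by (auto intro: mult_left_mono)
    finally show "\<bar>k x - k \<delta>\<bar> \<le> L * \<delta>" .
  qed (use assms in auto)
  then have "\<bar>H \<delta> - k \<delta> * \<delta>\<^sup>2 / 2\<bar> / \<delta>\<^sup>2 \<le> L * \<delta> * \<delta>\<^sup>2 / 2 / \<delta>\<^sup>2"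
    using H_0 by (intro divide_right_mono) auto
  also have "\<bar>H \<delta> - k \<delta> * \<delta>\<^sup>2 / 2\<bar> / \<delta>\<^sup>2 = \<bar>(H \<delta> - k \<delta> * \<delta>\<^sup>2 / 2) / \<delta>\<^sup>2\<bar>" by simp
  also have "(H \<delta> - k \<delta> * \<delta>\<^sup>2 / 2) / \<delta>\<^sup>2 = \<rho> s - R s \<delta>"
    using True assms by (simp add: \<rho>_def R_def field_simps)
  finally show ?thesis using assms by (simp add: abs_minus_commute)
next
  case False
  then have s: "\<delta> < s" using assms by simp
  have ne: "s\<^sup>2 - \<delta>\<^sup>2 = (s - \<delta>) * (s + \<delta>)" by (simp add: power2_eq_square algebra_simps)
  have "R s \<delta> - \<rho> s = \<delta>\<^sup>2 * (\<rho> s - \<rho> \<delta>) / (s\<^sup>2 - \<delta>\<^sup>2)"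
  proof -
    have nz: "s\<^sup>2 - \<delta>\<^sup>2 \<noteq> 0" "s \<noteq> 0" "\<delta> \<noteq> 0" using s assms unfolding ne by auto
    have H: "H s = \<rho> s * s\<^sup>2" "H \<delta> = \<rho> \<delta> * \<delta>\<^sup>2" using nz by (auto simp: \<rho>_def)
    have "R s \<delta> = (\<rho> s * s\<^sup>2 - \<rho> \<delta> * \<delta>\<^sup>2) / (s\<^sup>2 - \<delta>\<^sup>2)" using False H by (simp add: R_def)
    then show ?thesis using nz(1) by (simp add: divide_simps) (simp add: algebra_simps)
  qed
  also have "\<bar>\<dots>\<bar> = \<delta>\<^sup>2 * \<bar>\<rho> s - \<rho> \<delta>\<bar> / ((s - \<delta>) * (s + \<delta>))"
    unfolding ne using s assms by (simp add: abs_mult)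
  also have "\<dots> \<le> \<delta>\<^sup>2 * (L * \<bar>s - \<delta>\<bar> / 2) / ((s - \<delta>) * (s + \<delta>))"
    using s assms rho_Lip[of s \<delta>] by (intro divide_right_mono mult_left_mono) auto
  also have "\<dots> = (s - \<delta>) * (\<delta>\<^sup>2 * L / 2) / ((s - \<delta>) * (s + \<delta>))" using s by (simp add: mult_ac)
  also have "\<dots> = (\<delta>\<^sup>2 * L / 2) / (s + \<delta>)" using s by (subst mult_divide_mult_cancel_left) auto
  also have "\<dots> = L * \<delta> / 2 * (\<delta> / (s + \<delta>))" by (simp add: power2_eq_square)
  also have "\<dots> \<le> L * \<delta> / 2 * 1" using s assms L_nonneg by (intro mult_left_mono) auto
  finally show ?thesis by simp
qed

lemma R_ge:
  assumes "0 < \<delta>" "\<delta> < e" "\<delta> \<le> s" "s \<le> h"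
  shows "m / 2 \<le> R s \<delta>"
  using R_close_rho[of \<delta> s] rho_ge[of s] less_e[of \<delta>] assms by linarith

lemma R_le:
  assumes "0 < \<delta>" "\<delta> \<le> s" "s \<le> h"
  shows "R s \<delta> \<le> M / 2"
proof (cases "s = \<delta>")
  case True
  then show ?thesis using k_le[of \<delta>] assms by (simp add: R_def)
next
  case False
  have "\<bar>H s - H \<delta> - 0 * (s\<^sup>2 - \<delta>\<^sup>2) / 2\<bar> \<le> M * (s\<^sup>2 - \<delta>\<^sup>2) / 2"
    by (rule H_quadratic) (use assms k_le in auto)
  moreover have "s\<^sup>2 - \<delta>\<^sup>2 > 0" using False assms by (simp add: power_strict_mono)
  moreover have "H s - H \<delta> \<le> \<bar>H s - H \<delta> - 0 * (s\<^sup>2 - \<delta>\<^sup>2) / 2\<bar>" by simp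
  ultimately have "H s - H \<delta> \<le> M / 2 * (s\<^sup>2 - \<delta>\<^sup>2)" by linarith
  then show ?thesis using False \<open>s\<^sup>2 - \<delta>\<^sup>2 > 0\<close> unfolding R_def by (simp only: pos_divide_le_eq if_False)
qed

lemma H_diff_eq:
  assumes "0 < \<delta>" "\<delta> \<le> s"
  shows "H s - H \<delta> = (s\<^sup>2 - \<delta>\<^sup>2) * R s \<delta>"
proof (cases "s = \<delta>")
  case False
  then have "s\<^sup>2 - \<delta>\<^sup>2 > 0" using assms by (simp add: power_strict_mono)
  then show ?thesis using False by (simp add: R_def)
qed (simp add: R_def)

lemma H_less:
  assumes "0 < \<delta>" "\<delta> < e" "\<delta> < s" "s \<le> h"
  shows "H \<delta> < H s"
proof -
  have "s\<^sup>2 - \<delta>\<^sup>2 > 0" using assms by (simp add: power_strict_mono)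
  then have "0 < (s\<^sup>2 - \<delta>\<^sup>2) * R s \<delta>" using R_ge[of \<delta> s] assms m_pos by simp
  then show ?thesis using H_diff_eq[of \<delta> s] assms by simp
qed

lemma F_pos:
  assumes "0 < \<delta>" "\<delta> < e"
  shows "0 < F \<delta>"
proof -
  have dh: "\<delta> \<in> {0..h}" using assms e_le by auto
  have "0 < k \<delta>" using R_ge[of \<delta> \<delta>] m_pos assms e_le by (simp add: R_def)
  then have "0 < F \<delta> * D \<delta>" using FD_eq[OF dh] assms by simp
  moreover have "0 < D \<delta>" using D_ge[of \<delta>] d_pos sub dh by auto
  ultimately show ?thesis by (simp add: zero_less_mult_iff)
qed

text \<open>
  At a fixed ratio \<open>c = s / \<delta>\<close> the dependence on \<open>\<delta>\<close> is Lipschitz with a constant proportional to \<open>c\<close>; the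
  factor \<open>c\<^sup>2 - 1\<close> of the previous comparison of scales cancels the denominator of \<open>R\<close>.
\<close>

lemma R_scaled_Lip:
  assumes "0 < p" "0 < q" "1 \<le> c" "p * c \<le> h" "q * c \<le> h"
  shows "\<bar>R (p * c) p - R (q * c) q\<bar> \<le> L * c * \<bar>p - q\<bar> / 2"
proof (cases "c = 1")
  case True
  have "\<bar>k p - k q\<bar> \<le> L * \<bar>p - q\<bar>" using assms True by (intro k_Lip) auto
  moreover have "\<bar>k p / 2 - k q / 2\<bar> = \<bar>k p - k q\<bar> / 2" by (simp flip: diff_divide_distrib)
  ultimately show ?thesis using True by (simp add: R_def)
next
  case False
  then have c: "c\<^sup>2 - 1 > 0" using assms by simp
  have R: "R (x * c) x = (H (x * c) - H (x * 1)) / x\<^sup>2 / (c\<^sup>2 - 1)" if "x > 0" for x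
  proof -
    have "(x * c)\<^sup>2 - x\<^sup>2 = x\<^sup>2 * (c\<^sup>2 - 1)" by (simp add: power_mult_distrib algebra_simps)
    then show ?thesis using that False by (simp add: R_def)
  qed
  have "\<bar>R (p * c) p - R (q * c) q\<bar>
      = \<bar>(H (p * c) - H (p * 1)) / p\<^sup>2 - (H (q * c) - H (q * 1)) / q\<^sup>2\<bar> / (c\<^sup>2 - 1)"
    using R[OF assms(1)] R[OF assms(2)] c
    by (metis abs_divide abs_of_pos diff_divide_distrib)
  also have "\<dots> \<le> (L * \<bar>p - q\<bar> * c * (c\<^sup>2 - 1\<^sup>2) / 2) / (c\<^sup>2 - 1)"
    using c assms by (intro divide_right_mono H_scaled) auto
  also have "\<dots> = L * c * \<bar>p - q\<bar> / 2" using c by (simp add: nonzero_divide_eq_eq)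
  finally show ?thesis .
qed

lemma Q_scaled_Lip:
  assumes "0 < p" "p < e" "0 < q" "q < e" "1 \<le> c" "p * c \<le> h" "q * c \<le> h"
  shows "\<bar>Q (p * c) p - Q (q * c) q\<bar> \<le> B * c * \<bar>p - q\<bar>"
proof -
  let ?C = "1 / sqrt m + M / (m * sqrt m)"
  have pc: "p \<le> p * c" "q \<le> q * c" "p * c \<in> {0..h}" "q * c \<in> {0..h}" using assms by auto
  have "\<bar>Q (p * c) p - Q (q * c) q\<bar> \<le> ?C * (\<bar>D (p * c) - D (q * c)\<bar> + \<bar>R (p * c) p - R (q * c) q\<bar>)"
    unfolding Q_def
    using pc assms D_le[of "p * c"] D_le[of "q * c"] D_ge[of "p * c"] D_ge[of "q * c"] d_pos
      in_J[of "p * c"] in_J[of "q * c"] m_pos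
    by (intro quotient_sqrt_Lipschitz R_ge) auto
  also have "\<dots> \<le> ?C * (L * c * \<bar>p - q\<bar> + L * c * \<bar>p - q\<bar>)"
  proof (intro mult_left_mono add_mono)
    have "\<bar>D (p * c) - D (q * c)\<bar> \<le> L * \<bar>p * c - q * c\<bar>" using D_Lip pc by auto
    also have "\<dots> = L * c * \<bar>p - q\<bar>" using assms
      by (metis abs_mult abs_of_nonneg left_diff_distrib mult.assoc mult.commute order_trans zero_le_one)
    finally show "\<bar>D (p * c) - D (q * c)\<bar> \<le> L * c * \<bar>p - q\<bar>" .
    have "0 \<le> L * c * \<bar>p - q\<bar>" using L_nonneg assms by simp
    then show "\<bar>R (p * c) p - R (q * c) q\<bar> \<le> L * c * \<bar>p - q\<bar>"
      using R_scaled_Lip[of p q c] assms by linarith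
    show "0 \<le> ?C" using m_pos M_pos by (intro add_nonneg_nonneg) auto
  qed
  also have "\<dots> = B * c * \<bar>p - q\<bar>" by (simp add: B_def algebra_simps)
  finally show ?thesis .
qed

lemma Q_close_Q0:
  assumes "0 < \<delta>" "\<delta> < e" "\<delta> \<le> s" "s \<le> h"
  shows "\<bar>Q s \<delta> - Q0 s\<bar> \<le> B * \<delta>"
proof -
  let ?C = "1 / sqrt m + M / (m * sqrt m)"
  have C: "0 \<le> ?C" using m_pos M_pos by (intro add_nonneg_nonneg) auto
  have "\<bar>Q s \<delta> - Q0 s\<bar> \<le> ?C * (\<bar>D s - D s\<bar> + \<bar>R s \<delta> - \<rho> s\<bar>)"
    unfolding Q_def Q0_def
    using assms D_le[of s] D_ge[of s] d_pos in_J[of s] m_pos rho_ge[of s]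
    by (intro quotient_sqrt_Lipschitz R_ge) auto
  also have "\<dots> \<le> ?C * (2 * (L * \<delta>))"
  proof (rule mult_left_mono[OF _ C])
    have "0 \<le> L * \<delta>" using L_nonneg assms by simp
    then show "\<bar>D s - D s\<bar> + \<bar>R s \<delta> - \<rho> s\<bar> \<le> 2 * (L * \<delta>)" using R_close_rho[of \<delta> s] assms by simp
  qed
  also have "\<dots> = B * \<delta>" by (simp add: B_def algebra_simps)
  finally show ?thesis .
qed

lemma Q0_close:
  assumes "0 \<le> s" "s \<le> h"
  shows "\<bar>Q0 s - Q0 0\<bar> \<le> B * s"
proof -
  let ?C = "1 / sqrt m + M / (m * sqrt m)"
  have C: "0 \<le> ?C" using m_pos M_pos by (intro add_nonneg_nonneg) auto
  have "\<bar>Q0 s - Q0 0\<bar> \<le> ?C * (\<bar>D s - D 0\<bar> + \<bar>\<rho> s - \<rho> 0\<bar>)"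
    unfolding Q0_def
    using assms D_le[of s] D_ge[of s] D_le[of 0] D_ge[of 0] d_pos in_J[of 0] in_J[of s] m_pos
      rho_ge[of s] rho_ge[of 0]
    by (intro quotient_sqrt_Lipschitz) auto
  also have "\<dots> \<le> ?C * (2 * (L * s))"
  proof (rule mult_left_mono[OF _ C])
    have "0 \<le> L * s" using L_nonneg assms by simp
    then show "\<bar>D s - D 0\<bar> + \<bar>\<rho> s - \<rho> 0\<bar> \<le> 2 * (L * s)"
      using rho_0_close[of s] D_Lip[of s 0] assms by simp
  qed
  also have "\<dots> = B * s" by (simp add: B_def algebra_simps)
  finally show ?thesis .
qed

lemma Q_bounds:
  assumes "0 < \<delta>" "\<delta> < e" "\<delta> \<le> s" "s \<le> h"
  shows "d / sqrt M \<le> Q s \<delta>" "Q s \<delta> \<le> M / sqrt m"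
proof -
  have R: "m / 2 \<le> R s \<delta>" "R s \<delta> \<le> M / 2" using R_ge R_le assms by auto
  have D: "d \<le> D s" "D s \<le> M" using D_le[of s] D_ge[of s] in_J[of s] assms by auto
  have s: "sqrt m \<le> sqrt (2 * R s \<delta>)" "sqrt (2 * R s \<delta>) \<le> sqrt M" using R by auto
  have "0 < sqrt (2 * R s \<delta>)" using R m_pos by simp
  then show "d / sqrt M \<le> Q s \<delta>" unfolding Q_def using D s d_pos by (intro frac_le) auto
  show "Q s \<delta> \<le> M / sqrt m" unfolding Q_def using D s d_pos m_pos by (intro frac_le) auto
qed

lemma Q_pos:
  assumes "0 < \<delta>" "\<delta> < e" "\<delta> \<le> s" "s \<le> h"
  shows "0 < Q s \<delta>"
  using Q_bounds(1)[OF assms] d_pos M_pos by (smt (verit) divide_pos_pos real_sqrt_gt_0_iff)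

lemma continuous_on_D: "continuous_on {0..h} D"
proof -
  have "L-lipschitz_on {0..h} D" using D_Lip L_nonneg by (auto simp: lipschitz_on_def dist_real_def)
  then show ?thesis by (rule lipschitz_on_continuous_on)
qed

text \<open>
  Continuity at the corner \<open>s = \<delta>\<close> is the differentiability of the potential there.
\<close>

lemma continuous_on_R:
  assumes "0 < \<delta>"
  shows "continuous_on {\<delta>..h} (\<lambda>s. R s \<delta>)"
proof (cases "\<delta> \<le> h")
  case True
  have "(H has_real_derivative \<delta> * k \<delta>) (at \<delta>)"
    using H_deriv[of \<delta>] FD_eq[of \<delta>] in_J[of \<delta>] True assms by simp
  then obtain g where g: "\<And>z. H z - H \<delta> = g z * (z - \<delta>)" "isCont g \<delta>" "g \<delta> = \<delta> * k \<delta>"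
    unfolding CARAT_DERIV by metis
  have R: "R s \<delta> = g s / (s + \<delta>)" if "s \<ge> \<delta>" for s
  proof (cases "s = \<delta>")
    case False
    have "s\<^sup>2 - \<delta>\<^sup>2 = (s - \<delta>) * (s + \<delta>)" by (simp add: power2_eq_square algebra_simps)
    then show ?thesis using False g(1)[of s] that assms by (simp add: R_def)
  qed (use assms g in \<open>simp add: R_def\<close>)
  have "continuous_on {\<delta>..h} g"
  proof (rule continuous_at_imp_continuous_on, rule ballI)
    fix s assume s: "s \<in> {\<delta>..h}"
    show "isCont g s"
    proof (cases "s = \<delta>")
      case False
      have "isCont (\<lambda>z. (H z - H \<delta>) / (z - \<delta>)) s"
        using False s assms by (intro continuous_intros DERIV_isCont[OF H_deriv] in_J) auto
      moreover have "\<forall>\<^sub>F z in nhds s. (H z - H \<delta>) / (z - \<delta>) = g z"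
        using t1_space_nhds[OF False] by eventually_elim (simp add: g(1))
      ultimately show ?thesis by (subst isCont_cong[symmetric]) auto
    qed (use g in simp)
  qed
  then have "continuous_on {\<delta>..h} (\<lambda>s. g s / (s + \<delta>))"
    using assms by (intro continuous_intros) auto
  then show ?thesis by (rule continuous_on_eq) (auto simp: R)
qed auto

lemma continuous_on_Q:
  assumes "0 < \<delta>" "\<delta> < e"
  shows "continuous_on {\<delta>..h} (\<lambda>s. Q s \<delta>)"
  unfolding Q_def
proof (intro continuous_intros)
  show "continuous_on {\<delta>..h} D" by (rule continuous_on_subset[OF continuous_on_D]) (use assms in auto)
  show "continuous_on {\<delta>..h} (\<lambda>s. R s \<delta>)" by (rule continuous_on_R[OF assms(1)])
  show "\<forall>x\<in>{\<delta>..h}. sqrt (2 * R x \<delta>) \<noteq> 0"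
  proof
    fix x assume "x \<in> {\<delta>..h}"
    then have "m / 2 \<le> R x \<delta>" using assms by (intro R_ge) auto
    then show "sqrt (2 * R x \<delta>) \<noteq> 0" using m_pos by simp
  qed
qed

end

section \<open>The time map\<close>

text \<open>
  The left-hand side is a lower bound for \<open>ln (q / p)\<close>, by which \<open>arcosh\<close> increases at least when its
  argument is multiplied by \<open>q / p\<close>.
\<close>

lemma arcosh_scaled_diff_ge:
  fixes p q \<sigma> :: real
  assumes "0 < p" "p \<le> q" "q \<le> \<sigma>"
  shows "(q - p) / q \<le> arcosh (\<sigma> / p) - arcosh (\<sigma> / q)"
proof -
  define x y where "x = \<sigma> / p" "y = \<sigma> / q"
  have y: "1 \<le> y" "y \<le> x" using assms by (auto simp: x_y_def frac_le)
  have "(x / y) * sqrt (y\<^sup>2 - 1) = sqrt ((x / y)\<^sup>2 * (y\<^sup>2 - 1))" using y by (simp add: real_sqrt_mult)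
  also have "(x / y)\<^sup>2 * (y\<^sup>2 - 1) = x\<^sup>2 - (x / y)\<^sup>2" using y by (simp add: right_diff_distrib power_divide)
  also have "sqrt (x\<^sup>2 - (x / y)\<^sup>2) \<le> sqrt (x\<^sup>2 - 1)" using y by (simp add: one_le_power)
  finally have "(x / y) * (y + sqrt (y\<^sup>2 - 1)) \<le> x + sqrt (x\<^sup>2 - 1)" using y by (simp add: distrib_left)
  moreover have pos: "0 < x / y" "0 < y + sqrt (y\<^sup>2 - 1)"
    using y add_pos_nonneg[of y "sqrt (y\<^sup>2 - 1)"] by (auto simp: one_le_power)
  ultimately have "ln ((x / y) * (y + sqrt (y\<^sup>2 - 1))) \<le> ln (x + sqrt (x\<^sup>2 - 1))"
    by (intro ln_mono mult_pos_pos)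
  then have "ln (x / y) + arcosh y \<le> arcosh x"
    unfolding ln_mult_pos[OF pos] using y by (simp add: arcosh_real_def)
  moreover have "ln (p / q) \<le> p / q - 1" using assms by (intro ln_le_minus_one) auto
  moreover have "ln (x / y) = - ln (p / q)"
    using assms by (simp add: x_y_def ln_div)
  ultimately have "1 - p / q \<le> arcosh x - arcosh y" by linarith
  moreover have "1 - p / q = (q - p) / q" using assms by (simp add: diff_divide_distrib)
  ultimately show ?thesis by (simp add: x_y_def)
qed

context half_well
begin

text \<open>
  The substitution \<open>s = \<delta> cosh z\<close> turns \<open>ds / sqrt (s\<^sup>2 - \<delta>\<^sup>2)\<close> into \<open>dz\<close>. Hence \<open>T \<delta>\<close>, the integral of
  \<open>D / sqrt (2 (H s - H \<delta>))\<close> over \<open>[\<delta>, h]\<close> and thus the time from the extremal distance \<open>\<delta>\<close> to the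
  boundary distance \<open>h\<close>, becomes the integral of a continuous function. \<open>N \<sigma> \<delta>\<close> is the part of the
  time spent at distances at most \<open>\<sigma>\<close>.
\<close>

definition q :: "real \<Rightarrow> real \<Rightarrow> real" where "q \<delta> z = Q (\<delta> * cosh z) \<delta>"
definition N :: "real \<Rightarrow> real \<Rightarrow> real" where "N \<sigma> \<delta> = integral {0..arcosh (\<sigma> / \<delta>)} (q \<delta>)"
definition T :: "real \<Rightarrow> real" where "T \<delta> = N h \<delta>"

lemma cosh_range:
  fixes z :: real
  assumes "0 < \<delta>" "\<delta> \<le> \<sigma>" "\<bar>z\<bar> \<le> arcosh (\<sigma> / \<delta>)"
  shows "\<delta> \<le> \<delta> * cosh z" "\<delta> * cosh z \<le> \<sigma>"
proof -
  show "\<delta> \<le> \<delta> * cosh z" using assms cosh_real_ge_1[of z] by simp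
  have "cosh \<bar>z\<bar> \<le> cosh (arcosh (\<sigma> / \<delta>))"
    using assms by (subst cosh_real_nonneg_le_iff) auto
  then have "cosh z \<le> \<sigma> / \<delta>" using assms by (simp add: abs_if split: if_splits)
  then show "\<delta> * cosh z \<le> \<sigma>" using assms by (simp add: field_simps)
qed

lemma continuous_on_q:
  assumes "0 < \<delta>" "\<delta> < e"
  shows "continuous_on {- arcosh (h / \<delta>)..arcosh (h / \<delta>)} (q \<delta>)"
  unfolding q_def
  by (rule continuous_on_compose2[OF continuous_on_Q[OF assms]])
     (use cosh_range[of \<delta> h] assms e_le in \<open>auto intro!: continuous_intros\<close>)

lemma q_integrable:
  assumes "0 < \<delta>" "\<delta> < e" "- arcosh (h / \<delta>) \<le> a" "b \<le> arcosh (h / \<delta>)"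
  shows "q \<delta> integrable_on {a..b}"
  by (rule integrable_continuous_real, rule continuous_on_subset[OF continuous_on_q])
     (use assms in auto)

lemma q_bounds:
  fixes z :: real
  assumes "0 < \<delta>" "\<delta> < e" "\<bar>z\<bar> \<le> arcosh (h / \<delta>)"
  shows "d / sqrt M \<le> q \<delta> z" "q \<delta> z \<le> M / sqrt m" "0 < q \<delta> z"
  using Q_bounds[of \<delta> "\<delta> * cosh z"] Q_pos[of \<delta> "\<delta> * cosh z"] cosh_range[of \<delta> h z] assms e_le
  by (auto simp: q_def)

text \<open>
  The larger value \<open>r\<close> has the shorter range of \<open>z\<close>. On the common range the integrands differ by at most
  \<open>B (r - p) cosh z\<close>, whose integral has the factor \<open>\<sigma>\<close>; on the rest the bounds for \<open>Q\<close> enter. The second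
  contribution therefore decides the sign once \<open>\<sigma>\<close> is small.
\<close>

lemma N_diff:
  assumes "0 < p" "p \<le> r" "r < e" "r \<le> \<sigma>" "\<sigma> \<le> h"
  defines "Z \<equiv> arcosh (\<sigma> / p) - arcosh (\<sigma> / r)"
  shows "d / sqrt M * Z - B * (r - p) * (\<sigma> / r) \<le> N \<sigma> p - N \<sigma> r"
    and "N \<sigma> p - N \<sigma> r \<le> M / sqrt m * Z + B * (r - p) * (\<sigma> / r)"
proof -
  define y where "y = arcosh (\<sigma> / r)"
  define x where "x = arcosh (\<sigma> / p)"
  have r: "0 < r" "1 \<le> \<sigma> / r" "1 \<le> \<sigma> / p" "\<sigma> / r \<le> \<sigma> / p" using assms by (auto simp: frac_le)
  have y: "0 \<le> y" "y \<le> x" unfolding x_def y_def using r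
    by (auto simp: le_less arcosh_real_strict_mono)
  have hx: "x \<le> arcosh (h / p)" "y \<le> arcosh (h / r)"
  proof -
    have "\<sigma> / p \<le> h / p" "\<sigma> / r \<le> h / r" using assms r by (auto simp: divide_right_mono)
    moreover have mono: "arcosh u \<le> arcosh v" if "1 \<le> u" "u \<le> v" for u v :: real
      using that by (cases "u = v") (auto intro!: less_imp_le arcosh_real_strict_mono)
    ultimately show "x \<le> arcosh (h / p)" "y \<le> arcosh (h / r)" unfolding x_def y_def using r
      by (auto intro!: mono[of "\<sigma> / p" "h / p"] mono[of "\<sigma> / r" "h / r"] intro: order_trans)
  qed
  have int: "q p integrable_on {0..x}" "q p integrable_on {0..y}" "q p integrable_on {y..x}"
    "q r integrable_on {0..y}"
    using hx y assms by (auto intro!: q_integrable)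
  have "N \<sigma> p = integral {0..y} (q p) + integral {y..x} (q p)"
    unfolding N_def x_def[symmetric] using int y by (simp add: Henstock_Kurzweil_Integration.integral_combine)
  then have split: "N \<sigma> p - N \<sigma> r = integral {0..y} (\<lambda>z. q p z - q r z) + integral {y..x} (q p)"
    unfolding N_def y_def[symmetric] using int by (simp add: integral_diff)
  have "\<bar>integral {0..y} (\<lambda>z. q p z - q r z)\<bar> \<le> integral {0..y} (\<lambda>z. B * (r - p) * cosh z)"
  proof -
    have "norm (integral {0..y} (\<lambda>z. q p z - q r z)) \<le> integral {0..y} (\<lambda>z. B * (r - p) * cosh z)"
    proof (rule integral_norm_bound_integral)
      fix z assume z: "z \<in> {0..y}"
      have "\<bar>z\<bar> \<le> arcosh (\<sigma> / p)" "\<bar>z\<bar> \<le> arcosh (\<sigma> / r)" using z y by (auto simp: x_def y_def)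
      then have "p * cosh z \<le> \<sigma>" "r * cosh z \<le> \<sigma>" using assms r cosh_range by auto
      then have "\<bar>Q (p * cosh z) p - Q (r * cosh z) r\<bar> \<le> B * cosh z * \<bar>p - r\<bar>"
        using assms cosh_real_ge_1 by (intro Q_scaled_Lip) auto
      then show "norm (q p z - q r z) \<le> B * (r - p) * cosh z"
        using assms by (simp add: q_def mult_ac)
    next
      show "(\<lambda>z. q p z - q r z) integrable_on {0..y}" by (intro integrable_diff int)
      show "(\<lambda>z. B * (r - p) * cosh z) integrable_on {0..y}"
        by (intro integrable_continuous_real continuous_intros)
    qed
    then show ?thesis by simp
  qed
  also have "integral {0..y} (\<lambda>z. B * (r - p) * cosh z) = B * (r - p) * sinh y - B * (r - p) * sinh 0"
    using y(1) by (intro integral_unique fundamental_theorem_of_calculus)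
      (auto intro!: derivative_eq_intros simp flip: has_real_derivative_iff_has_vector_derivative)
  also have "\<dots> \<le> B * (r - p) * (\<sigma> / r)"
  proof -
    have "sinh y \<le> cosh y" by (simp add: sinh_le_cosh_real)
    also have "\<dots> = \<sigma> / r" unfolding y_def using r by simp
    finally have "B * (r - p) * sinh y \<le> B * (r - p) * (\<sigma> / r)"
      using B_nonneg assms by (intro mult_left_mono) auto
    then show ?thesis by simp
  qed
  finally have near: "\<bar>integral {0..y} (\<lambda>z. q p z - q r z)\<bar> \<le> B * (r - p) * (\<sigma> / r)" .
  have bd: "d / sqrt M \<le> q p z" "q p z \<le> M / sqrt m" if "z \<in> {y..x}" for z
    using q_bounds[of p z] that hx y assms by auto
  have "integral {y..x} (\<lambda>z. d / sqrt M) \<le> integral {y..x} (q p)"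
    using bd int by (intro integral_le) auto
  moreover have "integral {y..x} (q p) \<le> integral {y..x} (\<lambda>z. M / sqrt m)"
    using bd int by (intro integral_le) auto
  moreover have "Z = x - y" by (simp add: Z_def x_def y_def)
  ultimately have "d / sqrt M * Z \<le> integral {y..x} (q p)" "integral {y..x} (q p) \<le> M / sqrt m * Z"
    using y by (auto simp: mult.commute)
  then show "d / sqrt M * Z - B * (r - p) * (\<sigma> / r) \<le> N \<sigma> p - N \<sigma> r"
    "N \<sigma> p - N \<sigma> r \<le> M / sqrt m * Z + B * (r - p) * (\<sigma> / r)"
    unfolding split using near by linarith+
qed

lemma far_part:
  assumes "0 < \<delta>" "\<delta> < e" "\<delta> < \<sigma>" "\<sigma> \<le> h"
  shows "((\<lambda>s. D s / sqrt (2 * (H s - H \<delta>))) has_integral T \<delta> - N \<sigma> \<delta>) {\<sigma>..h}"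
proof -
  define f where "f s = D s / sqrt (2 * (H s - H \<delta>))" for s
  define a b where "a = arcosh (\<sigma> / \<delta>)" "b = arcosh (h / \<delta>)"
  have ge: "1 < \<sigma> / \<delta>" "\<sigma> / \<delta> \<le> h / \<delta>" using assms by (auto simp: divide_right_mono)
  have ab: "0 \<le> a" "a \<le> b" unfolding a_b_def using ge by (auto simp: le_less arcosh_real_strict_mono)
  have ends: "\<delta> * cosh a = \<sigma>" "\<delta> * cosh b = h" unfolding a_b_def using ge assms by auto
  have cf: "continuous_on {\<sigma>..h} f"
    unfolding f_def
  proof (intro continuous_intros)
    show "continuous_on {\<sigma>..h} D" by (rule continuous_on_subset[OF continuous_on_D]) (use assms in auto)
    show "continuous_on {\<sigma>..h} H"
      by (rule DERIV_continuous_on[OF DERIV_subset[OF H_deriv]]) (use assms in_J in auto)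
    show "\<forall>x\<in>{\<sigma>..h}. sqrt (2 * (H x - H \<delta>)) \<noteq> 0"
    proof
      fix x assume "x \<in> {\<sigma>..h}"
      then have "H \<delta> < H x" using assms by (intro H_less) auto
      then show "sqrt (2 * (H x - H \<delta>)) \<noteq> 0" by simp
    qed
  qed
  have "((\<lambda>z. (\<delta> * sinh z) *\<^sub>R f (\<delta> * cosh z)) has_integral (integral {\<delta> * cosh a..\<delta> * cosh b} f)) {a..b}"
  proof (rule has_integral_substitution[OF ab(2) _ _ cf])
    show "(\<lambda>z. \<delta> * cosh z) ` {a..b} \<subseteq> {\<sigma>..h}"
    proof clarsimp
      fix z assume z: "a \<le> z" "z \<le> b"
      have "cosh a \<le> cosh z" "cosh z \<le> cosh b" using z ab by (auto simp: cosh_real_nonneg_le_iff)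
      then have "\<delta> * cosh a \<le> \<delta> * cosh z" "\<delta> * cosh z \<le> \<delta> * cosh b" using assms by auto
      then show "\<sigma> \<le> \<delta> * cosh z \<and> \<delta> * cosh z \<le> h" using ends by simp
    qed
    show "\<delta> * cosh a \<le> \<delta> * cosh b" using ends assms by simp
  qed (auto intro!: derivative_eq_intros)
  moreover have eq: "(\<delta> * sinh z) *\<^sub>R f (\<delta> * cosh z) = q \<delta> z" if z: "z \<in> {a..b}" "z > 0" for z
  proof -
    have s: "0 < sinh z" using z by simp
    have "\<delta> * 1 < \<delta> * cosh z" using assms z cosh_real_strict_mono[of 0 z] by (intro mult_strict_left_mono) auto
    then have "H (\<delta> * cosh z) - H \<delta> = ((\<delta> * cosh z)\<^sup>2 - \<delta>\<^sup>2) * R (\<delta> * cosh z) \<delta>"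
      using assms by (intro H_diff_eq) auto
    also have "(\<delta> * cosh z)\<^sup>2 - \<delta>\<^sup>2 = (\<delta> * sinh z)\<^sup>2"
      by (simp add: power_mult_distrib cosh_square_eq algebra_simps)
    finally have "2 * (H (\<delta> * cosh z) - H \<delta>) = (\<delta> * sinh z)\<^sup>2 * (2 * R (\<delta> * cosh z) \<delta>)" by simp
    then have "sqrt (2 * (H (\<delta> * cosh z) - H \<delta>)) = \<delta> * sinh z * sqrt (2 * R (\<delta> * cosh z) \<delta>)"
      using s assms by (simp add: real_sqrt_mult)
    then show ?thesis using s assms by (simp add: f_def q_def Q_def)
  qed
  have a0: "0 < a" unfolding a_b_def using ge arcosh_real_strict_mono[of 1 "\<sigma> / \<delta>"] by simp
  ultimately have "(q \<delta> has_integral (integral {\<sigma>..h} f)) {a..b}"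
    unfolding ends by (subst has_integral_cong[OF eq[symmetric]]) auto
  then have "integral {a..b} (q \<delta>) = integral {\<sigma>..h} f" by (rule integral_unique)
  moreover have "integral {0..b} (q \<delta>) = integral {0..a} (q \<delta>) + integral {a..b} (q \<delta>)"
    using ab assms by (intro Henstock_Kurzweil_Integration.integral_combine[symmetric]) (auto intro!: q_integrable simp: a_b_def)
  ultimately have "T \<delta> - N \<sigma> \<delta> = integral {\<sigma>..h} f" by (simp add: T_def N_def a_b_def)
  then show ?thesis
    unfolding f_def[symmetric] using integrable_integral[OF integrable_continuous_real[OF cf]] by simp
qed

lemma H_diff_le:
  assumes "0 \<le> p" "p \<le> r" "r \<le> h"
  shows "\<bar>H p - H r\<bar> \<le> M * (r * (r - p))"
proof -
  have "\<bar>H r - H p - 0 * (r\<^sup>2 - p\<^sup>2) / 2\<bar> \<le> M * (r\<^sup>2 - p\<^sup>2) / 2"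
    by (rule H_quadratic) (use assms k_le in auto)
  also have "r\<^sup>2 - p\<^sup>2 = (r + p) * (r - p)" by (simp add: power2_eq_square algebra_simps)
  also have "M * ((r + p) * (r - p)) / 2 \<le> M * ((r + r) * (r - p)) / 2"
    using M_pos assms by (intro divide_right_mono mult_left_mono mult_right_mono) auto
  finally show ?thesis by (simp add: abs_minus_commute)
qed

text \<open>
  Away from the turning point the integrand is smooth in the energy \<open>H \<delta>\<close>, whose variation is of order
  \<open>r (r - p)\<close>.
\<close>

lemma far_diff:
  assumes "0 < \<sigma>" "\<sigma> \<le> h"
  obtains C where "0 \<le> C" "\<And>p r. 0 < p \<Longrightarrow> p \<le> r \<Longrightarrow> r < e \<Longrightarrow> r \<le> \<sigma> / 2 \<Longrightarrow>
     \<bar>(T p - N \<sigma> p) - (T r - N \<sigma> r)\<bar> \<le> C * (r * (r - p))"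
proof -
  define \<mu> where "\<mu> = m * \<sigma>\<^sup>2 / 2"
  define c where "c = 1 / sqrt \<mu> + M / (\<mu> * sqrt \<mu>)"
  have \<mu>: "\<mu> > 0" using m_pos assms by (simp add: \<mu>_def)
  have c: "c \<ge> 0" unfolding c_def using \<mu> M_pos by (intro add_nonneg_nonneg) auto
  show ?thesis
  proof
    show "0 \<le> c * M * (h - \<sigma>)" using c M_pos assms by simp
    fix p r assume pr: "0 < p" "p \<le> r" "r < e" "r \<le> \<sigma> / 2"
    have low: "\<mu> / 2 \<le> H s - H \<delta>" if "s \<in> {\<sigma>..h}" "0 < \<delta>" "\<delta> \<le> r" for s \<delta>
    proof -
      have "\<mu> / 2 = \<sigma>\<^sup>2 / 2 * (m / 2)" by (simp add: \<mu>_def)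
      also have "\<dots> \<le> (s\<^sup>2 - \<delta>\<^sup>2) * R s \<delta>"
      proof (intro mult_mono)
        have "\<sigma>\<^sup>2 \<le> s\<^sup>2" "\<delta>\<^sup>2 \<le> (\<sigma> / 2)\<^sup>2" using that assms pr by (auto intro!: power_mono)
        moreover have "0 \<le> \<sigma>\<^sup>2" "(\<sigma> / 2)\<^sup>2 = \<sigma>\<^sup>2 / 4" by (auto simp: power_divide)
        ultimately show "\<sigma>\<^sup>2 / 2 \<le> s\<^sup>2 - \<delta>\<^sup>2" by linarith
        then show "0 \<le> s\<^sup>2 - \<delta>\<^sup>2" using \<open>0 \<le> \<sigma>\<^sup>2\<close> by linarith
        show "m / 2 \<le> R s \<delta>" using that pr assms by (intro R_ge) auto
      qed (use m_pos in auto)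
      also have "\<dots> = H s - H \<delta>" using that pr assms by (intro H_diff_eq[symmetric]) auto
      finally show ?thesis .
    qed
    have "((\<lambda>s. D s / sqrt (2 * (H s - H p)) - D s / sqrt (2 * (H s - H r))) has_integral
        (T p - N \<sigma> p) - (T r - N \<sigma> r)) {\<sigma>..h}"
      using assms pr by (intro has_integral_diff far_part) auto
    moreover have "\<bar>D s / sqrt (2 * (H s - H p)) - D s / sqrt (2 * (H s - H r))\<bar> \<le> c * (M * (r * (r - p)))"
      if s: "s \<in> {\<sigma>..h}" for s
    proof -
      have "\<bar>D s / sqrt (2 * (H s - H p)) - D s / sqrt (2 * (H s - H r))\<bar>
         \<le> c * (\<bar>D s - D s\<bar> + \<bar>(H s - H p) - (H s - H r)\<bar>)"
        unfolding c_def using low[OF s] pr \<mu> D_le[of s] D_ge[of s] in_J[of s] s assms d_pos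
        by (intro quotient_sqrt_Lipschitz) auto
      also have "\<dots> \<le> c * (M * (r * (r - p)))"
        using H_diff_le[of p r] pr e_le c by (intro mult_left_mono) auto
      finally show ?thesis .
    qed
    ultimately have "norm ((T p - N \<sigma> p) - (T r - N \<sigma> r)) \<le> c * (M * (r * (r - p))) * measure lborel (cbox \<sigma> h)"
      using c M_pos pr by (intro has_integral_bound) auto
    then show "\<bar>(T p - N \<sigma> p) - (T r - N \<sigma> r)\<bar> \<le> c * M * (h - \<sigma>) * (r * (r - p))"
      using assms by (simp add: mult_ac)
  qed
qed

text \<open>
  For a small fixed \<open>\<sigma>\<close> the time near the zero decreases by at least a multiple of \<open>(r - p) / r\<close>, while the
  time far from the zero changes by at most a multiple of \<open>r (r - p)\<close>.
\<close>

lemma T_strict_antimono: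
  obtains \<eta> where "0 < \<eta>" "\<eta> \<le> e" "\<And>p r. 0 < p \<Longrightarrow> p < r \<Longrightarrow> r < \<eta> \<Longrightarrow> T r < T p"
proof -
  define c where "c = d / sqrt M"
  have c: "c > 0" using d_pos M_pos by (simp add: c_def)
  \<comment> \<open>Chosen so that the Lipschitz error of the near part is at most half of its gain \<open>c\<close>.\<close>
  define \<sigma> where "\<sigma> = min h (c / (2 * (B + 1)))"
  have \<sigma>: "0 < \<sigma>" "\<sigma> \<le> h" using c h_pos B_nonneg by (auto simp: \<sigma>_def)
  have "\<sigma> \<le> c / (2 * (B + 1))" by (simp add: \<sigma>_def)
  then have "\<sigma> * (2 * (B + 1)) \<le> c" using B_nonneg by (subst (asm) pos_le_divide_eq) auto
  then have B\<sigma>: "B * \<sigma> \<le> c / 2" using \<sigma> by (simp add: algebra_simps)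
  obtain C where C: "0 \<le> C" "\<And>p r. 0 < p \<Longrightarrow> p \<le> r \<Longrightarrow> r < e \<Longrightarrow> r \<le> \<sigma> / 2 \<Longrightarrow>
     \<bar>(T p - N \<sigma> p) - (T r - N \<sigma> r)\<bar> \<le> C * (r * (r - p))"
    using far_diff[OF \<sigma>] by metis
  define \<eta> where "\<eta> = Min {e, \<sigma> / 2, 1, c / (2 * (C + 1))}"
  show ?thesis
  proof
    show "0 < \<eta>" "\<eta> \<le> e" unfolding \<eta>_def using e_pos \<sigma> c C by auto
    fix p r assume pr: "0 < p" "p < r" "r < \<eta>"
    have r: "r < e" "r \<le> \<sigma> / 2" "r \<le> 1" "r < c / (2 * (C + 1))" using pr by (auto simp: \<eta>_def)
    have "r * (2 * (C + 1)) < c" using r(4) C by (subst (asm) pos_less_divide_eq) auto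
    then have "C * r < c / 2" using pr by (simp add: algebra_simps)
    moreover have "C * r * r \<le> C * r * 1" using C pr r by (intro mult_left_mono) auto
    ultimately have Cr: "C * r * r < c / 2" by simp
    have "c * ((r - p) / r) \<le> c * (arcosh (\<sigma> / p) - arcosh (\<sigma> / r))"
      using pr r c \<sigma> by (intro mult_left_mono arcosh_scaled_diff_ge) auto
    moreover have "c * (arcosh (\<sigma> / p) - arcosh (\<sigma> / r)) - B * (r - p) * (\<sigma> / r) \<le> N \<sigma> p - N \<sigma> r"
      unfolding c_def using N_diff(1)[of p r \<sigma>] pr r \<sigma> by auto
    moreover have "\<bar>(T p - N \<sigma> p) - (T r - N \<sigma> r)\<bar> \<le> C * (r * (r - p))" using C(2) pr r by auto
    ultimately have "c * ((r - p) / r) - B * (r - p) * (\<sigma> / r) - C * (r * (r - p)) \<le> T p - T r"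
      by linarith
    moreover have "c * ((r - p) / r) - B * (r - p) * (\<sigma> / r) - C * (r * (r - p))
        = (r - p) / r * (c - B * \<sigma> - C * r * r)"
    proof -
      have "C * (r * (r - p)) = (r - p) / r * (C * r * r)" using pr by simp
      moreover have "B * (r - p) * (\<sigma> / r) = (r - p) / r * (B * \<sigma>)" by simp
      ultimately show ?thesis by (simp only: right_diff_distrib mult.commute[of c])
    qed
    moreover have "0 < (r - p) / r * (c - B * \<sigma> - C * r * r)"
      using pr B\<sigma> Cr by (intro mult_pos_pos) auto
    ultimately show "T r < T p" by linarith
  qed
qed

lemma T_ge:
  assumes "0 < \<delta>" "\<delta> < e"
  shows "d / sqrt M * arcosh (h / \<delta>) \<le> T \<delta>"
proof -
  have ge: "1 \<le> h / \<delta>" using assms e_le by simp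
  have "integral {0..arcosh (h / \<delta>)} (\<lambda>z. d / sqrt M) \<le> integral {0..arcosh (h / \<delta>)} (q \<delta>)"
    using assms ge q_bounds(1)[OF assms] by (intro integral_le q_integrable) (auto intro: order_trans[of _ 0])
  then show ?thesis using ge by (simp add: T_def N_def mult.commute)
qed

lemma continuous_on_T:
  assumes "0 < a" "b < e"
  shows "continuous_on {a..b} T"
  unfolding continuous_on_def
proof
  fix x assume x: "x \<in> {a..b}"
  define Z where "Z \<delta> = arcosh (h / \<delta>)" for \<delta>
  have bound: "\<bar>T p - T r\<bar> \<le> M / sqrt m * \<bar>Z p - Z r\<bar> + B * (h / a) * \<bar>p - r\<bar>"
    if "a \<le> p" "p \<le> r" "r \<le> b" for p r
  proof -
    have pr: "0 < p" "p \<le> r" "r < e" "r \<le> h" using that assms e_le by auto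
    have "0 \<le> (r - p) / r" using pr by simp
    also have "\<dots> \<le> Z p - Z r" unfolding Z_def using pr by (intro arcosh_scaled_diff_ge)
    finally have Z: "0 \<le> Z p - Z r" .
    then have "0 \<le> d / sqrt M * (Z p - Z r)" "0 \<le> M / sqrt m * (Z p - Z r)" using d_pos M_pos m_pos by auto
    moreover have "B * (r - p) * (h / r) \<le> B * (r - p) * (h / a)"
      using that pr B_nonneg assms h_pos by (intro mult_left_mono frac_le) auto
    ultimately have "\<bar>T p - T r\<bar> \<le> M / sqrt m * (Z p - Z r) + B * (r - p) * (h / a)"
      using N_diff[of p r h] pr unfolding T_def Z_def by (simp add: abs_le_iff)
    then show ?thesis using Z pr by (simp add: mult_ac)
  qed
  have cZ: "continuous_on {a..b} Z"
    unfolding Z_def using assms e_le by (intro continuous_intros) auto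
  have "((\<lambda>p. T p - T x) \<longlongrightarrow> 0) (at x within {a..b})"
  proof (rule Lim_null_comparison)
    show "\<forall>\<^sub>F p in at x within {a..b}. norm (T p - T x) \<le> M / sqrt m * \<bar>Z p - Z x\<bar> + B * (h / a) * \<bar>p - x\<bar>"
      unfolding eventually_at_filter
    proof (intro always_eventually allI impI)
      fix p assume "p \<in> {a..b}"
      then show "norm (T p - T x) \<le> M / sqrt m * \<bar>Z p - Z x\<bar> + B * (h / a) * \<bar>p - x\<bar>"
        using bound[of p x] bound[of x p] x by (cases "p \<le> x") (auto simp: abs_minus_commute)
    qed
    have "(Z \<longlongrightarrow> Z x) (at x within {a..b})" using cZ x by (simp add: continuous_on_def)
    then have "((\<lambda>p. M / sqrt m * \<bar>Z p - Z x\<bar> + B * (h / a) * \<bar>p - x\<bar>) \<longlongrightarrow>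
       M / sqrt m * \<bar>Z x - Z x\<bar> + B * (h / a) * \<bar>x - x\<bar>) (at x within {a..b})"
      by (intro tendsto_intros)
    then show "((\<lambda>p. M / sqrt m * \<bar>Z p - Z x\<bar> + B * (h / a) * \<bar>p - x\<bar>) \<longlongrightarrow> 0) (at x within {a..b})" by simp
  qed
  then show "(T \<longlongrightarrow> T x) (at x within {a..b})" by (simp add: LIM_zero_iff)
qed

lemma T_attains:
  assumes "0 < \<delta>1" "\<delta>1 < e" "T \<delta>1 < \<tau>"
  obtains \<delta> where "0 < \<delta>" "\<delta> < \<delta>1" "T \<delta> = \<tau>"
proof -
  define c where "c = d / sqrt M"
  have c: "c > 0" using d_pos M_pos by (simp add: c_def)
  define \<delta>0 where "\<delta>0 = min \<delta>1 (h * exp (- \<tau> / c))"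
  have \<delta>0: "0 < \<delta>0" "\<delta>0 \<le> \<delta>1" using assms h_pos by (auto simp: \<delta>0_def)
  have "exp (\<tau> / c) \<le> h / \<delta>0"
  proof -
    have "\<delta>0 \<le> h * exp (- \<tau> / c)" by (simp add: \<delta>0_def)
    then show ?thesis using \<delta>0 by (simp add: exp_minus field_simps)
  qed
  moreover have ge: "1 \<le> h / \<delta>0" using \<delta>0 assms e_le by simp
  ultimately have "\<tau> / c \<le> ln (h / \<delta>0)" by (metis exp_gt_zero ln_exp ln_le_cancel_iff order_less_le_trans)
  also have "\<dots> \<le> arcosh (h / \<delta>0)"
    using ge unfolding arcosh_real_def[OF ge] by (intro ln_mono) (auto simp: one_le_power)
  finally have "\<tau> \<le> c * arcosh (h / \<delta>0)" using c by (simp add: field_simps)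
  also have "\<dots> \<le> T \<delta>0" unfolding c_def using \<delta>0 assms by (intro T_ge) auto
  finally have "\<tau> \<le> T \<delta>0" .
  then obtain \<delta> where \<delta>: "\<delta>0 \<le> \<delta>" "\<delta> \<le> \<delta>1" "T \<delta> = \<tau>"
    using IVT2'[of T \<delta>1 \<tau> \<delta>0] assms \<delta>0 continuous_on_T[of \<delta>0 \<delta>1] by auto
  moreover have "\<delta> \<noteq> \<delta>1" using \<delta> assms by auto
  ultimately show ?thesis using that[of \<delta>] \<delta>0 by auto
qed

end

section \<open>Existence of solutions with a given extremal distance\<close>

text \<open>
  At a zero of \<open>f\<close> the product rule needs only continuity of the other factor. It yields the derivative of
  the flux at the turning point, where \<open>R\<close> is merely known to be continuous.
\<close>

lemma DERIV_mult_continuous_zero: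
  fixes f c :: "real \<Rightarrow> real"
  assumes "(f has_real_derivative l) (at a)" "f a = 0" "isCont c a"
  shows "((\<lambda>x. f x * c x) has_real_derivative l * c a) (at a)"
proof -
  obtain g where g: "\<And>z. f z - f a = g z * (z - a)" "isCont g a" "g a = l"
    using assms(1) unfolding CARAT_DERIV by metis
  have "\<forall>z. f z * c z - f a * c a = (g z * c z) * (z - a)"
    using g(1) assms(2) by (simp add: mult_ac)
  moreover have "isCont (\<lambda>z. g z * c z) a" using g(2) assms(3) by (intro continuous_intros)
  ultimately show ?thesis
    unfolding CARAT_DERIV using g(3) by (intro exI[of _ "\<lambda>z. g z * c z"]) simp
qed

context half_well
begin

text \<open>
  The boundary value problem for the distance \<open>\<psi>\<close> to the zero on \<open>[-a, a]\<close>, with \<open>v\<close> the derivative of \<open>\<psi>\<close>.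
\<close>

definition sol :: "real \<Rightarrow> real \<Rightarrow> (real \<Rightarrow> real) \<Rightarrow> (real \<Rightarrow> real) \<Rightarrow> bool" where
  "sol \<epsilon> a \<psi> v \<longleftrightarrow> continuous_on {-a..a} \<psi> \<and> \<psi> (-a) = h \<and> \<psi> a = h \<and>
     (\<forall>x\<in>{-a<..<a}. \<psi> x \<in> J \<and> \<psi> x < h \<and> (\<psi> has_real_derivative v x) (at x) \<and>
        ((\<lambda>y. D (\<psi> y) * v y) has_real_derivative F (\<psi> x) / \<epsilon>\<^sup>2) (at x))"

text \<open>
  The flux \<open>\<epsilon> D \<psi>'\<close> of a solution as a function of the coordinate \<open>z\<close>, where \<open>\<psi> = \<delta> cosh z\<close>. By conservation
  of energy it is a signed square root of \<open>2 (H \<psi> - H \<delta>)\<close>; written in this form it has no singularity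
  at the turning point \<open>z = 0\<close>.
\<close>

definition W :: "real \<Rightarrow> real \<Rightarrow> real" where
  "W \<delta> z = (\<delta> * sinh z) * sqrt (2 * R (\<delta> * cosh z) \<delta>)"

lemma W_sqrt:
  assumes "0 < \<delta>" "\<delta> < e" "\<bar>z\<bar> < arcosh (h / \<delta>)"
  shows "W \<delta> z = sgn z * sqrt (2 * (H (\<delta> * cosh z) - H \<delta>))"
proof -
  have "H (\<delta> * cosh z) - H \<delta> = ((\<delta> * cosh z)\<^sup>2 - \<delta>\<^sup>2) * R (\<delta> * cosh z) \<delta>"
    using assms cosh_real_ge_1[of z] by (intro H_diff_eq) auto
  also have "(\<delta> * cosh z)\<^sup>2 - \<delta>\<^sup>2 = (\<delta> * sinh z)\<^sup>2"
    by (simp add: power_mult_distrib cosh_square_eq algebra_simps)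
  finally have "2 * (H (\<delta> * cosh z) - H \<delta>) = (\<delta> * sinh z)\<^sup>2 * (2 * R (\<delta> * cosh z) \<delta>)" by simp
  then have "sqrt (2 * (H (\<delta> * cosh z) - H \<delta>)) = \<delta> * \<bar>sinh z\<bar> * sqrt (2 * R (\<delta> * cosh z) \<delta>)"
    using assms by (simp add: real_sqrt_mult abs_mult)
  moreover have "sgn z * \<bar>sinh z\<bar> = sinh z" by (cases z "0::real" rule: linorder_cases) auto
  ultimately show ?thesis by (simp add: W_def mult_ac) 
qed

lemma W_deriv:
  assumes "0 < \<delta>" "\<delta> < e" "\<bar>z\<bar> < arcosh (h / \<delta>)"
  shows "(W \<delta> has_real_derivative F (\<delta> * cosh z) * q \<delta> z) (at z)"
proof (cases "z = 0")
  case True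
  define Z where "Z = arcosh (h / \<delta>)"
  have Z: "0 < Z" using assms by (simp add: Z_def)
  have "continuous_on {-Z..Z} (\<lambda>u. sqrt (2 * R (\<delta> * cosh u) \<delta>))"
    by (intro continuous_intros continuous_on_compose2[OF continuous_on_R[OF assms(1)]])
       (use cosh_range[of \<delta> h] assms e_le in \<open>auto simp: Z_def\<close>)
  then have "isCont (\<lambda>u. sqrt (2 * R (\<delta> * cosh u) \<delta>)) 0"
    by (rule continuous_on_interior) (use Z in auto)
  moreover have "((\<lambda>u. \<delta> * sinh u) has_real_derivative \<delta>) (at 0)"
    by (auto intro!: derivative_eq_intros)
  ultimately have "(W \<delta> has_real_derivative \<delta> * sqrt (2 * R (\<delta> * cosh 0) \<delta>)) (at 0)"
    unfolding W_def by (intro DERIV_mult_continuous_zero) auto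
  moreover have "\<delta> * sqrt (2 * R (\<delta> * cosh 0) \<delta>) = F \<delta> * q \<delta> 0"
  proof -
    have k: "0 < k \<delta>" using R_ge[of \<delta> \<delta>] m_pos assms e_le by (simp add: R_def)
    have "F \<delta> * q \<delta> 0 = (F \<delta> * D \<delta>) / sqrt (k \<delta>)" by (simp add: q_def Q_def R_def)
    also have "\<dots> = \<delta> * (k \<delta> / sqrt (k \<delta>))" using FD_eq[of \<delta>] assms e_le by simp
    also have "\<dots> = \<delta> * sqrt (k \<delta>)" using k by (subst real_div_sqrt) auto
    finally show ?thesis by (simp add: R_def)
  qed
  ultimately show ?thesis using True by simp
next
  case False
  define s where "s = \<delta> * cosh z"
  have s: "\<delta> < s" "s \<le> h"
  proof -
    have "1 < cosh z" using cosh_real_strict_mono[of 0 "\<bar>z\<bar>"] False by simp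
    then show "\<delta> < s" using assms by (simp add: s_def)
    show "s \<le> h" unfolding s_def using cosh_range[of \<delta> h z] assms e_le by simp
  qed
  define E where "E = 2 * (H s - H \<delta>)"
  have E: "0 < E" using H_less[of \<delta> s] assms s by (simp add: E_def)
  have WE: "W \<delta> z = sgn z * sqrt E" using W_sqrt[OF assms] by (simp add: E_def s_def)
  have "((\<lambda>u. sgn z * sqrt (2 * (H (\<delta> * cosh u) - H \<delta>))) has_real_derivative
     sgn z * (inverse (sqrt E) / 2 * (2 * (F s * D s * (\<delta> * sinh z))))) (at z)"
  proof -
    have "((\<lambda>u. H (\<delta> * cosh u)) has_real_derivative F s * D s * (\<delta> * sinh z)) (at z)"
      using s assms
      by (intro DERIV_chain2[where f = H and g = "\<lambda>u. \<delta> * cosh u"])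
         (auto intro!: derivative_eq_intros H_deriv in_J simp flip: s_def)
    then have "((\<lambda>u. 2 * (H (\<delta> * cosh u) - H \<delta>)) has_real_derivative 2 * (F s * D s * (\<delta> * sinh z))) (at z)"
      by (auto intro!: derivative_eq_intros)
    then show ?thesis
      using DERIV_real_sqrt[OF E]
      by (intro DERIV_chain2[where f = sqrt and g = "\<lambda>u. 2 * (H (\<delta> * cosh u) - H \<delta>)", THEN DERIV_cmult])
         (auto simp: E_def s_def)
  qed
  then have "(W \<delta> has_real_derivative
     sgn z * (inverse (sqrt E) / 2 * (2 * (F s * D s * (\<delta> * sinh z))))) (at z)"
  proof (rule has_field_derivative_transform_within_open)
    let ?S = "{u. u * z > 0} \<inter> {u. \<bar>u\<bar> < arcosh (h / \<delta>)}"
    show "open ?S" by (intro open_Int open_Collect_less continuous_intros)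
    show "z \<in> ?S" using False assms by (simp add: zero_less_mult_iff) linarith
    fix u assume u: "u \<in> ?S"
    then have "sgn u = sgn z" by (auto simp: zero_less_mult_iff sgn_if)
    then show "sgn z * sqrt (2 * (H (\<delta> * cosh u) - H \<delta>)) = W \<delta> u"
      using W_sqrt[of \<delta> u] u assms by simp
  qed
  moreover have "sgn z * (inverse (sqrt E) / 2 * (2 * (F s * D s * (\<delta> * sinh z)))) = F (\<delta> * cosh z) * q \<delta> z"
  proof -
    have R: "0 < sqrt (2 * R s \<delta>)" using R_ge[of \<delta> s] s assms m_pos by simp
    have sz: "sinh z \<noteq> 0" using False by simp
    have "sgn z * sqrt E = \<delta> * sinh z * sqrt (2 * R s \<delta>)" using WE by (simp add: W_def s_def)
    then have "sqrt E = sgn z * (\<delta> * sinh z * sqrt (2 * R s \<delta>))"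
      using False by (cases "z > 0") (auto simp: sgn_if)
    then have inv: "inverse (sqrt E) = inverse (sgn z) * inverse (\<delta> * sinh z) * inverse (sqrt (2 * R s \<delta>))"
      by (simp add: mult_ac)
    have alg: "A * (inverse A * inverse B * inverse C / 2 * (2 * (f * g * B))) = f * (g / C)"
      if "A \<noteq> 0" "B \<noteq> 0" for A B C f g :: real
      using that by (cases "C = 0") (simp_all add: field_simps)
    have "sgn z \<noteq> 0" "\<delta> * sinh z \<noteq> 0" using False sz assms by (auto simp: sgn_if)
    then show ?thesis unfolding inv q_def Q_def s_def[symmetric] by (rule alg)
  qed
  ultimately show ?thesis by simp
qed

lemma integral_q_deriv:
  assumes "0 < \<delta>" "\<delta> < e" "b \<ge> - arcosh (h / \<delta>)" "b < z" "z < arcosh (h / \<delta>)"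
  shows "((\<lambda>u. integral {b..u} (q \<delta>)) has_real_derivative q \<delta> z) (at z)"
proof -
  have "continuous_on {b..arcosh (h / \<delta>)} (q \<delta>)"
    by (rule continuous_on_subset[OF continuous_on_q]) (use assms in auto)
  then have "((\<lambda>u. integral {b..u} (q \<delta>)) has_real_derivative q \<delta> z) (at z within {b..arcosh (h / \<delta>)})"
    by (rule integral_has_real_derivative) (use assms in auto)
  then show ?thesis using at_within_Icc_at[OF assms(4,5)] by simp
qed

lemma integral_q_continuous:
  assumes "0 < \<delta>" "\<delta> < e" "b \<ge> - arcosh (h / \<delta>)"
  shows "continuous_on {b..arcosh (h / \<delta>)} (\<lambda>u. integral {b..u} (q \<delta>))"
  by (rule indefinite_integral_continuous_1) (use q_integrable[of \<delta> b] assms in auto)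

lemma integral_q_strict_mono:
  assumes "0 < \<delta>" "\<delta> < e" "b \<ge> - arcosh (h / \<delta>)" "b \<le> x" "x < y" "y \<le> arcosh (h / \<delta>)"
  shows "integral {b..x} (q \<delta>) < integral {b..y} (q \<delta>)"
proof (rule DERIV_pos_imp_increasing_open[OF \<open>x < y\<close>])
  fix z assume z: "x < z" "z < y"
  have "((\<lambda>u. integral {b..u} (q \<delta>)) has_real_derivative q \<delta> z) (at z)"
    using assms z by (intro integral_q_deriv) auto
  moreover have "0 < q \<delta> z" using q_bounds[of \<delta> z] assms z by auto
  ultimately show "\<exists>y. ((\<lambda>u. integral {b..u} (q \<delta>)) has_real_derivative y) (at z) \<and> 0 < y" by blast
next
  show "continuous_on {x..y} (\<lambda>u. integral {b..u} (q \<delta>))"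
    by (rule continuous_on_subset[OF integral_q_continuous[OF assms(1-3)]]) (use assms in auto)
qed

text \<open>
  In the coordinate \<open>z\<close> the first-order energy equation reads \<open>z' = 1 / (\<epsilon> q \<delta> z)\<close>, with a continuous
  positive right-hand side. It is solved by inverting the primitive of \<open>q \<delta>\<close>; since \<open>q \<delta>\<close> is even, the
  inverse covers the interval symmetrically and passes the turning point without any gluing.
\<close>

lemma solution_exists:
  assumes "0 < \<delta>" "\<delta> < e" "0 < \<epsilon>" "0 < a" "T \<delta> = a / \<epsilon>"
  obtains \<psi> v where "sol \<epsilon> a \<psi> v" "\<psi> 0 = \<delta>"
proof -
  define Z where "Z = arcosh (h / \<delta>)"
  define \<tau> where "\<tau> = T \<delta>"
  \<comment> \<open>Normalised to \<open>X 0 = 0\<close>, because half of the integral lies to the left of \<open>0\<close>.\<close>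
  define X where "X z = integral {-Z..z} (q \<delta>) - \<tau>" for z
  have Z: "0 < Z" using assms e_le by (simp add: Z_def)
  have \<tau>: "0 < \<tau>" using assms by (simp add: \<tau>_def)
  have half: "integral {-Z..0} (q \<delta>) = \<tau>"
  proof -
    have "integral {-Z..-0} (\<lambda>z. q \<delta> (- z)) = integral {0..Z} (q \<delta>)"
      by (rule Henstock_Kurzweil_Integration.integral_reflect_real)
    moreover have "(\<lambda>z. q \<delta> (- z)) = q \<delta>" by (simp add: q_def fun_eq_iff)
    ultimately show ?thesis by (simp add: \<tau>_def T_def N_def Z_def)
  qed
  have "integral {-Z..Z} (q \<delta>) = integral {-Z..0} (q \<delta>) + integral {0..Z} (q \<delta>)"
    using Z assms by (intro Henstock_Kurzweil_Integration.integral_combine[symmetric])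
      (auto intro!: q_integrable simp: Z_def)
  then have X_vals: "X (-Z) = - \<tau>" "X 0 = 0" "X Z = \<tau>"
    using half by (auto simp: X_def \<tau>_def T_def N_def Z_def)
  have X_mono: "X x < X y" if "- Z \<le> x" "x < y" "y \<le> Z" for x y
    using integral_q_strict_mono[of \<delta> "- Z" x y] that assms by (simp add: X_def Z_def)
  have X_cont: "continuous_on {-Z..Z} X"
    unfolding X_def Z_def by (intro continuous_intros integral_q_continuous assms) auto
  have X_deriv: "(X has_real_derivative q \<delta> z) (at z)" if "- Z < z" "z < Z" for z
    unfolding X_def using integral_q_deriv[of \<delta> "- Z" z] that assms
    by (auto intro!: derivative_eq_intros simp: Z_def)
  have inj: "inj_on X {-Z..Z}"
    by (rule inj_onI) (metis X_mono atLeastAtMost_iff less_irrefl linorder_neqE_linordered_idom)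
  have img: "X ` {-Z..Z} = {-\<tau>..\<tau>}"
  proof
    show "X ` {-Z..Z} \<subseteq> {-\<tau>..\<tau>}"
    proof clarify
      fix z assume z: "z \<in> {-Z..Z}"
      have "X (-Z) \<le> X z" using X_mono[of "-Z" z] z by (cases "z = -Z") auto
      moreover have "X z \<le> X Z" using X_mono[of z Z] z by (cases "z = Z") auto
      ultimately show "X z \<in> {-\<tau>..\<tau>}" using X_vals by simp
    qed
    show "{-\<tau>..\<tau>} \<subseteq> X ` {-Z..Z}"
    proof
      fix y assume "y \<in> {-\<tau>..\<tau>}"
      then obtain z where "-Z \<le> z" "z \<le> Z" "X z = y"
        using IVT'[of X "-Z" y Z] X_vals X_cont Z by auto
      then show "y \<in> X ` {-Z..Z}" by auto
    qed
  qed
  define g where "g = inv_into {-Z..Z} X"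
  have gX: "g (X z) = z" if "z \<in> {-Z..Z}" for z using inj that by (simp add: g_def)
  have Xg: "X (g y) = y" "g y \<in> {-Z..Z}" if "y \<in> {-\<tau>..\<tau>}" for y
    using that f_inv_into_f[of y X "{-Z..Z}"] inv_into_into[of y X "{-Z..Z}"] unfolding img g_def by auto
  have g_cont: "continuous_on {-\<tau>..\<tau>} g"
    using continuous_on_inv[OF X_cont compact_Icc, of g] gX unfolding img by blast
  have g_open: "- Z < g y" "g y < Z" if "- \<tau> < y" "y < \<tau>" for y
  proof -
    have "g y \<noteq> Z" "g y \<noteq> - Z" using Xg[of y] X_vals that by auto
    then show "- Z < g y" "g y < Z" using Xg(2)[of y] that by auto
  qed
  have g_deriv: "(g has_real_derivative inverse (q \<delta> (g y))) (at y)" if y: "- \<tau> < y" "y < \<tau>" for y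
  proof (rule DERIV_inverse_function[where f = X and a = "- \<tau>" and b = \<tau>])
    show "(X has_real_derivative q \<delta> (g y)) (at (g y))" using X_deriv g_open y by simp
    have "0 < q \<delta> (g y)" using g_open[OF y] assms by (intro q_bounds) (auto simp: Z_def abs_le_iff)
    then show "q \<delta> (g y) \<noteq> 0" by simp
    show "isCont g y" using continuous_on_interior[OF g_cont] y by simp
  qed (use y Xg in auto)
  have a\<epsilon>: "\<tau> = a / \<epsilon>" using assms by (simp add: \<tau>_def)
  have scale: "- \<tau> < x / \<epsilon>" "x / \<epsilon> < \<tau>" if "x \<in> {-a<..<a}" for x
    using that assms divide_strict_right_mono[of x a \<epsilon>] divide_strict_right_mono[of "- a" x \<epsilon>]
    by (auto simp: a\<epsilon>)
  define \<psi> where "\<psi> x = \<delta> * cosh (g (x / \<epsilon>))" for x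
  define v where "v x = \<delta> * sinh (g (x / \<epsilon>)) * (inverse (q \<delta> (g (x / \<epsilon>))) / \<epsilon>)" for x
  have chain: "((\<lambda>x. g (x / \<epsilon>)) has_real_derivative inverse (q \<delta> (g (x / \<epsilon>))) / \<epsilon>) (at x)"
    if "x \<in> {-a<..<a}" for x
    by (rule DERIV_cong[OF DERIV_chain2[where f = g and g = "\<lambda>x. x / \<epsilon>" and x = x,
          OF g_deriv[OF scale[OF that]] DERIV_cdivide[OF DERIV_ident]]]) simp
  have range: "\<delta> \<le> \<psi> x" "\<psi> x < h" "\<bar>g (x / \<epsilon>)\<bar> < Z" if x: "x \<in> {-a<..<a}" for x
  proof -
    show z: "\<bar>g (x / \<epsilon>)\<bar> < Z" using g_open[OF scale[OF x]] by auto
    then show "\<delta> \<le> \<psi> x" using cosh_range[of \<delta> h "g (x / \<epsilon>)"] assms e_le by (simp add: \<psi>_def Z_def)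
    have "cosh \<bar>g (x / \<epsilon>)\<bar> < cosh Z" using z by (intro cosh_real_strict_mono) auto
    then have "cosh (g (x / \<epsilon>)) < h / \<delta>" using assms e_le by (simp add: Z_def)
    then show "\<psi> x < h" using assms by (simp add: \<psi>_def pos_less_divide_eq mult.commute)
  qed
  have "sol \<epsilon> a \<psi> v"
    unfolding sol_def
  proof (intro conjI ballI)
    show "continuous_on {-a..a} \<psi>"
      unfolding \<psi>_def
    proof (intro continuous_intros continuous_on_compose2[OF g_cont])
      show "(\<lambda>x. x / \<epsilon>) ` {- a..a} \<subseteq> {- \<tau>..\<tau>}" using assms divide_right_mono[of _ a \<epsilon>] divide_right_mono[of "- a" _ \<epsilon>]
        by (auto simp: a\<epsilon>)
    qed (use assms in auto)
    have "g \<tau> = Z" "g (- \<tau>) = - Z" using gX[of Z] gX[of "-Z"] X_vals Z by auto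
    then show "\<psi> (- a) = h" "\<psi> a = h" using assms e_le by (auto simp: \<psi>_def a\<epsilon> Z_def)
    fix x assume x: "x \<in> {-a<..<a}"
    show "\<psi> x < h" "\<psi> x \<in> J" using range[OF x] assms in_J[of "\<psi> x"] by auto
    show "(\<psi> has_real_derivative v x) (at x)"
      unfolding \<psi>_def v_def by (rule derivative_eq_intros chain[OF x] refl)+ simp
    have "((\<lambda>y. W \<delta> (g (y / \<epsilon>)) / \<epsilon>) has_real_derivative
       F (\<psi> x) * q \<delta> (g (x / \<epsilon>)) * (inverse (q \<delta> (g (x / \<epsilon>))) / \<epsilon>) / \<epsilon>) (at x)"
      unfolding \<psi>_def using range[OF x] assms
      by (intro DERIV_cdivide DERIV_chain2[where f = "W \<delta>" and g = "\<lambda>x. g (x / \<epsilon>)"] W_deriv chain x)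
        (auto simp: Z_def)
    also have "F (\<psi> x) * q \<delta> (g (x / \<epsilon>)) * (inverse (q \<delta> (g (x / \<epsilon>))) / \<epsilon>) / \<epsilon> = F (\<psi> x) / \<epsilon>\<^sup>2"
      using q_bounds(3)[of \<delta> "g (x / \<epsilon>)"] range[OF x] assms by (simp add: Z_def power2_eq_square)
    finally show "((\<lambda>y. D (\<psi> y) * v y) has_real_derivative F (\<psi> x) / \<epsilon>\<^sup>2) (at x)"
    proof (rule has_field_derivative_transform_within_open[where S = "{-a<..<a}"])
      fix y assume y: "y \<in> {-a<..<a}"
      define s where "s = \<psi> y"
      have s: "\<delta> \<le> s" "s \<le> h" using range[OF y] by (auto simp: s_def)
      have "0 < D s" using D_ge[of s] d_pos in_J[of s] s assms by simp
      moreover have "0 < sqrt (2 * R s \<delta>)" using R_ge[of \<delta> s] s assms m_pos by simp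
      ultimately have "D s * inverse (Q s \<delta>) = sqrt (2 * R s \<delta>)" by (simp add: Q_def)
      then show "W \<delta> (g (y / \<epsilon>)) / \<epsilon> = D (\<psi> y) * v y"
        by (simp add: W_def v_def q_def s_def \<psi>_def mult_ac)
    qed (use x in auto)
  qed
  moreover have "\<psi> 0 = \<delta>" using gX[of 0] X_vals Z by (simp add: \<psi>_def)
  ultimately show ?thesis using that by blast
qed

end

section \<open>Symmetry and uniqueness of solutions\<close>

context half_well
begin

lemma sol_D:
  assumes "sol \<epsilon> a \<psi> v"
  shows "continuous_on {-a..a} \<psi>" "\<psi> (-a) = h" "\<psi> a = h"
    and "\<And>x. -a < x \<Longrightarrow> x < a \<Longrightarrow> \<psi> x \<in> J"
    and "\<And>x. -a < x \<Longrightarrow> x < a \<Longrightarrow> \<psi> x < h"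
    and "\<And>x. -a < x \<Longrightarrow> x < a \<Longrightarrow> (\<psi> has_real_derivative v x) (at x)"
    and "\<And>x. -a < x \<Longrightarrow> x < a \<Longrightarrow>
      ((\<lambda>y. D (\<psi> y) * v y) has_real_derivative F (\<psi> x) / \<epsilon>\<^sup>2) (at x)"
  using assms unfolding sol_def by auto

lemma sol_mirror:
  assumes "sol \<epsilon> a \<psi> v"
  shows "sol \<epsilon> a (\<lambda>x. \<psi> (- x)) (\<lambda>x. - v (- x))"
  unfolding sol_def
proof (intro conjI ballI)
  show "continuous_on {-a..a} (\<lambda>x. \<psi> (- x))"
    by (rule continuous_on_compose2[OF sol_D(1)[OF assms]]) (auto intro!: continuous_intros)
  show "\<psi> (- (- a)) = h" "\<psi> (- a) = h" using sol_D[OF assms] by auto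
  fix x assume "x \<in> {-a<..<a}"
  then have x: "- a < - x" "- x < a" by auto
  show "\<psi> (- x) \<in> J" "\<psi> (- x) < h" using sol_D[OF assms] x by auto
  show "((\<lambda>x. \<psi> (- x)) has_real_derivative - v (- x)) (at x)"
    using sol_D(6)[OF assms x] by (simp add: DERIV_mirror)
  have "((\<lambda>y. D (\<psi> (- y)) * v (- y)) has_real_derivative - (F (\<psi> (- x)) / \<epsilon>\<^sup>2)) (at x)"
    using sol_D(7)[OF assms x] DERIV_mirror[of "\<lambda>y. D (\<psi> y) * v y" "F (\<psi> (- x)) / \<epsilon>\<^sup>2" x] by simp
  then have "((\<lambda>y. - (D (\<psi> (- y)) * v (- y))) has_real_derivative - (- (F (\<psi> (- x)) / \<epsilon>\<^sup>2))) (at x)"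
    by (rule DERIV_minus)
  then show "((\<lambda>y. D (\<psi> (- y)) * - v (- y)) has_real_derivative F (\<psi> (- x)) / \<epsilon>\<^sup>2) (at x)" by simp
qed

lemma energy:
  assumes sol: "sol \<epsilon> a \<psi> v" and "\<epsilon> > 0"
    and x0: "- a < x0" "x0 < a" "v x0 = 0" and x: "- a < x" "x < a"
  shows "\<epsilon>\<^sup>2 / 2 * (D (\<psi> x) * v x)\<^sup>2 = H (\<psi> x) - H (\<psi> x0)"
proof -
  define E where "E y = \<epsilon>\<^sup>2 / 2 * (D (\<psi> y) * v y)\<^sup>2 - H (\<psi> y)" for y
  have "(E has_real_derivative 0) (at y)" if y: "- a < y" "y < a" for y
  proof -
    have "(E has_real_derivative
       \<epsilon>\<^sup>2 / 2 * (2 * (D (\<psi> y) * v y) * (F (\<psi> y) / \<epsilon>\<^sup>2)) - F (\<psi> y) * D (\<psi> y) * v y) (at y)"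
      unfolding E_def
      by (rule DERIV_diff[OF DERIV_cmult[OF DERIV_cong[OF DERIV_power[OF sol_D(7)[OF sol y], of 2]]]
            DERIV_chain2[where f = H and g = \<psi> and x = y, OF H_deriv[OF sol_D(4)[OF sol y]] sol_D(6)[OF sol y]]])
         simp
    moreover have "\<epsilon>\<^sup>2 / 2 * (2 * (D (\<psi> y) * v y) * (F (\<psi> y) / \<epsilon>\<^sup>2)) - F (\<psi> y) * D (\<psi> y) * v y = 0"
      using \<open>\<epsilon> > 0\<close> by simp
    ultimately show ?thesis by simp
  qed
  then have "E x = E x0" using x0 x by (intro DERIV_isconst3[of "- a" a]) auto
  then show ?thesis using x0 by (simp add: E_def)
qed

text \<open>
  If the minimal distance were not positive, the solution would take the value \<open>0\<close> between the minimum
  and the boundary. The energy there forces the minimum itself to be \<open>0\<close>, so the energy vanishes and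
  \<open>\<bar>\<psi>'\<bar> \<le> C \<psi>\<close>. By Gronwall's argument \<open>\<psi>\<close> would then be \<open>0\<close> up to the boundary, where it is \<open>h\<close>.
\<close>

lemma sol_minimum:
  assumes sol: "sol \<epsilon> a \<psi> v" and \<epsilon>: "\<epsilon> > 0" and a: "a > 0"
  obtains x0 where "- a < x0" "x0 < a" "v x0 = 0" "0 < \<psi> x0" "\<And>x. x \<in> {-a..a} \<Longrightarrow> \<psi> x0 \<le> \<psi> x"
proof -
  obtain x0 where x0: "x0 \<in> {-a..a}" "\<And>x. x \<in> {-a..a} \<Longrightarrow> \<psi> x0 \<le> \<psi> x"
    using continuous_attains_inf[OF compact_Icc _ sol_D(1)[OF sol]] a by auto
  have "\<psi> x0 < h" using x0(2)[of 0] sol_D(5)[OF sol, of 0] a by simp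
  then have int: "- a < x0" "x0 < a" using x0(1) sol_D(2,3)[OF sol] by (auto simp: less_le)
  have v0: "v x0 = 0"
  proof (rule DERIV_local_min[OF sol_D(6)[OF sol int]])
    show "0 < min (x0 + a) (a - x0)" using int by simp
    show "\<forall>y. \<bar>x0 - y\<bar> < min (x0 + a) (a - x0) \<longrightarrow> \<psi> x0 \<le> \<psi> y"
      using x0(2) by (auto simp: abs_less_iff)
  qed
  note en = energy[OF sol \<epsilon> int v0]
  have "0 < \<psi> x0"
  proof (rule ccontr)
    assume "\<not> 0 < \<psi> x0"
    then have neg: "\<psi> x0 \<le> 0" by simp
    have sub': "continuous_on {x0..a} \<psi>"
      by (rule continuous_on_subset[OF sol_D(1)[OF sol]]) (use int in auto)
    obtain x1 where x1: "x0 \<le> x1" "x1 \<le> a" "\<psi> x1 = 0"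
      using IVT'[of \<psi> x0 0 a] neg sol_D(3)[OF sol] h_pos int sub' by auto
    have "x1 \<noteq> a" using x1 sol_D(3)[OF sol] h_pos by auto
    then have x1': "- a < x1" "x1 < a" using x1 int by auto
    have "0 \<le> H (\<psi> x1) - H (\<psi> x0)" unfolding en[OF x1', symmetric] by simp
    then have "H (\<psi> x0) \<le> 0" using x1 H_0 by simp
    then have zero: "\<psi> x0 = 0"
      using H_pos[of "\<psi> x0"] sol_D(4)[OF sol int] neg h_pos by force
    define C where "C = sqrt (2 * M) / (\<epsilon> * d)"
    have growth: "v x \<le> C * \<psi> x" if x: "x0 < x" "x < a" for x
    proof -
      have xa: "- a < x" "x < a" using x int by auto
      have \<psi>: "0 \<le> \<psi> x" "\<psi> x < h" using x0(2)[of x] zero sol_D(5)[OF sol xa] xa by auto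
      have Dx: "d \<le> D (\<psi> x)" using D_ge sol_D(4)[OF sol xa] by simp
      have "(\<epsilon> * d * v x)\<^sup>2 \<le> 2 * (\<epsilon>\<^sup>2 / 2 * (D (\<psi> x) * v x)\<^sup>2)"
        using Dx d_pos \<epsilon> by (simp add: power_mult_distrib mult_left_mono mult_right_mono power_mono)
      also have "\<dots> = 2 * H (\<psi> x)" using en[OF xa] zero H_0 by simp
      also have "\<dots> \<le> 2 * (M * (\<psi> x)\<^sup>2)"
        using H_diff_le[of 0 "\<psi> x"] \<psi> H_0 by (simp add: power2_eq_square)
      also have "\<dots> = (sqrt (2 * M) * \<psi> x)\<^sup>2" using M_pos by (simp add: power_mult_distrib)
      finally have "\<epsilon> * d * v x \<le> sqrt (2 * M) * \<psi> x"
        by (rule power2_le_imp_le) (use \<psi> M_pos in auto)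
      then show ?thesis using \<epsilon> d_pos by (simp add: C_def field_simps)
    qed
    have "\<psi> a * exp (- C * a) \<le> \<psi> x0 * exp (- C * x0)"
    proof (rule DERIV_nonpos_imp_decreasing_open[where f = "\<lambda>x. \<psi> x * exp (- C * x)" and a = x0 and b = a])
      show "continuous_on {x0..a} (\<lambda>x. \<psi> x * exp (- C * x))"
        by (intro continuous_intros sub')
      fix x assume x: "x0 < x" "x < a"
      have "((\<lambda>x. \<psi> x * exp (- C * x)) has_real_derivative
         v x * exp (- C * x) + (exp (- C * x) * (- C)) * \<psi> x) (at x)"
        using x int by (intro DERIV_mult sol_D(6)[OF sol]) (auto intro!: derivative_eq_intros)
      moreover have "v x * exp (- C * x) + (exp (- C * x) * (- C)) * \<psi> x = exp (- C * x) * (v x - C * \<psi> x)"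
        by (simp add: algebra_simps)
      moreover have "exp (- C * x) * (v x - C * \<psi> x) \<le> 0"
        using growth[OF x] by (intro mult_nonneg_nonpos) auto
      ultimately show "\<exists>y. ((\<lambda>x. \<psi> x * exp (- C * x)) has_real_derivative y) (at x) \<and> y \<le> 0" by metis
    qed (use int in auto)
    then show False using zero sol_D(3)[OF sol] h_pos by (simp add: mult_le_0_iff)
  qed
  then show ?thesis using that int v0 x0 by blast
qed

text \<open>
  After its minimum, the solution never returns to the minimal value: between two such points there
  would be a further critical point, critical points have the energy level of the minimum, and this
  level is attained at the minimal distance only, so the solution would be constant although the
  reaction term does not vanish. Hence the flux has no zero and keeps the positive sign.
\<close>

lemma sol_increasing:
  assumes sol: "sol \<epsilon> a \<psi> v" and \<epsilon>: "\<epsilon> > 0"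
    and x0: "- a < x0" "x0 < a" "v x0 = 0" and min: "\<And>x. x \<in> {-a..a} \<Longrightarrow> \<psi> x0 \<le> \<psi> x"
    and \<delta>: "0 < \<psi> x0" "\<psi> x0 < e" and x: "x0 < x" "x < a"
  shows "\<psi> x0 < \<psi> x" "\<epsilon> * (D (\<psi> x) * v x) = sqrt (2 * (H (\<psi> x) - H (\<psi> x0)))"
proof -
  note en = energy[OF sol \<epsilon> x0]
  have above: "\<psi> x0 < \<psi> y" if y: "x0 < y" "y < a" for y
  proof (rule ccontr)
    assume "\<not> \<psi> x0 < \<psi> y"
    then have eq: "\<psi> y = \<psi> x0" using min[of y] y x0 by simp
    have "continuous_on {x0..y} \<psi>"
      by (rule continuous_on_subset[OF sol_D(1)[OF sol]]) (use x0 y in auto)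
    then obtain x2 where x2: "x2 \<in> {x0..y}" "\<And>u. u \<in> {x0..y} \<Longrightarrow> \<psi> u \<le> \<psi> x2"
      using continuous_attains_sup[OF compact_Icc, of x0 y \<psi>] y by auto
    have "\<psi> x2 = \<psi> x0"
    proof (cases "x2 = x0 \<or> x2 = y")
      case False
      then have i: "x0 < x2" "x2 < y" "- a < x2" "x2 < a" using x2 x0 y by auto
      have "v x2 = 0"
      proof (rule DERIV_local_max[OF sol_D(6)[OF sol i(3,4)]])
        show "0 < min (x2 - x0) (y - x2)" using i by simp
        show "\<forall>u. \<bar>x2 - u\<bar> < min (x2 - x0) (y - x2) \<longrightarrow> \<psi> u \<le> \<psi> x2"
          using x2(2) by (auto simp: abs_less_iff)
      qed
      then have "H (\<psi> x2) = H (\<psi> x0)" using en[OF i(3,4)] by simp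
      moreover have "\<psi> x0 \<le> \<psi> x2" "\<psi> x2 < h" using min[of x2] sol_D(5)[OF sol i(3,4)] i by auto
      ultimately show ?thesis using H_less[of "\<psi> x0" "\<psi> x2"] \<delta> by (cases "\<psi> x0 = \<psi> x2") auto
    qed (use eq in auto)
    then have const: "\<psi> u = \<psi> x0" if "u \<in> {x0..y}" for u
      using x2(2)[OF that] min[of u] that x0 y by force
    have flat: "v u = 0" if u: "u \<in> {x0<..<y}" for u
    proof -
      have "((\<lambda>_. \<psi> x0) has_real_derivative 0) (at u)" by simp
      then have "(\<psi> has_real_derivative 0) (at u)"
        by (rule has_field_derivative_transform_within_open[where S = "{x0<..<y}"]) (use u in \<open>auto intro: const[symmetric]\<close>)
      then show ?thesis using sol_D(6)[OF sol, of u] u x0 y DERIV_unique by auto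
    qed
    define u where "u = (x0 + y) / 2"
    have u: "u \<in> {x0<..<y}" "- a < u" "u < a" using y x0 by (auto simp: u_def field_simps)
    have "((\<lambda>_. 0) has_real_derivative 0) (at u)" by simp
    then have "((\<lambda>y. D (\<psi> y) * v y) has_real_derivative 0) (at u)"
      by (rule has_field_derivative_transform_within_open[where S = "{x0<..<y}"]) (use u flat in auto)
    then have "F (\<psi> u) / \<epsilon>\<^sup>2 = 0" using sol_D(7)[OF sol u(2,3)] DERIV_unique by blast
    then show False using F_pos[OF \<delta>] const[of u] u \<epsilon> by simp
  qed
  define P where "P y = D (\<psi> y) * v y" for y
  have Dpos: "0 < D (\<psi> y)" if "- a < y" "y < a" for y
    using D_ge[OF sol_D(4)[OF sol that]] d_pos by simp
  have P0: "P y \<noteq> 0" if y: "x0 < y" "y < a" for y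
  proof -
    have ya: "- a < y" "y < a" using y x0 by auto
    have "H (\<psi> x0) < H (\<psi> y)"
      using H_less[of "\<psi> x0" "\<psi> y"] \<delta> above[OF y] sol_D(5)[OF sol ya] by simp
    then show ?thesis using en[OF ya] by (auto simp: P_def)
  qed
  have "0 < P x"
  proof (rule ccontr)
    assume "\<not> 0 < P x"
    then have Px: "P x < 0" using P0[OF x] by simp
    have neg: "P y < 0" if y: "x0 < y" "y < x" for y
    proof (rule ccontr)
      assume "\<not> P y < 0"
      moreover have "continuous_on {y..x} P"
        unfolding P_def using y x x0
        by (intro continuous_at_imp_continuous_on ballI DERIV_isCont[OF sol_D(7)[OF sol]]) auto
      ultimately obtain u where "y \<le> u" "u \<le> x" "P u = 0"
        using IVT2'[of P x 0 y] Px y by auto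
      then show False using P0[of u] y x by auto
    qed
    have "\<psi> x < \<psi> x0"
    proof (rule DERIV_neg_imp_decreasing_open[OF x(1)])
      show "continuous_on {x0..x} \<psi>"
        by (rule continuous_on_subset[OF sol_D(1)[OF sol]]) (use x0 x in auto)
      fix y assume y: "x0 < y" "y < x"
      then have "v y < 0" using neg[OF y] Dpos[of y] x x0 by (auto simp: P_def mult_less_0_iff)
      moreover have "(\<psi> has_real_derivative v y) (at y)" using sol_D(6)[OF sol, of y] y x x0 by auto
      ultimately show "\<exists>z. (\<psi> has_real_derivative z) (at y) \<and> z < 0" by blast
    qed
    then show False using above[OF x] by simp
  qed
  moreover have "(\<epsilon> * P x)\<^sup>2 = 2 * (H (\<psi> x) - H (\<psi> x0))"
    using en[of x] x x0 by (simp add: P_def power_mult_distrib)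
  ultimately show "\<epsilon> * (D (\<psi> x) * v x) = sqrt (2 * (H (\<psi> x) - H (\<psi> x0)))"
    using \<epsilon> by (metis P_def less_imp_le mult_pos_pos real_sqrt_abs abs_of_nonneg)
  show "\<psi> x0 < \<psi> x" by (rule above[OF x])
qed

text \<open>
  The elapsed time is a primitive of \<open>1 / \<epsilon>\<close>: by the energy equation, \<open>\<epsilon> D v = sqrt (2 (H \<psi> - H \<delta>))\<close>, which
  cancels the integrand of the time map.
\<close>

lemma sol_time:
  assumes sol: "sol \<epsilon> a \<psi> v" and \<epsilon>: "\<epsilon> > 0"
    and x0: "- a < x0" "x0 < a" "v x0 = 0" and min: "\<And>x. x \<in> {-a..a} \<Longrightarrow> \<psi> x0 \<le> \<psi> x"
    and \<delta>: "0 < \<psi> x0" "\<psi> x0 < e" and x: "x0 \<le> x" "x \<le> a"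
  shows "integral {0..arcosh (\<psi> x / \<psi> x0)} (q (\<psi> x0)) = (x - x0) / \<epsilon>"
proof -
  define \<delta> where "\<delta> = \<psi> x0"
  have \<delta>': "0 < \<delta>" "\<delta> < e" "\<delta> < h" using \<delta> e_le by (auto simp: \<delta>_def)
  define Y where "Y y = integral {0..arcosh (\<psi> y / \<delta>)} (q \<delta>) - y / \<epsilon>" for y
  have le: "\<delta> \<le> \<psi> y" "\<psi> y \<le> h" if "x0 \<le> y" "y \<le> a" for y
    using min[of y] that x0 sol_D(3)[OF sol] sol_D(5)[OF sol, of y] by (cases "y = a"; auto simp: \<delta>_def)+
  have mono: "arcosh u \<le> arcosh w" if "1 \<le> u" "u \<le> w" for u w :: real
    using that by (cases "u = w") (auto intro!: less_imp_le arcosh_real_strict_mono)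
  have "Y x = Y x0"
  proof (rule DERIV_isconst2[OF x0(2) _ _ x])
    show "continuous_on {x0..a} Y"
      unfolding Y_def
    proof (intro continuous_intros continuous_on_compose2[OF integral_q_continuous[OF \<delta>'(1,2), of 0]])
      show "0 \<ge> - arcosh (h / \<delta>)" using \<delta>' by simp
      show "continuous_on {x0..a} \<psi>"
        by (rule continuous_on_subset[OF sol_D(1)[OF sol]]) (use x0 in auto)
      show "(\<lambda>y. arcosh (\<psi> y / \<delta>)) ` {x0..a} \<subseteq> {0..arcosh (h / \<delta>)}"
      proof clarify
        fix y assume "y \<in> {x0..a}"
        then have "1 \<le> \<psi> y / \<delta>" "\<psi> y / \<delta> \<le> h / \<delta>"
          using le[of y] \<delta>' by (auto simp: divide_right_mono)
        then show "arcosh (\<psi> y / \<delta>) \<in> {0..arcosh (h / \<delta>)}" using mono by simp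
      qed
    qed (use \<delta>' \<epsilon> le in auto)
    fix y assume y: "x0 < y" "y < a"
    have ya: "- a < y" "y < a" using y x0 by auto
    define c where "c = \<psi> y / \<delta>"
    note inc = sol_increasing[OF sol \<epsilon> x0 min \<delta> y, folded \<delta>_def]
    have s: "\<delta> < \<psi> y" "\<psi> y < h" using inc(1) sol_D(5)[OF sol ya] by (auto simp: \<delta>_def)
    have c: "1 < c" "c < h / \<delta>" using s \<delta>' by (auto simp: c_def divide_strict_right_mono)
    have ar: "0 < arcosh c" "arcosh c < arcosh (h / \<delta>)"
      using c arcosh_real_strict_mono[of 1 c] by auto
    have "((\<lambda>y. \<psi> y / \<delta>) has_real_derivative v y / \<delta>) (at y)"
      by (intro DERIV_cdivide sol_D(6)[OF sol] ya)
    then have "((\<lambda>y. arcosh (\<psi> y / \<delta>)) has_real_derivative 1 / sqrt (c\<^sup>2 - 1) * (v y / \<delta>)) (at y)"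
      using arcosh_real_has_field_derivative[OF c(1), of UNIV]
      by (intro DERIV_chain2[where f = arcosh]) (auto simp: c_def)
    then have "((\<lambda>y. integral {0..arcosh (\<psi> y / \<delta>)} (q \<delta>)) has_real_derivative
       q \<delta> (arcosh c) * (1 / sqrt (c\<^sup>2 - 1) * (v y / \<delta>))) (at y)"
    proof (intro DERIV_chain2[where f = "\<lambda>z. integral {0..z} (q \<delta>)"])
      show "((\<lambda>z. integral {0..z} (q \<delta>)) has_real_derivative q \<delta> (arcosh c)) (at (arcosh (\<psi> y / \<delta>)))"
        using integral_q_deriv[of \<delta> 0 "arcosh c"] ar \<delta>' by (simp add: c_def)
    qed
    moreover have "q \<delta> (arcosh c) * (1 / sqrt (c\<^sup>2 - 1) * (v y / \<delta>)) = 1 / \<epsilon>"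
    proof -
      define S where "S = sqrt (c\<^sup>2 - 1)"
      define B' where "B' = sqrt (2 * R (\<psi> y) \<delta>)"
      have S: "0 < S" using c by (simp add: S_def)
      have B': "0 < B'" using R_ge[of \<delta> "\<psi> y"] \<delta>' s m_pos by (simp add: B'_def)
      have cs: "\<delta> * cosh (arcosh c) = \<psi> y" using c \<delta>' by (simp add: c_def)
      have "(\<psi> y)\<^sup>2 - \<delta>\<^sup>2 = \<delta>\<^sup>2 * (c\<^sup>2 - 1)" using \<delta>' by (simp add: c_def power_divide right_diff_distrib)
      then have "2 * (H (\<psi> y) - H \<delta>) = (\<delta>\<^sup>2 * (c\<^sup>2 - 1)) * (2 * R (\<psi> y) \<delta>)"
        using H_diff_eq[of \<delta> "\<psi> y"] s \<delta>' by simp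
      then have "sqrt (2 * (H (\<psi> y) - H \<delta>)) = \<delta> * S * B'"
        using \<delta>' by (simp add: S_def B'_def real_sqrt_mult)
      then have "\<epsilon> * (D (\<psi> y) * v y) = \<delta> * S * B'" using inc(2) by simp
      then have "D (\<psi> y) * v y = \<delta> * S * B' / \<epsilon>" using \<epsilon> by (simp add: field_simps)
      moreover have "q \<delta> (arcosh c) = D (\<psi> y) / B'" by (simp add: q_def Q_def cs B'_def)
      ultimately have "q \<delta> (arcosh c) * (1 / S * (v y / \<delta>)) = (\<delta> * S * B' / \<epsilon>) / (B' * S * \<delta>)"
        by (simp add: mult_ac)
      also have "\<dots> = 1 / \<epsilon>" using S B' \<delta>' \<epsilon> by (simp add: field_simps)
      finally show ?thesis by (simp add: S_def)
    qed
    ultimately have "(Y has_real_derivative 1 / \<epsilon> - 1 / \<epsilon>) (at y)"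
      unfolding Y_def by (intro DERIV_diff DERIV_cdivide DERIV_ident) simp
    then show "(Y has_real_derivative 0) (at y)" by simp
  qed
  moreover have "arcosh (\<psi> x0 / \<delta>) = 0" using \<delta>' by (simp add: \<delta>_def)
  ultimately show ?thesis by (simp add: Y_def \<delta>_def diff_divide_distrib)
qed

text \<open>
  The times from the minimum to the two end points both equal \<open>T\<close> at the minimal distance, so the minimum
  is at the centre of the interval.
\<close>

lemma sol_symmetric:
  assumes sol: "sol \<epsilon> a \<psi> v" and \<epsilon>: "\<epsilon> > 0" and a: "a > 0" and "\<psi> 0 < e"
  shows "0 < \<psi> 0" "T (\<psi> 0) = a / \<epsilon>"
    and "\<And>x. x \<in> {-a..a} \<Longrightarrow> \<psi> 0 \<le> \<psi> x \<and> \<psi> x \<le> h \<and>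
      integral {0..arcosh (\<psi> x / \<psi> 0)} (q (\<psi> 0)) = \<bar>x\<bar> / \<epsilon>"
proof -
  obtain x0 where x0: "- a < x0" "x0 < a" "v x0 = 0" and pos: "0 < \<psi> x0"
    and min: "\<And>x. x \<in> {-a..a} \<Longrightarrow> \<psi> x0 \<le> \<psi> x"
    using sol_minimum[OF sol \<epsilon> a] by metis
  have le: "\<psi> x0 < e" using min[of 0] a assms by simp
  note right = sol_time[OF sol \<epsilon> x0 min pos le]
  have left: "integral {0..arcosh (\<psi> (- x) / \<psi> x0)} (q (\<psi> x0)) = (x + x0) / \<epsilon>"
    if "- x0 \<le> x" "x \<le> a" for x
    using sol_time[OF sol_mirror[OF sol] \<epsilon>, of "- x0" x] x0 min pos le that by simp
  have "T (\<psi> x0) = (a - x0) / \<epsilon>" "T (\<psi> x0) = (a + x0) / \<epsilon>"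
    using right[of a] left[of a] x0 sol_D(2,3)[OF sol] by (auto simp: T_def N_def)
  then have "x0 = 0" "T (\<psi> x0) = a / \<epsilon>" using \<epsilon> by (auto simp: field_simps)
  then show "0 < \<psi> 0" "T (\<psi> 0) = a / \<epsilon>" using pos by auto
  fix x assume x: "x \<in> {-a..a}"
  have "\<psi> x \<le> h" using sol_D(2,3)[OF sol] sol_D(5)[OF sol, of x] x
    by (cases "x = a \<or> x = - a") auto
  moreover have "integral {0..arcosh (\<psi> x / \<psi> 0)} (q (\<psi> 0)) = \<bar>x\<bar> / \<epsilon>"
    using right[of x] left[of "- x"] x \<open>x0 = 0\<close> by (cases "0 \<le> x") auto
  ultimately show "\<psi> 0 \<le> \<psi> x \<and> \<psi> x \<le> h \<and>
      integral {0..arcosh (\<psi> x / \<psi> 0)} (q (\<psi> 0)) = \<bar>x\<bar> / \<epsilon>"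
    using min[OF x] \<open>x0 = 0\<close> by simp
qed

lemma sol_unique:
  assumes "sol \<epsilon> a \<psi> v" "sol \<epsilon> a \<xi> w" "\<epsilon> > 0" "a > 0" "\<psi> 0 < e" "\<psi> 0 = \<xi> 0" "x \<in> {-a..a}"
  shows "\<psi> x = \<xi> x"
proof -
  define \<delta> where "\<delta> = \<psi> 0"
  have \<delta>: "0 < \<delta>" "\<delta> < e" using sol_symmetric(1)[OF assms(1,3,4,5)] assms by (auto simp: \<delta>_def)
  define Y where "Y s = integral {0..arcosh (s / \<delta>)} (q \<delta>)" for s
  have less: "Y s < Y t" if "\<delta> \<le> s" "s < t" "t \<le> h" for s t
  proof -
    have b: "1 \<le> s / \<delta>" "s / \<delta> < t / \<delta>" "t / \<delta> \<le> h / \<delta>"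
      using that \<delta> by (auto simp: divide_strict_right_mono divide_right_mono)
    then have "arcosh (t / \<delta>) \<le> arcosh (h / \<delta>)"
      by (cases "t = h") (auto intro!: less_imp_le arcosh_real_strict_mono simp: less_le)
    then show ?thesis unfolding Y_def using b \<delta> that
      by (intro integral_q_strict_mono arcosh_real_strict_mono) auto
  qed
  have "\<delta> \<le> \<psi> x" "\<psi> x \<le> h" "Y (\<psi> x) = \<bar>x\<bar> / \<epsilon>"
    using sol_symmetric(3)[OF assms(1,3,4,5,7)] by (auto simp: \<delta>_def Y_def)
  moreover have "\<delta> \<le> \<xi> x" "\<xi> x \<le> h" "Y (\<xi> x) = \<bar>x\<bar> / \<epsilon>"
    using sol_symmetric(3)[OF assms(2,3,4) _ assms(7)] assms by (auto simp: \<delta>_def Y_def)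
  ultimately show ?thesis using less[of "\<psi> x" "\<xi> x"] less[of "\<xi> x" "\<psi> x"]
    by (cases "\<psi> x" "\<xi> x" rule: linorder_cases) auto
qed

end

section \<open>Asymptotics of the time map\<close>

lemma set_integrable_bounded_continuous:
  fixes f :: "real \<Rightarrow> real"
  assumes "continuous_on {a<..<b} f" "\<And>x. x \<in> {a<..<b} \<Longrightarrow> \<bar>f x\<bar> \<le> C"
  shows "set_integrable lborel {a<..<b} f"
proof -
  have "(\<lambda>x. indicator {a<..<b} x *\<^sub>R f x) \<in> borel_measurable lborel"
    using borel_measurable_continuous_on_indicator[OF _ assms(1)] by simp
  moreover have "AE x in lborel. x \<in> {a<..<b} \<longrightarrow> norm (indicator {a<..<b} x *\<^sub>R f x) \<le> C"
    using assms(2) by (intro AE_I2) auto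
  ultimately have "integrable lborel (\<lambda>x. indicator {a<..<b} x *\<^sub>R (indicator {a<..<b} x *\<^sub>R f x))"
    by (intro integrableI_bounded_set_indicator[where B = C]) (cases "a \<le> b"; auto)+
  moreover have "(\<lambda>x. indicator {a<..<b} x *\<^sub>R (indicator {a<..<b} x *\<^sub>R f x)) = (\<lambda>x. indicator {a<..<b} x *\<^sub>R f x)"
    by (auto simp: indicator_def)
  ultimately show ?thesis unfolding set_integrable_def by simp
qed

lemma arcosh_close_ln:
  fixes x :: real
  assumes "1 \<le> x"
  shows "arcosh x \<le> ln (2 * x)" "ln (2 * x) - arcosh x \<le> 1 / x"
proof -
  define w where "w = sqrt (x\<^sup>2 - 1)"
  have w: "0 \<le> w" "w \<le> x" "w\<^sup>2 = x\<^sup>2 - 1"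
    using assms real_sqrt_le_mono[of "x\<^sup>2 - 1" "x\<^sup>2"] by (auto simp: w_def one_le_power)
  have ar: "arcosh x = ln (x + w)" using assms by (simp add: arcosh_real_def w_def)
  show "arcosh x \<le> ln (2 * x)" unfolding ar using w assms by (intro ln_mono) auto
  have "(x - w) * (x + w) = 1" using w by (simp add: power2_eq_square algebra_simps)
  then have "x - w = 1 / (x + w)" using w assms by (simp add: field_simps)
  also have "\<dots> \<le> 1 / 1" using w assms by (intro divide_left_mono) auto
  finally have "x - w \<le> 1" by simp
  have "ln (2 * x) - ln (x + w) = ln (2 * x / (x + w))" using w assms by (simp add: ln_div)
  also have "\<dots> \<le> 2 * x / (x + w) - 1" using w assms by (intro ln_le_minus_one) auto
  also have "\<dots> = (x - w) / (x + w)" using w assms by (simp add: field_simps)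
  also have "\<dots> \<le> 1 / x" using w assms \<open>x - w \<le> 1\<close> by (intro frac_le) auto
  finally show "ln (2 * x) - arcosh x \<le> 1 / x" using ar by simp
qed

context half_well
begin

text \<open>
  The reciprocal of \<open>Q0 0\<close>, the rate at which a solution leaves the zero. Subtracting the singular
  part \<open>1 / s\<close> of the limiting integrand leaves the bounded function \<open>i\<close>, whose integral fixes the
  constant \<open>K\<close>.
\<close>

definition A :: real where "A = sqrt (k 0) / D 0"
definition i :: "real \<Rightarrow> real" where "i s = A * D s / sqrt (2 * H s) - 1 / s"
definition K :: real where "K = 2 * h * exp (integral {0..h} i)"

lemma k0_pos: "0 < k 0" using rho_ge[of 0] h_pos m_pos by (simp add: \<rho>_def)

lemma D_pos: "0 \<le> s \<Longrightarrow> s \<le> h \<Longrightarrow> 0 < D s" using D_ge[of s] d_pos in_J[of s] by simp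

lemma A_pos: "0 < A" using k0_pos D_pos[of 0] h_pos by (simp add: A_def)

lemma A_Q0: "A * Q0 0 = 1"
  using k0_pos D_pos[of 0] h_pos by (simp add: A_def Q0_def \<rho>_def)

lemma K_pos: "0 < K" using h_pos by (simp add: K_def)

lemma s_i: "0 < s \<Longrightarrow> s \<le> h \<Longrightarrow> s * i s = A * (Q0 s - Q0 0)"
proof -
  assume s: "0 < s" "s \<le> h"
  have "2 * H s = s\<^sup>2 * (2 * \<rho> s)" using s by (simp add: \<rho>_def)
  then have "sqrt (2 * H s) = s * sqrt (2 * \<rho> s)" using s by (simp add: real_sqrt_mult)
  then have "s * i s = A * Q0 s - 1" using s by (simp add: i_def Q0_def right_diff_distrib)
  then show ?thesis using A_Q0 by (simp add: right_diff_distrib)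
qed

lemma i_bounded:
  assumes "0 < s" "s \<le> h"
  shows "\<bar>i s\<bar> \<le> A * B"
proof -
  have "s * \<bar>i s\<bar> = \<bar>s * i s\<bar>" using assms by (simp add: abs_mult)
  also have "\<dots> = A * \<bar>Q0 s - Q0 0\<bar>" using s_i[OF assms] A_pos by (simp add: abs_mult)
  also have "\<dots> \<le> A * (B * s)" using Q0_close[of s] assms A_pos by (intro mult_left_mono) auto
  finally show ?thesis using assms by simp
qed

lemma continuous_on_i:
  assumes "\<And>s. s \<in> S \<Longrightarrow> 0 < s \<and> s \<le> h"
  shows "continuous_on S i"
  unfolding i_def
proof (intro continuous_intros)
  have sub': "S \<subseteq> {0..h}" using assms by force
  show "continuous_on S D" by (rule continuous_on_subset[OF continuous_on_D sub'])
  show "continuous_on S H"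
    by (rule DERIV_continuous_on[OF DERIV_subset[OF H_deriv]]) (use sub' in_J in auto)
  show "\<forall>x\<in>S. sqrt (2 * H x) \<noteq> 0"
  proof
    fix x assume "x \<in> S"
    then have "0 < H x" using assms[of x] in_J[of x] by (intro H_pos) auto
    then show "sqrt (2 * H x) \<noteq> 0" by simp
  qed
  show "\<forall>x\<in>S. x \<noteq> 0" using assms by force
qed

lemma i_set_integrable: "set_integrable lborel {0<..<h} i"
  by (rule set_integrable_bounded_continuous[where C = "A * B"])
     (auto intro!: continuous_on_i i_bounded)

lemma i_integrable: "i integrable_on {0..h}"
  using set_borel_integral_eq_integral(1)[OF i_set_integrable] by (simp add: integrable_on_open_interval_real)

text \<open>
  Replacing \<open>Q s \<delta>\<close> by \<open>Q0 s\<close> costs \<open>B \<delta>\<close> per unit of \<open>z\<close>, and the range of \<open>z\<close> has length at most a multiple of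
  \<open>T \<delta>\<close>. What remains is \<open>A Q0 s = 1 + s i s\<close>. The constant part gives \<open>arcosh (h / \<delta>)\<close>, which is
  \<open>ln (2 h / \<delta>)\<close> up to order \<open>\<delta>\<close>. The other part is the integral of \<open>i\<close>, up to order \<open>\<delta>\<close>, because
  \<open>cosh z\<close> and the Jacobian \<open>sinh z\<close> differ by \<open>exp (- z)\<close>.
\<close>

lemma T_asymptotic:
  obtains C where "0 \<le> C" "\<And>\<delta>. 0 < \<delta> \<Longrightarrow> \<delta> < e \<Longrightarrow> \<bar>A * T \<delta> - ln (K / \<delta>)\<bar> \<le> C * \<delta> * (1 + T \<delta>)"
proof
  let ?C = "A * B * (sqrt M / d) + 2 * A * B + 1 / h"
  show "0 \<le> ?C" using A_pos B_nonneg h_pos M_pos d_pos by simp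
  fix \<delta> :: real assume \<delta>: "0 < \<delta>" "\<delta> < e"
  define Z where "Z = arcosh (h / \<delta>)"
  have ge: "1 \<le> h / \<delta>" using \<delta> e_le by simp
  have Z: "0 \<le> Z" using ge by (simp add: Z_def)
  have rng: "\<delta> \<le> \<delta> * cosh z" "\<delta> * cosh z \<le> h" if "z \<in> {0..Z}" for z
    using cosh_range[of \<delta> h z] that \<delta> e_le by (auto simp: Z_def)
  have ends: "\<delta> * cosh Z = h" using ge \<delta> by (simp add: Z_def)
  have ci: "continuous_on {\<delta>..h} i" by (rule continuous_on_i) (use \<delta> in auto)
  have ciz: "continuous_on {0..Z} (\<lambda>z. i (\<delta> * cosh z))"
    by (rule continuous_on_compose2[OF ci]) (use rng in \<open>auto intro!: continuous_intros\<close>)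
  have qi: "q \<delta> integrable_on {0..Z}" using \<delta> Z by (intro q_integrable) (auto simp: Z_def)
  define u where "u z = 1 + \<delta> * cosh z * i (\<delta> * cosh z)" for z
  define w where "w z = i (\<delta> * cosh z) * (\<delta> * sinh z)" for z
  define c where "c z = i (\<delta> * cosh z) * (\<delta> * (cosh z - sinh z))" for z
  have int: "u integrable_on {0..Z}" "w integrable_on {0..Z}" "c integrable_on {0..Z}"
    unfolding u_def w_def c_def by (intro integrable_continuous_real continuous_intros ciz)+
  have "norm (integral {0..Z} (\<lambda>z. A * q \<delta> z - u z)) \<le> integral {0..Z} (\<lambda>z. A * (B * \<delta>))"
  proof (rule integral_norm_bound_integral)
    fix z assume z: "z \<in> {0..Z}"
    have "A * q \<delta> z - u z = A * (Q (\<delta> * cosh z) \<delta> - Q0 (\<delta> * cosh z))"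
      using s_i[of "\<delta> * cosh z"] rng[OF z] \<delta> A_Q0 by (simp add: u_def q_def right_diff_distrib)
    also have "\<bar>\<dots>\<bar> \<le> A * (B * \<delta>)"
      unfolding abs_mult using A_pos Q_close_Q0[OF \<delta> rng[OF z]] by (simp add: mult_left_mono)
    finally show "norm (A * q \<delta> z - u z) \<le> A * (B * \<delta>)" by simp
  qed (use int qi in \<open>auto intro!: integrable_diff integrable_on_mult_right\<close>)
  then have b1: "\<bar>integral {0..Z} (\<lambda>z. A * q \<delta> z - u z)\<bar> \<le> A * (B * \<delta>) * Z" using Z by (simp add: mult_ac)
  have T: "T \<delta> = integral {0..Z} (q \<delta>)" by (simp add: T_def N_def Z_def)
  have e1: "integral {0..Z} (\<lambda>z. A * q \<delta> z - u z) = A * T \<delta> - integral {0..Z} u"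
    unfolding T using int qi by (subst integral_diff) (auto intro!: integrable_on_mult_right)
  have e2: "integral {0..Z} u = Z + integral {0..Z} w + integral {0..Z} c"
  proof -
    have "u = (\<lambda>z. 1 + (w z + c z))" by (auto simp: u_def w_def c_def algebra_simps)
    then have "integral {0..Z} u = integral {0..Z} (\<lambda>z. 1) + integral {0..Z} (\<lambda>z. w z + c z)"
      by (simp only: integral_add[OF integrable_const_ivl integrable_add[OF int(2,3)]])
    then show ?thesis using int Z by (simp add: integral_add)
  qed
  have "((\<lambda>z. (\<delta> * sinh z) *\<^sub>R i (\<delta> * cosh z)) has_integral (integral {\<delta> * cosh 0..\<delta> * cosh Z} i)) {0..Z}"
    by (rule has_integral_substitution[where g = "\<lambda>z. \<delta> * cosh z", OF Z _ _ ci])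
       (use rng ends \<delta> e_le in \<open>auto intro!: derivative_eq_intros\<close>)
  then have e3: "integral {0..Z} w = integral {\<delta>..h} i"
    unfolding w_def using ends by (auto intro: integral_unique simp: mult.commute)
  have e4: "integral {0..h} i = integral {0..\<delta>} i + integral {\<delta>..h} i"
    using \<delta> e_le i_integrable by (intro Henstock_Kurzweil_Integration.integral_combine[symmetric]) auto
  have b2: "\<bar>integral {0..Z} c\<bar> \<le> A * B * \<delta>"
  proof -
    have "norm (integral {0..Z} c) \<le> integral {0..Z} (\<lambda>z. A * B * \<delta> * exp (- z))"
    proof (rule integral_norm_bound_integral)
      fix z assume z: "z \<in> {0..Z}"
      have "cosh z - sinh z = exp (- z)" by (simp add: cosh_minus_sinh)
      then show "norm (c z) \<le> A * B * \<delta> * exp (- z)"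
        using i_bounded[of "\<delta> * cosh z"] rng[OF z] \<delta>
        by (auto simp: c_def abs_mult mult.assoc[symmetric] intro!: mult_right_mono)
    qed (use int in \<open>auto intro!: integrable_continuous_real continuous_intros\<close>)
    also have "integral {0..Z} (\<lambda>z. A * B * \<delta> * exp (- z)) = - (A * B * \<delta> * exp (- Z)) - - (A * B * \<delta> * exp (- 0))"
      using Z by (intro integral_unique fundamental_theorem_of_calculus)
        (auto intro!: derivative_eq_intros simp flip: has_real_derivative_iff_has_vector_derivative)
    also have "\<dots> \<le> A * B * \<delta>" using A_pos B_nonneg \<delta> by simp
    finally show ?thesis by simp
  qed
  have b3: "\<bar>integral {0..\<delta>} i\<bar> \<le> A * B * \<delta>"
  proof -
    have "(i has_integral integral {0..\<delta>} i) {0..\<delta>}"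
      by (rule integrable_integral, rule integrable_subinterval_real[OF i_integrable]) (use \<delta> e_le in auto)
    then have "(i has_integral integral {0..\<delta>} i) {0<..<\<delta>}" by (simp add: has_integral_Icc_iff_Ioo)
    then have "((\<lambda>s. if s \<in> {0<..<\<delta>} then i s else 0) has_integral integral {0..\<delta>} i) {0..\<delta>}"
      by (subst has_integral_restrict) auto
    then have "norm (integral {0..\<delta>} i) \<le> A * B * measure lborel (cbox 0 \<delta>)"
      using A_pos B_nonneg i_bounded \<delta> e_le by (intro has_integral_bound) auto
    then show ?thesis using \<delta> by simp
  qed
  have lnK: "ln (K / \<delta>) = ln (2 * (h / \<delta>)) + integral {0..h} i"
  proof -
    have "K / \<delta> = 2 * (h / \<delta>) * exp (integral {0..h} i)" by (simp add: K_def)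
    moreover have "ln (2 * (h / \<delta>) * exp (integral {0..h} i)) = ln (2 * (h / \<delta>)) + ln (exp (integral {0..h} i))"
      using ge by (intro ln_mult_pos) auto
    ultimately show ?thesis by (simp only: ln_exp)
  qed
  have b4: "\<bar>ln (2 * (h / \<delta>)) - Z\<bar> \<le> \<delta> / h"
    using arcosh_close_ln[OF ge] by (simp add: Z_def abs_le_iff)
  have "\<bar>A * T \<delta> - ln (K / \<delta>)\<bar> \<le> A * (B * \<delta>) * Z + A * B * \<delta> + A * B * \<delta> + \<delta> / h"
    using b1 b2 b3 b4 unfolding e1 e2 e3 e4 lnK by linarith
  also have "\<dots> \<le> A * (B * \<delta>) * (sqrt M / d * T \<delta>) + A * B * \<delta> + A * B * \<delta> + \<delta> / h"
  proof -
    have "Z \<le> sqrt M / d * T \<delta>" using T_ge[OF \<delta>] d_pos M_pos by (simp add: Z_def field_simps)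
    then show ?thesis using A_pos B_nonneg \<delta> by (intro add_right_mono mult_left_mono) auto
  qed
  also have "\<dots> \<le> ?C * \<delta> * (1 + T \<delta>)"
  proof -
    have T0: "0 \<le> T \<delta>" using T_ge[OF \<delta>] d_pos M_pos Z by (smt (verit) Z_def divide_nonneg_nonneg mult_nonneg_nonneg real_sqrt_ge_zero)
    have "0 \<le> A * B * (sqrt M / d) * \<delta>" "0 \<le> (2 * A * B + 1 / h) * \<delta> * T \<delta>"
      using A_pos B_nonneg \<delta> M_pos d_pos h_pos T0 by auto
    moreover have alg: "A * (B * \<delta>) * (s * t) + A * B * \<delta> + A * B * \<delta> + c * \<delta> \<le> (A * B * s + 2 * A * B + c) * \<delta> * (1 + t)"
      if "0 \<le> A * B * s * \<delta>" "0 \<le> (2 * A * B + c) * \<delta> * t" for s t c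
      using that by (simp add: algebra_simps)
    ultimately show ?thesis using alg[of "sqrt M / d" "1 / h" "T \<delta>"] by simp
  qed
  finally show "\<bar>A * T \<delta> - ln (K / \<delta>)\<bar> \<le> ?C * \<delta> * (1 + T \<delta>)" .
qed

lemma T_le:
  assumes "0 < \<delta>" "\<delta> < e"
  shows "T \<delta> \<le> M / sqrt m * ln (2 * (h / \<delta>))" "0 \<le> T \<delta>"
proof -
  have ge: "1 \<le> h / \<delta>" using assms e_le by simp
  have Z: "0 \<le> arcosh (h / \<delta>)" using ge by simp
  have qi: "q \<delta> integrable_on {0..arcosh (h / \<delta>)}" using assms Z by (intro q_integrable) auto
  have "integral {0..arcosh (h / \<delta>)} (q \<delta>) \<le> integral {0..arcosh (h / \<delta>)} (\<lambda>z. M / sqrt m)"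
    using q_bounds(2)[OF assms] by (intro integral_le qi) auto
  also have "\<dots> = M / sqrt m * arcosh (h / \<delta>)" using Z by simp
  also have "\<dots> \<le> M / sqrt m * ln (2 * (h / \<delta>))"
    using arcosh_close_ln(1)[OF ge] M_pos m_pos by (intro mult_left_mono) auto
  finally show "T \<delta> \<le> M / sqrt m * ln (2 * (h / \<delta>))" by (simp add: T_def N_def)
  show "0 \<le> T \<delta>" unfolding T_def N_def using q_bounds(3)[OF assms]
    by (intro integral_nonneg qi) (auto intro: less_imp_le)
qed

text \<open>
  With \<open>T \<delta> = 1 / (2 r)\<close> the expansion reads \<open>\<delta> = K exp (- A / (2 r)) exp err\<close>, where \<open>err\<close> is of order \<open>\<delta> / r\<close>.
  Once \<open>\<bar>err\<bar> < 1 / 2\<close>, \<open>\<delta>\<close> itself is at most \<open>2 K exp (- A / (2 r))\<close>, which gives the order of \<open>err\<close> in terms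
  of \<open>r\<close>. The expansion of \<open>H \<delta>\<close> follows from \<open>H \<delta> = \<rho> \<delta> \<delta>\<^sup>2\<close>.
\<close>

lemma delta_asymptotic:
  assumes "0 < \<eta>"
  obtains \<delta> r1 C where "0 < r1"
    "\<And>r. 0 < r \<Longrightarrow> r < r1 \<Longrightarrow> 0 < \<delta> r \<and> \<delta> r < \<eta> \<and> \<delta> r < e \<and> T (\<delta> r) = 1 / (2 * r)"
    "\<And>r. 0 < r \<Longrightarrow> r < r1 \<Longrightarrow>
       \<bar>\<delta> r / (K * exp (- A / (2 * r))) - 1\<bar> \<le> C * (1 / r * exp (- A / (2 * r)))"
    "\<And>r. 0 < r \<Longrightarrow> r < r1 \<Longrightarrow>
       \<bar>H (\<delta> r) / (1 / 2 * A\<^sup>2 * (D 0)\<^sup>2 * K\<^sup>2 * exp (- A / r)) - 1\<bar> \<le> C * (1 / r * exp (- A / (2 * r)))"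
proof -
  obtain C where C: "0 \<le> C" "\<And>\<delta>. 0 < \<delta> \<Longrightarrow> \<delta> < e \<Longrightarrow> \<bar>A * T \<delta> - ln (K / \<delta>)\<bar> \<le> C * \<delta> * (1 + T \<delta>)"
    using T_asymptotic by metis
  define p where "p = M / sqrt m"
  have p: "0 < p" using M_pos m_pos by (simp add: p_def)
  \<comment> \<open>The error times \<open>T\<close> tends to zero because \<open>T\<close> grows only logarithmically.\<close>
  have "((\<lambda>\<delta>. C * \<delta> * (1 + p * ln (2 * (h / \<delta>)))) \<longlongrightarrow> 0) (at_right 0)"
    using h_pos p C by real_asymp
  then have "\<forall>\<^sub>F \<delta> in at_right 0. C * \<delta> * (1 + p * ln (2 * (h / \<delta>))) < 1 / 2"
    by (rule order_tendstoD) simp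
  then obtain b where b: "0 < b" "\<And>\<delta>. 0 < \<delta> \<Longrightarrow> \<delta> < b \<Longrightarrow> C * \<delta> * (1 + p * ln (2 * (h / \<delta>))) < 1 / 2"
    unfolding eventually_at_right_field by auto
  define \<delta>1 where "\<delta>1 = min (min (\<eta> / 2) (e / 2)) (b / 2)"
  have \<delta>1: "0 < \<delta>1" "\<delta>1 < \<eta>" "\<delta>1 < e" "\<delta>1 < b" using assms e_pos b by (auto simp: \<delta>1_def)
  define r1 where "r1 = min 1 (1 / (2 * (T \<delta>1 + 1)))"
  have T1: "0 \<le> T \<delta>1" using T_le(2) \<delta>1 by simp
  have r1: "0 < r1" using T1 by (simp add: r1_def)
  have ex: "\<exists>\<delta>. 0 < \<delta> \<and> \<delta> < \<delta>1 \<and> T \<delta> = 1 / (2 * r)" if r: "0 < r" "r < r1" for r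
  proof -
    have "r < 1 / (2 * (T \<delta>1 + 1))" using r by (simp add: r1_def)
    then have "T \<delta>1 < 1 / (2 * r)" using T1 r by (simp add: field_simps)
    then show ?thesis using T_attains[of \<delta>1 "1 / (2 * r)"] \<delta>1 by metis
  qed
  define \<delta> where "\<delta> r = (SOME \<delta>. 0 < \<delta> \<and> \<delta> < \<delta>1 \<and> T \<delta> = 1 / (2 * r))" for r
  have \<delta>: "0 < \<delta> r" "\<delta> r < \<delta>1" "T (\<delta> r) = 1 / (2 * r)" if "0 < r" "r < r1" for r
    using someI_ex[OF ex[OF that]] by (auto simp: \<delta>_def)
  define g where "g r = 1 / r * exp (- A / (2 * r))" for r
  define t where "t r = \<delta> r / (K * exp (- A / (2 * r)))" for r
  have main: "\<bar>t r - 1\<bar> \<le> 8 * C * K * g r \<and> 0 < t r \<and> t r \<le> 2 \<and> \<delta> r \<le> 2 * K * g r"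
    if r: "0 < r" "r < r1" for r
  proof -
    define y where "y = exp (- A / (2 * r))"
    define err where "err = A * T (\<delta> r) - ln (K / \<delta> r)"
    have r1': "r < 1" using r by (simp add: r1_def)
    have d: "0 < \<delta> r" "\<delta> r < e" "\<delta> r < b" using \<delta>[OF r] \<delta>1 by auto
    have err: "\<bar>err\<bar> \<le> C * \<delta> r * (1 + T (\<delta> r))" unfolding err_def by (rule C(2)[OF d(1,2)])
    also have "\<dots> \<le> C * \<delta> r * (1 + p * ln (2 * (h / \<delta> r)))"
      using T_le(1)[OF d(1,2)] C d by (intro mult_left_mono) (auto simp: p_def)
    also have "\<dots> < 1 / 2" using b(2) d by simp
    finally have small: "\<bar>err\<bar> < 1 / 2" .
    have "t r = exp err"
    proof -
      have "err = A / (2 * r) + ln (\<delta> r / K)"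
        using d K_pos by (simp add: err_def \<delta>(3)[OF r] ln_div)
      then have "exp err = exp (A / (2 * r)) * (\<delta> r / K)"
        using d K_pos by (simp add: exp_add)
      then show ?thesis by (simp add: t_def exp_minus field_simps)
    qed
    moreover have "exp err \<le> 1 + 2 * \<bar>err\<bar>"
      using exp_bound_lemma[of err] small by simp
    moreover have "1 + err \<le> exp err" by (rule exp_ge_add_one_self)
    ultimately have "t r - 1 \<le> 2 * \<bar>err\<bar>" "1 - t r \<le> 2 * \<bar>err\<bar>" "0 < t r" by (linarith | simp)+
    then have t: "\<bar>t r - 1\<bar> \<le> 2 * \<bar>err\<bar>" "0 < t r" "t r \<le> 2" using small by auto
    have y: "0 < y" "y \<le> g r" using r r1' by (auto simp: y_def g_def field_simps)
    have "\<delta> r = t r * (K * y)" using K_pos by (simp add: t_def y_def)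
    also have "\<dots> \<le> 2 * (K * y)" using t K_pos y by (intro mult_right_mono) auto
    finally have dy: "\<delta> r \<le> 2 * (K * y)" .
    have "1 + T (\<delta> r) \<le> 2 / r" using r r1' \<delta>(3)[OF r] by (simp add: field_simps)
    then have "C * \<delta> r * (1 + T (\<delta> r)) \<le> C * \<delta> r * (2 / r)" using C d by (intro mult_left_mono) auto
    also have "\<dots> \<le> C * (2 * (K * y)) * (2 / r)" using dy C d r by (intro mult_right_mono mult_left_mono) auto
    also have "\<dots> = 4 * C * K * g r" by (simp add: g_def y_def)
    finally have "\<bar>err\<bar> \<le> 4 * C * K * g r" using err by simp
    moreover have "2 * (K * y) \<le> 2 * K * g r" using y K_pos by simp
    ultimately show ?thesis using t dy by linarith
  qed
  have theta: "\<bar>H (\<delta> r) / (1 / 2 * A\<^sup>2 * (D 0)\<^sup>2 * K\<^sup>2 * exp (- A / r)) - 1\<bar> \<le> (24 * C * K + 4 * (L / \<rho> 0) * K) * g r"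
    if r: "0 < r" "r < r1" for r
  proof -
    have d: "0 < \<delta> r" "\<delta> r \<le> h" using \<delta>[OF r] \<delta>1 e_le by auto
    have \<rho>0: "0 < \<rho> 0" using rho_ge[of 0] h_pos m_pos by simp
    define s where "s = \<rho> (\<delta> r) / \<rho> 0"
    have "1 / 2 * A\<^sup>2 * (D 0)\<^sup>2 = \<rho> 0"
      using k0_pos D_pos[of 0] h_pos by (simp add: A_def \<rho>_def power_divide)
    moreover have "H (\<delta> r) = \<rho> (\<delta> r) * (\<delta> r)\<^sup>2" using d by (simp add: \<rho>_def)
    moreover have "exp (- A / r) = (exp (- A / (2 * r)))\<^sup>2" by (simp flip: exp_double)
    ultimately have "H (\<delta> r) / (1 / 2 * A\<^sup>2 * (D 0)\<^sup>2 * K\<^sup>2 * exp (- A / r)) = s * (t r)\<^sup>2"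
      by (simp add: s_def t_def power_divide power_mult_distrib)
    also have "s * (t r)\<^sup>2 - 1 = (s - 1) * (t r)\<^sup>2 + (t r - 1) * (t r + 1)"
      by (simp add: power2_eq_square algebra_simps)
    also have "\<bar>\<dots>\<bar> \<le> \<bar>s - 1\<bar> * (t r)\<^sup>2 + \<bar>t r - 1\<bar> * \<bar>t r + 1\<bar>"
      by (rule order_trans[OF abs_triangle_ineq]) (simp add: abs_mult)
    also have "\<dots> \<le> (L / \<rho> 0 * K * g r) * 2\<^sup>2 + (8 * C * K * g r) * 3"
    proof (intro add_mono mult_mono)
      have "\<bar>s - 1\<bar> = \<bar>\<rho> (\<delta> r) - \<rho> 0\<bar> / \<rho> 0" using \<rho>0 by (simp add: s_def field_simps)
      also have "\<dots> \<le> (L * \<delta> r / 2) / \<rho> 0" using rho_0_close[of "\<delta> r"] d \<rho>0 by (intro divide_right_mono) auto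
      also have "\<dots> \<le> (L * (2 * K * g r) / 2) / \<rho> 0"
        using main[OF r] L_nonneg \<rho>0 by (intro divide_right_mono mult_left_mono) auto
      finally show "\<bar>s - 1\<bar> \<le> L / \<rho> 0 * K * g r" by simp
      show "(t r)\<^sup>2 \<le> 2\<^sup>2" using main[OF r] by (intro power_mono) auto
      show "\<bar>t r - 1\<bar> \<le> 8 * C * K * g r" "\<bar>t r + 1\<bar> \<le> 3" using main[OF r] by auto
      show "0 \<le> L / \<rho> 0 * K * g r" "0 \<le> 8 * C * K * g r"
        using L_nonneg \<rho>0 K_pos r C by (auto simp: g_def)
    qed auto
    finally show ?thesis by (simp add: algebra_simps)
  qed
  show ?thesis
  proof (rule that[of r1 \<delta> "24 * C * K + 4 * (L / \<rho> 0) * K"])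
    fix r assume r: "0 < r" "r < r1"
    show "0 < \<delta> r \<and> \<delta> r < \<eta> \<and> \<delta> r < e \<and> T (\<delta> r) = 1 / (2 * r)" using \<delta>[OF r] \<delta>1 by simp
    have "0 < \<rho> 0" using rho_ge[of 0] h_pos m_pos by simp
    then have "8 * C * K * g r \<le> (24 * C * K + 4 * (L / \<rho> 0) * K) * g r"
      using C K_pos L_nonneg r by (intro mult_right_mono) (auto simp: g_def)
    then show "\<bar>\<delta> r / (K * exp (- A / (2 * r))) - 1\<bar>
        \<le> (24 * C * K + 4 * (L / \<rho> 0) * K) * (1 / r * exp (- A / (2 * r)))"
      using main[OF r] unfolding t_def[symmetric] g_def[symmetric] by linarith
    show "\<bar>H (\<delta> r) / (1 / 2 * A\<^sup>2 * (D 0)\<^sup>2 * K\<^sup>2 * exp (- A / r)) - 1\<bar>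
        \<le> (24 * C * K + 4 * (L / \<rho> 0) * K) * (1 / r * exp (- A / (2 * r)))"
      using theta[OF r] unfolding g_def .
  qed (rule r1)
qed

end

section \<open>Reduction of the two wells to the normalised problem\<close>

lemma C1_imp_Lipschitz:
  fixes g :: "real \<Rightarrow> real"
  assumes "g C1_differentiable_on S" "{a..b} \<subseteq> S"
  obtains L where "0 \<le> L" "\<And>x y. x \<in> {a..b} \<Longrightarrow> y \<in> {a..b} \<Longrightarrow> \<bar>g x - g y\<bar> \<le> L * \<bar>x - y\<bar>"
proof -
  obtain g' where g': "\<And>x. x \<in> S \<Longrightarrow> (g has_vector_derivative g' x) (at x)" "continuous_on S g'"
    using assms(1) unfolding C1_differentiable_on_def by auto
  have "compact (g' ` {a..b})"
    by (intro compact_continuous_image continuous_on_subset[OF g'(2) assms(2)] compact_Icc)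
  then obtain C where C: "\<forall>x\<in>{a..b}. norm (g' x) \<le> C"
    using compact_imp_bounded[of "g' ` {a..b}"] unfolding bounded_iff by auto
  show ?thesis
  proof
    fix x y assume xy: "x \<in> {a..b}" "y \<in> {a..b}"
    have "norm (g x - g y) \<le> max C 0 * norm (x - y)"
    proof (rule field_differentiable_bound[OF convex_real_interval(5) _ _ xy])
      fix z assume z: "z \<in> {a..b}"
      show "(g has_real_derivative g' z) (at z within {a..b})"
        unfolding has_real_derivative_iff_has_vector_derivative
        using z assms(2) by (intro has_vector_derivative_at_within[OF g'(1)]) auto
      show "norm (g' z) \<le> max C 0" using C z by force
    qed
    then show "\<bar>g x - g y\<bar> \<le> max C 0 * \<bar>x - y\<bar>" by simp
  qed simp
qed

text \<open>
  For \<open>s \<noteq> 0\<close> the function \<open>\<tau> \<mapsto> F (s \<tau>) / s\<close> has the derivative \<open>F' (s \<tau>)\<close>, and for \<open>s = 0\<close> the function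
  \<open>\<tau> \<mapsto> F' 0 \<tau>\<close> takes its place. The difference of two of these functions at \<open>\<tau> = 1\<close> is thus controlled by the
  Lipschitz constant of \<open>F'\<close>.
\<close>

lemma difference_quotient_Lipschitz:
  fixes F F' :: "real \<Rightarrow> real"
  assumes deriv: "\<And>s. s \<in> {0..h} \<Longrightarrow> (F has_real_derivative F' s) (at s)"
    and Lip: "\<And>s t. s \<in> {0..h} \<Longrightarrow> t \<in> {0..h} \<Longrightarrow> \<bar>F' s - F' t\<bar> \<le> L * \<bar>s - t\<bar>"
    and "F 0 = 0" and "s \<in> {0..h}" "t \<in> {0..h}"
  defines "e \<equiv> \<lambda>s. if s = 0 then F' 0 else F s / s"
  shows "\<bar>e s - e t\<bar> \<le> L * \<bar>s - t\<bar>"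
proof -
  define P where "P s \<tau> = (if s = 0 then F' 0 * \<tau> else F (s * \<tau>) / s)" for s \<tau>
  have P: "(P s has_real_derivative F' (s * \<tau>)) (at \<tau>)"
    if "s \<in> {0..h}" "0 \<le> \<tau>" "\<tau> \<le> 1" for s \<tau>
  proof (cases "s = 0")
    case False
    have "s * \<tau> \<in> {0..h}" using that mult_mono[of s h \<tau> 1] by auto
    then have "((\<lambda>\<tau>. F (s * \<tau>)) has_real_derivative F' (s * \<tau>) * s) (at \<tau>)"
      by (intro DERIV_chain2[where f = F and g = "\<lambda>\<tau>. s * \<tau>"] deriv) (auto intro!: derivative_eq_intros)
    from DERIV_cdivide[OF this, of s]
    have "((\<lambda>\<tau>. F (s * \<tau>) / s) has_real_derivative F' (s * \<tau>)) (at \<tau>)" using False by simp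
    moreover have "P s = (\<lambda>\<tau>. F (s * \<tau>) / s)" using False by (simp add: P_def fun_eq_iff)
    ultimately show ?thesis by simp
  next
    case True
    have "P s = (\<lambda>\<tau>. F' 0 * \<tau>)" using True by (simp add: P_def fun_eq_iff)
    then show ?thesis using True by (auto intro!: derivative_eq_intros)
  qed
  have "\<bar>(P s 1 - P t 1) - (P s 0 - P t 0)\<bar> \<le> (L * \<bar>s - t\<bar>) * (1 - 0)"
  proof -
    have "\<bar>F' (s * \<tau>) - F' (t * \<tau>)\<bar> \<le> (L * \<bar>s - t\<bar>) * \<tau>" if "0 \<le> \<tau>" "\<tau> \<le> 1" for \<tau>
    proof -
      have "s * \<tau> \<in> {0..h}" "t * \<tau> \<in> {0..h}"
        using that assms(4,5) mult_mono[of s h \<tau> 1] mult_mono[of t h \<tau> 1] by auto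
      then have "\<bar>F' (s * \<tau>) - F' (t * \<tau>)\<bar> \<le> L * \<bar>s * \<tau> - t * \<tau>\<bar>" by (rule Lip)
      also have "\<bar>s * \<tau> - t * \<tau>\<bar> = \<bar>s - t\<bar> * \<tau>" using that by (simp add: abs_mult flip: left_diff_distrib)
      finally show ?thesis by (simp add: mult_ac)
    qed
    then have "\<bar>(P s 1 - P t 1) - (P s 0 - P t 0)\<bar> \<le> (L * \<bar>s - t\<bar>) * (1\<^sup>2 - 0\<^sup>2) / 2"
      using assms(4,5)
      by (intro bounded_by_quadratic_derivative[where f = "\<lambda>\<tau>. P s \<tau> - P t \<tau>"
            and f' = "\<lambda>\<tau>. F' (s * \<tau>) - F' (t * \<tau>)"] DERIV_diff P) auto
    moreover have "0 \<le> L * \<bar>s - t\<bar>" using Lip[of s t] assms(4,5) abs_ge_zero order_trans by blast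
    ultimately show ?thesis by simp
  qed
  moreover have "P s 1 = e s" "P t 1 = e t" "P s 0 = 0" "P t 0 = 0"
    using \<open>F 0 = 0\<close> by (auto simp: P_def e_def)
  ultimately show ?thesis by simp
qed

text \<open>
  The quadratic lower bound for the potential comes from \<open>k 0 > 0\<close> near the zero and from compactness
  away from it.
\<close>

lemma half_wellI:
  fixes J :: "real set" and D F F' H :: "real \<Rightarrow> real" and h d :: real
  assumes "h > 0" "{0..h} \<subseteq> J" "d > 0" and D_ge: "\<And>s. s \<in> J \<Longrightarrow> d \<le> D s"
    and D_C1: "D C1_differentiable_on J"
    and F_deriv: "\<And>s. s \<in> J \<Longrightarrow> (F has_real_derivative F' s) (at s)" and F'_C1: "F' C1_differentiable_on J"
    and "F 0 = 0" "F' 0 > 0"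
    and H_deriv: "\<And>s. s \<in> J \<Longrightarrow> (H has_real_derivative F s * D s) (at s)" and "H 0 = 0"
    and H_pos: "\<And>s. s \<in> J \<Longrightarrow> s \<noteq> 0 \<Longrightarrow> s \<le> h \<Longrightarrow> 0 < H s"
  obtains k L M m where "half_well J D F H k h d L M m" "k 0 = F' 0 * D 0"
proof -
  have in_J: "s \<in> J" if "s \<in> {0..h}" for s using that assms by auto
  define u where "u s = (if s = 0 then F' 0 else F s / s)" for s
  define k where "k s = u s * D s" for s
  obtain LD where LD: "0 \<le> LD" "\<And>x y. x \<in> {0..h} \<Longrightarrow> y \<in> {0..h} \<Longrightarrow> \<bar>D x - D y\<bar> \<le> LD * \<bar>x - y\<bar>"
    using C1_imp_Lipschitz[OF D_C1 assms(2)] by metis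
  obtain LF where LF: "0 \<le> LF" "\<And>x y. x \<in> {0..h} \<Longrightarrow> y \<in> {0..h} \<Longrightarrow> \<bar>F' x - F' y\<bar> \<le> LF * \<bar>x - y\<bar>"
    using C1_imp_Lipschitz[OF F'_C1 assms(2)] by metis
  have u_Lip: "\<bar>u s - u t\<bar> \<le> LF * \<bar>s - t\<bar>" if "s \<in> {0..h}" "t \<in> {0..h}" for s t
    unfolding u_def
    by (rule difference_quotient_Lipschitz[of h F F' LF, OF F_deriv[OF in_J] LF(2) \<open>F 0 = 0\<close> that])
  define MD where "MD = \<bar>D 0\<bar> + LD * h"
  define Mu where "Mu = \<bar>u 0\<bar> + LF * h"
  have D_bd: "\<bar>D s\<bar> \<le> MD" if "s \<in> {0..h}" for s
    using LD(2)[of s 0] that mult_left_mono[of s h LD] LD(1) \<open>h > 0\<close> by (auto simp: MD_def)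
  have u_bd: "\<bar>u s\<bar> \<le> Mu" if "s \<in> {0..h}" for s
    using u_Lip[of s 0] that mult_left_mono[of s h LF] LF(1) \<open>h > 0\<close> by (auto simp: Mu_def)
  have nn: "0 \<le> MD" "0 \<le> Mu" using LD(1) LF(1) \<open>h > 0\<close> by (auto simp: MD_def Mu_def)
  define L where "L = LD + (Mu * LD + MD * LF)"
  define M where "M = MD + Mu * MD"
  have L: "0 \<le> L" "LD \<le> L" "Mu * LD + MD * LF \<le> L" using LD(1) LF(1) nn by (auto simp: L_def)
  have k_Lip: "\<bar>k s - k t\<bar> \<le> L * \<bar>s - t\<bar>" if st: "s \<in> {0..h}" "t \<in> {0..h}" for s t
  proof -
    have "k s - k t = u s * (D s - D t) + D t * (u s - u t)" by (simp add: k_def algebra_simps)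
    then have "\<bar>k s - k t\<bar> \<le> \<bar>u s\<bar> * \<bar>D s - D t\<bar> + \<bar>D t\<bar> * \<bar>u s - u t\<bar>"
      by (simp add: order_trans[OF abs_triangle_ineq] flip: abs_mult)
    also have "\<dots> \<le> Mu * (LD * \<bar>s - t\<bar>) + MD * (LF * \<bar>s - t\<bar>)"
      using u_bd D_bd LD(2) u_Lip st nn by (intro add_mono mult_mono) auto
    also have "\<dots> = (Mu * LD + MD * LF) * \<bar>s - t\<bar>" by (simp add: algebra_simps)
    also have "\<dots> \<le> L * \<bar>s - t\<bar>" using L by (intro mult_right_mono) auto
    finally show ?thesis .
  qed
  have FD: "F s * D s = s * k s" for s using \<open>F 0 = 0\<close> by (simp add: k_def u_def)
  have D0: "0 < D 0" using D_ge[of 0] in_J[of 0] \<open>d > 0\<close> \<open>h > 0\<close> by simp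
  have k0: "0 < k 0" using D0 assms by (simp add: k_def u_def)
  define s0 where "s0 = min h (k 0 / (2 * (L + 1)))"
  have s0: "0 < s0" "s0 \<le> h" using k0 L \<open>h > 0\<close> by (auto simp: s0_def)
  have "s0 \<le> k 0 / (2 * (L + 1))" by (simp add: s0_def)
  then have "s0 * (2 * (L + 1)) \<le> k 0" using L by (subst (asm) pos_le_divide_eq) auto
  then have Ls0: "L * s0 \<le> k 0 / 2" using s0 by (simp add: algebra_simps)
  have near: "k 0 / 4 * s\<^sup>2 \<le> H s" if s: "0 \<le> s" "s \<le> s0" for s
  proof -
    have "H 0 - k 0 / 4 * 0\<^sup>2 \<le> H s - k 0 / 4 * s\<^sup>2"
    proof (rule DERIV_nonneg_imp_nondecreasing[OF s(1)])
      fix x assume x: "0 \<le> x" "x \<le> s"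
      have xh: "x \<in> {0..h}" using x s s0 by auto
      have "((\<lambda>s. H s - k 0 / 4 * s\<^sup>2) has_real_derivative x * k x - k 0 / 2 * x) (at x)"
        using H_deriv[OF in_J[OF xh]] by (auto intro!: derivative_eq_intros simp: FD)
      moreover have "0 \<le> x * k x - k 0 / 2 * x"
      proof -
        have "\<bar>k x - k 0\<bar> \<le> L * \<bar>x - 0\<bar>" using xh \<open>h > 0\<close> by (intro k_Lip) auto
        also have "\<dots> \<le> L * s0" using x s L by (intro mult_left_mono) auto
        finally have "0 \<le> k x - k 0 / 2" using Ls0 by linarith
        then have "0 \<le> x * (k x - k 0 / 2)" using x by simp
        then show ?thesis by (simp add: algebra_simps)
      qed
      ultimately show "\<exists>y. ((\<lambda>s. H s - k 0 / 4 * s\<^sup>2) has_real_derivative y) (at x) \<and> 0 \<le> y" by blast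
    qed
    then show ?thesis using \<open>H 0 = 0\<close> by simp
  qed
  have "continuous_on {s0..h} H"
    by (rule DERIV_continuous_on[OF DERIV_subset[OF H_deriv]]) (use in_J s0 in auto)
  then obtain s1 where s1: "s1 \<in> {s0..h}" "\<And>s. s \<in> {s0..h} \<Longrightarrow> H s1 \<le> H s"
    using continuous_attains_inf[OF compact_Icc, of s0 h H] s0 by auto
  have Hs1: "0 < H s1" using H_pos[of s1] s1 s0 in_J[of s1] by auto
  define m where "m = min (k 0 / 4) (H s1 / h\<^sup>2)"
  have m: "0 < m" "m \<le> k 0 / 4" "m \<le> H s1 / h\<^sup>2"
    using k0 Hs1 \<open>h > 0\<close> by (simp_all only: m_def min.cobounded1 min.cobounded2) simp
  have H_ge: "m * s\<^sup>2 \<le> H s" if s: "s \<in> {0..h}" for s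
  proof (cases "s \<le> s0")
    case True
    have "m * s\<^sup>2 \<le> k 0 / 4 * s\<^sup>2" using m by (intro mult_right_mono) auto
    then show ?thesis using near[of s] True s by auto
  next
    case False
    have "m * s\<^sup>2 \<le> H s1 / h\<^sup>2 * h\<^sup>2"
      using s m Hs1 by (intro mult_mono power_mono) auto
    then show ?thesis using s1(2)[of s] False s \<open>h > 0\<close> by simp
  qed
  have "half_well J D F H k h d L M m"
  proof
    fix s t assume st: "s \<in> {0..h}" "t \<in> {0..h}"
    have "\<bar>D s - D t\<bar> \<le> LD * \<bar>s - t\<bar>" by (rule LD(2)[OF st])
    also have "\<dots> \<le> L * \<bar>s - t\<bar>" using L by (intro mult_right_mono) auto
    finally show "\<bar>D s - D t\<bar> \<le> L * \<bar>s - t\<bar>" .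
    show "\<bar>k s - k t\<bar> \<le> L * \<bar>s - t\<bar>" by (rule k_Lip[OF st])
  next
    fix s assume s: "s \<in> {0..h}"
    have "0 \<le> Mu * MD" using nn by simp
    then show "D s \<le> M" using D_bd[OF s] unfolding M_def by linarith
    have "\<bar>k s\<bar> \<le> Mu * MD" unfolding k_def abs_mult using u_bd[OF s] D_bd[OF s] nn by (intro mult_mono) auto
    then show "\<bar>k s\<bar> \<le> M" using nn by (simp add: M_def)
  qed (use assms FD L m H_ge in auto)
  moreover have "k 0 = F' 0 * D 0" by (simp add: k_def u_def)
  ultimately show ?thesis using that by blast
qed

locale bistable =
  fixes I :: "real set" and D f :: "real \<Rightarrow> real" and \<alpha> \<beta> d :: real
  assumes open_I: "open I" and interval_I: "is_interval I"
    and less: "\<alpha> < \<beta>" and sub_I: "{\<alpha>..\<beta>} \<subseteq> I"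
    and D_C1: "D C1_differentiable_on I"
    and d_pos: "d > 0" and D_ge: "\<And>u. u \<in> I \<Longrightarrow> D u \<ge> d"
    and f_C1: "f C1_differentiable_on I" and f'_C1: "deriv f C1_differentiable_on I"
    and f_zero: "f \<alpha> = 0" "f \<beta> = 0"
    and f'_pos: "deriv f \<alpha> > 0" "deriv f \<beta> > 0"
    and balance: "(LBINT s=\<alpha>..\<beta>. f s * D s) = 0"
    and pot_pos: "\<And>u. u \<in> I \<Longrightarrow> u \<noteq> \<alpha> \<Longrightarrow> u \<noteq> \<beta> \<Longrightarrow> potential D f \<alpha> u > 0"
begin

abbreviation G :: "real \<Rightarrow> real" where "G \<equiv> potential D f \<alpha>"
abbreviation mid :: real where "mid \<equiv> (\<alpha> + \<beta>) / 2"

lemma f_deriv: "u \<in> I \<Longrightarrow> (f has_real_derivative deriv f u) (at u)"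
  using f_C1 unfolding C1_differentiable_on_def
  by (metis DERIV_imp_deriv has_real_derivative_iff_has_vector_derivative)

lemma D_deriv: "u \<in> I \<Longrightarrow> (D has_real_derivative deriv D u) (at u)"
  using D_C1 unfolding C1_differentiable_on_def
  by (metis DERIV_imp_deriv has_real_derivative_iff_has_vector_derivative)

lemma G_deriv:
  assumes u: "u \<in> I"
  shows "(G has_real_derivative f u * D u) (at u)"
proof -
  have a: "\<alpha> \<in> I" using sub_I less by auto
  obtain r where r: "0 < r" "cball u r \<subseteq> I" using open_I u open_contains_cball by blast
  define a' b' where "a' = min (u - r) \<alpha>" "b' = max (u + r) \<alpha>"
  have "u - r \<in> I" "u + r \<in> I" using r by (auto simp: subset_iff dist_real_def)
  then have "a' \<in> I" "b' \<in> I" using a by (auto simp: a'_b'_def min_def max_def)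
  then have sub: "{a'..b'} \<subseteq> I" using interval_I unfolding is_interval_1 by (meson atLeastAtMost_iff subsetI)
  have ord: "a' \<le> \<alpha>" "\<alpha> \<le> b'" "a' < u" "u < b'" using r by (auto simp: a'_b'_def)
  have "continuous_on {a'..b'} (\<lambda>s. f s * D s)"
    by (intro continuous_intros continuous_on_subset[OF C1_differentiable_imp_continuous_on sub] f_C1 D_C1)
  then have "((\<lambda>u. LBINT s=\<alpha>..u. f s * D s) has_vector_derivative f u * D u) (at u within {a'..b'})"
    using ord by (intro interval_integral_FTC2[of a' \<alpha> b']) auto
  moreover have "G = (\<lambda>u. LBINT s=\<alpha>..u. f s * D s)" by (simp add: potential_def fun_eq_iff)
  ultimately show ?thesis
    using at_within_Icc_at[OF ord(3,4)] by (simp add: has_real_derivative_iff_has_vector_derivative)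
qed

text \<open>
  The two zeros \<open>\<gamma>\<close> with the direction \<open>\<sigma>\<close> that points from \<open>\<gamma>\<close> to the midpoint.
\<close>

definition well :: "real \<Rightarrow> real \<Rightarrow> bool" where
  "well \<gamma> \<sigma> \<longleftrightarrow> (\<gamma> = \<alpha> \<and> \<sigma> = 1) \<or> (\<gamma> = \<beta> \<and> \<sigma> = - 1)"

definition side_solution :: "real \<Rightarrow> real \<Rightarrow> real \<Rightarrow> real \<Rightarrow> real \<Rightarrow> (real \<Rightarrow> real) \<Rightarrow> bool" where
  "side_solution \<gamma> \<sigma> \<eta> \<epsilon> l \<phi> \<longleftrightarrow> bvp_solution I D f \<alpha> \<beta> \<epsilon> l \<phi> \<and>
     (\<forall>x\<in>{-(l/2)<..<l/2}. 0 < \<sigma> * (mid - \<phi> x)) \<and> \<bar>\<phi> 0 - \<gamma>\<bar> < \<eta>"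

lemma upper_eq_side: "upper_solution I D f \<alpha> \<beta> \<eta> \<epsilon> l \<phi> = side_solution \<beta> (-1) \<eta> \<epsilon> l \<phi>"
  by (simp add: upper_solution_def side_solution_def)

lemma lower_eq_side: "lower_solution I D f \<alpha> \<beta> \<eta> \<epsilon> l \<phi> = side_solution \<alpha> 1 \<eta> \<epsilon> l \<phi>"
  by (simp add: lower_solution_def side_solution_def)

lemma G_zero: "G \<alpha> = 0" "G \<beta> = 0"
  using balance by (auto simp: potential_def)

lemma deriv_deriv_G:
  assumes "\<gamma> \<in> I" "f \<gamma> = 0"
  shows "deriv (deriv G) \<gamma> = deriv f \<gamma> * D \<gamma>"
proof -
  have "\<forall>\<^sub>F u in nhds \<gamma>. u \<in> I" using open_I assms eventually_nhds by blast
  then have "\<forall>\<^sub>F u in nhds \<gamma>. deriv G u = f u * D u"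
    by eventually_elim (rule DERIV_imp_deriv[OF G_deriv])
  then have "deriv (deriv G) \<gamma> = deriv (\<lambda>u. f u * D u) \<gamma>" by (rule deriv_cong_ev) simp
  also have "((\<lambda>u. f u * D u) has_real_derivative deriv f \<gamma> * D \<gamma> + deriv D \<gamma> * f \<gamma>) (at \<gamma>)"
    using f_deriv[OF assms(1)] D_deriv[OF assms(1)] by (rule DERIV_mult)
  then have "deriv (\<lambda>u. f u * D u) \<gamma> = deriv f \<gamma> * D \<gamma> + deriv D \<gamma> * f \<gamma>" by (rule DERIV_imp_deriv)
  finally show ?thesis using assms by simp
qed

end

locale bistable_well = bistable +
  fixes \<gamma> \<sigma> :: real
  assumes well: "well \<gamma> \<sigma>"
begin

definition J :: "real set" where "J = {s. \<gamma> + \<sigma> * s \<in> I}"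
definition D' :: "real \<Rightarrow> real" where "D' s = D (\<gamma> + \<sigma> * s)"
definition F :: "real \<Rightarrow> real" where "F s = \<sigma> * f (\<gamma> + \<sigma> * s)"
definition H :: "real \<Rightarrow> real" where "H s = G (\<gamma> + \<sigma> * s)"
definition h :: real where "h = (\<beta> - \<alpha>) / 2"

lemma \<sigma>_sq: "\<sigma> * \<sigma> = 1" "\<sigma> * (\<sigma> * x) = x" "\<bar>\<sigma>\<bar> = 1" "\<sigma> \<noteq> 0"
  using well by (auto simp: well_def)

lemma mid_eq: "\<gamma> + \<sigma> * h = mid"
  using well by (auto simp: well_def h_def field_simps)

lemma h_pos: "0 < h" using less by (simp add: h_def)

lemma \<gamma>_in: "\<gamma> \<in> I" and f_\<gamma>: "f \<gamma> = 0" and f'_\<gamma>: "0 < deriv f \<gamma>" and G_\<gamma>: "G \<gamma> = 0"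
  using well sub_I less f_zero f'_pos G_zero by (auto simp: well_def)

lemma affine_deriv:
  fixes g :: "real \<Rightarrow> real"
  assumes "(g has_real_derivative g') (at (\<gamma> + \<sigma> * s))"
  shows "((\<lambda>s. g (\<gamma> + \<sigma> * s)) has_real_derivative \<sigma> * g') (at s)"
  by (rule DERIV_cong[OF DERIV_chain2[where f = g and g = "\<lambda>s. \<gamma> + \<sigma> * s", OF assms]])
     (auto intro!: derivative_eq_intros)

lemma affine_C1:
  fixes g :: "real \<Rightarrow> real"
  assumes "g C1_differentiable_on I"
  shows "(\<lambda>s. g (\<gamma> + \<sigma> * s)) C1_differentiable_on J"
proof -
  obtain g' where g': "\<And>x. x \<in> I \<Longrightarrow> (g has_real_derivative g' x) (at x)" "continuous_on I g'"
    using assms unfolding C1_differentiable_on_def has_real_derivative_iff_has_vector_derivative by auto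
  have "continuous_on J (\<lambda>s. \<sigma> * g' (\<gamma> + \<sigma> * s))"
    by (intro continuous_intros continuous_on_compose2[OF g'(2)]) (auto simp: J_def)
  moreover have "((\<lambda>s. g (\<gamma> + \<sigma> * s)) has_real_derivative \<sigma> * g' (\<gamma> + \<sigma> * s)) (at s)" if "s \<in> J" for s
    using g'(1) that by (intro affine_deriv) (auto simp: J_def)
  ultimately show ?thesis
    unfolding C1_differentiable_on_def has_real_derivative_iff_has_vector_derivative
    by (intro exI[of _ "\<lambda>s. \<sigma> * g' (\<gamma> + \<sigma> * s)"]) auto
qed

lemma half_well:
  obtains k L M m where "half_well J D' F H k h d L M m" "k 0 = deriv f \<gamma> * D \<gamma>"
proof -
  define F' where "F' s = deriv f (\<gamma> + \<sigma> * s)" for s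
  obtain k L M m where "half_well J D' F H k h d L M m" "k 0 = F' 0 * D' 0"
  proof (rule half_wellI[of h J d D' F F' H])
    show "{0..h} \<subseteq> J"
    proof
      fix s assume "s \<in> {0..h}"
      then have "\<gamma> + \<sigma> * s \<in> {\<alpha>..\<beta>}" using well less by (auto simp: well_def h_def)
      then show "s \<in> J" using sub_I by (auto simp: J_def)
    qed
    show "D' C1_differentiable_on J" "F' C1_differentiable_on J"
      unfolding D'_def[abs_def] F'_def[abs_def] by (rule affine_C1[OF D_C1] affine_C1[OF f'_C1])+
    show "0 < h" "0 < d" by (rule h_pos d_pos)+
    show "F 0 = 0" "0 < F' 0" "H 0 = 0" using f_\<gamma> f'_\<gamma> G_\<gamma> by (auto simp: F_def F'_def H_def)
    fix s assume s: "s \<in> J"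
    then have sI: "\<gamma> + \<sigma> * s \<in> I" by (simp add: J_def)
    show "d \<le> D' s" using D_ge[OF sI] by (simp add: D'_def)
    have "(F has_real_derivative \<sigma> * (\<sigma> * F' s)) (at s)"
      unfolding F_def[abs_def] F'_def by (intro DERIV_cmult affine_deriv f_deriv sI)
    then show "(F has_real_derivative F' s) (at s)" by (simp add: \<sigma>_sq)
    have "(H has_real_derivative \<sigma> * (f (\<gamma> + \<sigma> * s) * D (\<gamma> + \<sigma> * s))) (at s)"
      unfolding H_def[abs_def] by (intro affine_deriv G_deriv sI)
    then show "(H has_real_derivative F s * D' s) (at s)" by (simp add: F_def D'_def mult.assoc)
    assume "s \<noteq> 0" "s \<le> h"
    then have "\<gamma> + \<sigma> * s \<noteq> \<alpha>" "\<gamma> + \<sigma> * s \<noteq> \<beta>" using well less by (auto simp: well_def h_def)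
    then show "0 < H s" using pot_pos[OF sI] by (simp add: H_def)
  qed
  then show ?thesis using that by (simp add: F'_def D'_def)
qed

lemma solution_normalize:
  assumes "half_well J D' F H k h d L M m" "\<epsilon> > 0" and side: "side_solution \<gamma> \<sigma> \<eta> \<epsilon> l \<phi>"
  shows "half_well.sol J D' F h \<epsilon> (l/2) (\<lambda>x. \<sigma> * (\<phi> x - \<gamma>)) (\<lambda>x. \<sigma> * deriv \<phi> x)"
proof -
  interpret half_well J D' F H k h d L M m by fact
  have inv: "\<gamma> + \<sigma> * (\<sigma> * (u - \<gamma>)) = u" for u by (simp add: \<sigma>_sq)
  note sol = side[unfolded side_solution_def bvp_solution_def]
  show ?thesis
    unfolding sol_def
  proof (intro conjI ballI)
    have "continuous_on {-(l/2)..l/2} \<phi>" using sol by blast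
    then show "continuous_on {-(l/2)..l/2} (\<lambda>x. \<sigma> * (\<phi> x - \<gamma>))" by (intro continuous_intros)
    have "\<phi> (-(l/2)) = \<gamma> + \<sigma> * h" "\<phi> (l/2) = \<gamma> + \<sigma> * h" using sol mid_eq by auto
    then show "\<sigma> * (\<phi> (-(l/2)) - \<gamma>) = h" "\<sigma> * (\<phi> (l/2) - \<gamma>) = h" by (auto simp: \<sigma>_sq)
    fix x assume x: "x \<in> {-(l/2)<..<l/2}"
    have "\<phi> x \<in> I" using sol x by (auto simp: PiE_iff)
    then show "\<sigma> * (\<phi> x - \<gamma>) \<in> J" by (simp add: J_def inv)
    have "0 < \<sigma> * (mid - \<phi> x)" using sol x by blast
    then have "0 < \<sigma> * (\<gamma> + \<sigma> * h - \<phi> x)" by (simp only: mid_eq)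
    also have "\<sigma> * (\<gamma> + \<sigma> * h - \<phi> x) = h - \<sigma> * (\<phi> x - \<gamma>)" by (simp add: algebra_simps \<sigma>_sq)
    finally show "\<sigma> * (\<phi> x - \<gamma>) < h" by simp
    have "(\<phi> has_real_derivative deriv \<phi> x) (at x)"
      using sol x by (intro DERIV_deriv_iff_real_differentiable[THEN iffD2]) blast
    then show "((\<lambda>x. \<sigma> * (\<phi> x - \<gamma>)) has_real_derivative \<sigma> * deriv \<phi> x) (at x)"
      by (auto intro!: derivative_eq_intros)
    let ?w = "\<lambda>y. D (\<phi> y) * deriv \<phi> y"
    have "(?w has_real_derivative deriv ?w x) (at x)"
      using sol x by (intro DERIV_deriv_iff_real_differentiable[THEN iffD2]) blast
    then have "((\<lambda>y. \<sigma> * ?w y) has_real_derivative \<sigma> * deriv ?w x) (at x)" by (rule DERIV_cmult)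
    moreover have "deriv ?w x = f (\<phi> x) / \<epsilon>\<^sup>2"
    proof -
      have "\<epsilon>\<^sup>2 * deriv ?w x - f (\<phi> x) = 0" using sol x by blast
      then show ?thesis using \<open>\<epsilon> > 0\<close> by (simp add: field_simps)
    qed
    moreover have "(\<lambda>y. D' (\<sigma> * (\<phi> y - \<gamma>)) * (\<sigma> * deriv \<phi> y)) = (\<lambda>y. \<sigma> * ?w y)"
      by (simp add: D'_def inv fun_eq_iff)
    moreover have "F (\<sigma> * (\<phi> x - \<gamma>)) = \<sigma> * f (\<phi> x)" by (simp add: F_def inv)
    ultimately show "((\<lambda>y. D' (\<sigma> * (\<phi> y - \<gamma>)) * (\<sigma> * deriv \<phi> y)) has_real_derivative
        F (\<sigma> * (\<phi> x - \<gamma>)) / \<epsilon>\<^sup>2) (at x)" by simp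
  qed
qed

lemma solution_denormalize:
  assumes "half_well J D' F H k h d L M m" "\<epsilon> > 0" "l > 0"
    and sol: "half_well.sol J D' F h \<epsilon> (l/2) \<psi> v" and "\<bar>\<psi> 0\<bar> < \<eta>"
  defines "\<phi> \<equiv> restrict (\<lambda>x. \<gamma> + \<sigma> * \<psi> x) {-(l/2)..l/2}"
  shows "side_solution \<gamma> \<sigma> \<eta> \<epsilon> l \<phi>"
proof -
  interpret half_well J D' F H k h d L M m by fact
  note S = sol_D[OF sol]
  have "deriv \<phi> x = \<sigma> * v x \<and> (\<phi> has_real_derivative \<sigma> * v x) (at x)" if x: "x \<in> {-(l/2)<..<l/2}" for x
  proof -
    have "((\<lambda>x. \<gamma> + \<sigma> * \<psi> x) has_real_derivative \<sigma> * v x) (at x)"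
      using S(6)[of x] x by (auto intro!: derivative_eq_intros)
    then have "(\<phi> has_real_derivative \<sigma> * v x) (at x)"
      by (rule has_field_derivative_transform_within_open[where S = "{-(l/2)<..<l/2}"])
         (use x in \<open>auto simp: \<phi>_def\<close>)
    then show ?thesis using DERIV_imp_deriv by blast
  qed
  note \<phi>_deriv = this
  have w_deriv: "((\<lambda>y. D (\<phi> y) * deriv \<phi> y) has_real_derivative f (\<phi> x) / \<epsilon>\<^sup>2) (at x)"
    if x: "x \<in> {-(l/2)<..<l/2}" for x
  proof -
    have "((\<lambda>y. \<sigma> * (D' (\<psi> y) * v y)) has_real_derivative \<sigma> * (F (\<psi> x) / \<epsilon>\<^sup>2)) (at x)"
      using S(7)[of x] x by (intro DERIV_cmult) auto
    then have "((\<lambda>y. D (\<phi> y) * deriv \<phi> y) has_real_derivative \<sigma> * (F (\<psi> x) / \<epsilon>\<^sup>2)) (at x)"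
      by (rule has_field_derivative_transform_within_open[where S = "{-(l/2)<..<l/2}"])
         (use x \<phi>_deriv in \<open>auto simp: \<phi>_def D'_def\<close>)
    moreover have "\<sigma> * (F (\<psi> x) / \<epsilon>\<^sup>2) = f (\<phi> x) / \<epsilon>\<^sup>2"
      using x by (simp add: F_def \<phi>_def \<sigma>_sq flip: times_divide_eq_right)
    ultimately show ?thesis by (simp only:)
  qed
  have "\<psi> x \<in> J" if "x \<in> {-(l/2)..l/2}" for x
  proof (cases "x \<in> {-(l/2)<..<l/2}")
    case False
    then have "\<psi> x = h" using that S(2,3) by (auto simp: less_le)
    then show ?thesis using in_J[of h] h_pos by simp
  qed (use S(4) in auto)
  then have "\<phi> \<in> {-(l/2)..l/2} \<rightarrow>\<^sub>E I" by (auto simp: \<phi>_def J_def)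
  moreover have "continuous_on {-(l/2)..l/2} \<phi>"
  proof -
    have "continuous_on {-(l/2)..l/2} (\<lambda>x. \<gamma> + \<sigma> * \<psi> x)" using S(1) by (intro continuous_intros)
    then show ?thesis by (rule continuous_on_eq) (auto simp: \<phi>_def)
  qed
  moreover have "\<phi> (-(l/2)) = mid" "\<phi> (l/2) = mid" using S(2,3) \<open>l > 0\<close> mid_eq by (auto simp: \<phi>_def)
  moreover have "\<phi> differentiable (at x)" "(\<lambda>y. D (\<phi> y) * deriv \<phi> y) differentiable (at x)"
    "\<epsilon>\<^sup>2 * deriv (\<lambda>y. D (\<phi> y) * deriv \<phi> y) x - f (\<phi> x) = 0" if x: "x \<in> {-(l/2)<..<l/2}" for x
  proof -
    show "\<phi> differentiable (at x)" using \<phi>_deriv[OF x] real_differentiable_def by blast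
    show "(\<lambda>y. D (\<phi> y) * deriv \<phi> y) differentiable (at x)"
      using w_deriv[OF x] real_differentiable_def by blast
    show "\<epsilon>\<^sup>2 * deriv (\<lambda>y. D (\<phi> y) * deriv \<phi> y) x - f (\<phi> x) = 0"
      unfolding DERIV_imp_deriv[OF w_deriv[OF x]] using \<open>\<epsilon> > 0\<close> by simp
  qed
  moreover have "0 < \<sigma> * (mid - \<phi> x)" if x: "x \<in> {-(l/2)<..<l/2}" for x
  proof -
    have "\<sigma> * (mid - \<phi> x) = h - \<psi> x"
      using x mid_eq[symmetric] by (simp add: \<phi>_def algebra_simps \<sigma>_sq)
    then show ?thesis using S(5)[of x] x by simp
  qed
  moreover have "\<bar>\<phi> 0 - \<gamma>\<bar> < \<eta>" using assms \<sigma>_sq by (simp add: abs_mult)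
  ultimately show ?thesis unfolding side_solution_def bvp_solution_def by blast
qed

text \<open>
  Both solutions attain their extremal value at the centre, where the time map identifies it by strict
  monotonicity; the extremal value then determines the solution.
\<close>

lemma side_solution_unique:
  obtains \<eta>0 where "0 < \<eta>0" "\<And>\<eta>. 0 < \<eta> \<Longrightarrow> \<eta> \<le> \<eta>0 \<Longrightarrow>
     \<exists>\<rho>>0. \<forall>\<epsilon>>0. \<forall>l>0. \<epsilon> / l < \<rho> \<longrightarrow> (\<exists>!\<phi>. side_solution \<gamma> \<sigma> \<eta> \<epsilon> l \<phi>)"
proof -
  obtain k L M m where hw: "half_well J D' F H k h d L M m" using half_well by metis
  interpret half_well J D' F H k h d L M m by fact
  obtain \<eta>0 where \<eta>0: "0 < \<eta>0" "\<eta>0 \<le> e" and mono: "\<And>p r. 0 < p \<Longrightarrow> p < r \<Longrightarrow> r < \<eta>0 \<Longrightarrow> T r < T p"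
    by (rule T_strict_antimono, rule that)
  show ?thesis
  proof (rule that[OF \<eta>0(1)])
    fix \<eta> assume \<eta>: "0 < \<eta>" "\<eta> \<le> \<eta>0"
    obtain \<delta> r1 where r1: "0 < r1" and \<delta>: "\<And>r. 0 < r \<Longrightarrow> r < r1 \<Longrightarrow>
        0 < \<delta> r \<and> \<delta> r < \<eta> \<and> \<delta> r < e \<and> T (\<delta> r) = 1 / (2 * r)"
      by (rule delta_asymptotic[OF \<eta>(1)], rule that)
    show "\<exists>\<rho>>0. \<forall>\<epsilon>>0. \<forall>l>0. \<epsilon> / l < \<rho> \<longrightarrow> (\<exists>!\<phi>. side_solution \<gamma> \<sigma> \<eta> \<epsilon> l \<phi>)"
    proof (intro exI[of _ r1] conjI r1 allI impI)
      fix \<epsilon> l :: real assume el: "0 < \<epsilon>" "0 < l" "\<epsilon> / l < r1"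
      have pos: "0 < \<epsilon> / l" using el by simp
      have "T (\<delta> (\<epsilon> / l)) = (l / 2) / \<epsilon>" using \<delta>[OF pos el(3)] by simp
      then obtain \<psi> v where \<psi>: "sol \<epsilon> (l/2) \<psi> v" "\<psi> 0 = \<delta> (\<epsilon> / l)"
        using solution_exists[of "\<delta> (\<epsilon> / l)" \<epsilon> "l / 2"] \<delta>[OF pos el(3)] el by auto
      have ex: "side_solution \<gamma> \<sigma> \<eta> \<epsilon> l (restrict (\<lambda>x. \<gamma> + \<sigma> * \<psi> x) {-(l/2)..l/2})"
        using solution_denormalize[OF hw el(1,2) \<psi>(1)] \<psi>(2) \<delta>[OF pos el(3)] by simp
      have uniq: "\<phi> = \<chi>'" if a: "side_solution \<gamma> \<sigma> \<eta> \<epsilon> l \<phi>" and b: "side_solution \<gamma> \<sigma> \<eta> \<epsilon> l \<chi>'" for \<phi> \<chi>'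
      proof -
        note A = solution_normalize[OF hw el(1) a] and B = solution_normalize[OF hw el(1) b]
        have l2: "0 < l / 2" using el by simp
        have "\<bar>\<sigma> * (\<phi> 0 - \<gamma>)\<bar> < \<eta>" "\<bar>\<sigma> * (\<chi>' 0 - \<gamma>)\<bar> < \<eta>"
          using a b \<sigma>_sq by (auto simp: side_solution_def abs_mult)
        then have small: "\<sigma> * (\<phi> 0 - \<gamma>) < \<eta>0" "\<sigma> * (\<chi>' 0 - \<gamma>) < \<eta>0" using \<eta> by auto
        then have e: "\<sigma> * (\<phi> 0 - \<gamma>) < e" "\<sigma> * (\<chi>' 0 - \<gamma>) < e" using \<eta>0 by auto
        note SA = sol_symmetric[OF A el(1) l2 e(1)] and SB = sol_symmetric[OF B el(1) l2 e(2)]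
        have eq: "\<sigma> * (\<phi> 0 - \<gamma>) = \<sigma> * (\<chi>' 0 - \<gamma>)"
          using mono[OF SA(1) _ small(2)] mono[OF SB(1) _ small(1)] SA(2) SB(2)
          by (cases "\<sigma> * (\<phi> 0 - \<gamma>)" "\<sigma> * (\<chi>' 0 - \<gamma>)" rule: linorder_cases) auto
        show "\<phi> = \<chi>'"
        proof (rule PiE_ext)
          show "\<phi> \<in> {-(l/2)..l/2} \<rightarrow>\<^sub>E I" "\<chi>' \<in> {-(l/2)..l/2} \<rightarrow>\<^sub>E I"
            using a b by (auto simp: side_solution_def bvp_solution_def)
        next
          fix x assume x: "x \<in> {-(l/2)..l/2}"
          show "\<phi> x = \<chi>' x" using sol_unique[OF A B el(1) l2 e(1) eq x] \<sigma>_sq by simp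
        qed
      qed
      show "\<exists>!\<phi>. side_solution \<gamma> \<sigma> \<eta> \<epsilon> l \<phi>" using ex uniq by blast
    qed
  qed
qed

definition A :: real where "A = A_coeff D f \<alpha> \<gamma>"
definition K :: real where "K = (\<beta> - \<alpha>) *
  exp (integral {0..h} (\<lambda>s. A * D' s / sqrt (2 * H s) - 1 / s))"

text \<open>
  The centre values are produced here by construction rather than by uniqueness, and they come as close
  to the zero as required. This makes the expansion available for every admissible \<open>\<eta>\<close>, also for
  one that is larger than the range in which the time map is monotone.
\<close>

lemma side_asymptotics:
  assumes "0 < \<eta>"
  obtains \<delta> r1 C where "0 < r1" "0 < A" "0 < K"
    "\<And>\<epsilon> l. 0 < \<epsilon> \<Longrightarrow> 0 < l \<Longrightarrow> \<epsilon> / l < r1 \<Longrightarrow>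
       \<exists>\<phi>. side_solution \<gamma> \<sigma> \<eta> \<epsilon> l \<phi> \<and> \<phi> 0 = \<gamma> + \<sigma> * \<delta> (\<epsilon> / l)"
    "\<And>r. 0 < r \<Longrightarrow> r < r1 \<Longrightarrow>
       \<bar>\<delta> r / (K * exp (- A / (2 * r))) - 1\<bar> \<le> C * (1 / r * exp (- A / (2 * r)))"
    "\<And>r. 0 < r \<Longrightarrow> r < r1 \<Longrightarrow>
       \<bar>G (\<gamma> + \<sigma> * \<delta> r) / (1 / 2 * A\<^sup>2 * (D \<gamma>)\<^sup>2 * K\<^sup>2 * exp (- A / r)) - 1\<bar>
         \<le> C * (1 / r * exp (- A / (2 * r)))"
proof -
  obtain k L M m where hw: "half_well J D' F H k h d L M m" and k0: "k 0 = deriv f \<gamma> * D \<gamma>"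
    using half_well by metis
  interpret hw: half_well J D' F H k h d L M m by fact
  have A_eq: "hw.A = A"
    unfolding hw.A_def A_def A_coeff_def deriv_deriv_G[OF \<gamma>_in f_\<gamma>] k0 by (simp add: D'_def)
  have K_eq: "hw.K = K"
    unfolding hw.K_def K_def hw.i_def[abs_def] A_eq by (simp add: h_def)
  have D0: "D' 0 = D \<gamma>" by (simp add: D'_def)
  show ?thesis
  proof (rule hw.delta_asymptotic[OF assms])
    fix \<delta> r1 C
    assume r1: "0 < r1" and \<delta>: "\<And>r. 0 < r \<Longrightarrow> r < r1 \<Longrightarrow>
          0 < \<delta> r \<and> \<delta> r < \<eta> \<and> \<delta> r < hw.e \<and> hw.T (\<delta> r) = 1 / (2 * r)"
      and b1: "\<And>r. 0 < r \<Longrightarrow> r < r1 \<Longrightarrow>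
          \<bar>\<delta> r / (hw.K * exp (- hw.A / (2 * r))) - 1\<bar> \<le> C * (1 / r * exp (- hw.A / (2 * r)))"
      and b2: "\<And>r. 0 < r \<Longrightarrow> r < r1 \<Longrightarrow>
          \<bar>H (\<delta> r) / (1 / 2 * hw.A\<^sup>2 * (D' 0)\<^sup>2 * hw.K\<^sup>2 * exp (- hw.A / r)) - 1\<bar>
            \<le> C * (1 / r * exp (- hw.A / (2 * r)))"
    show thesis
    proof (rule that[of r1 \<delta> C])
      fix \<epsilon> l :: real assume el: "0 < \<epsilon>" "0 < l" "\<epsilon> / l < r1"
      have pos: "0 < \<epsilon> / l" using el by simp
      have "hw.T (\<delta> (\<epsilon> / l)) = (l / 2) / \<epsilon>" using \<delta>[OF pos el(3)] by simp
      then obtain \<psi> v where \<psi>: "hw.sol \<epsilon> (l/2) \<psi> v" "\<psi> 0 = \<delta> (\<epsilon> / l)"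
        using hw.solution_exists[of "\<delta> (\<epsilon> / l)" \<epsilon> "l / 2"] \<delta>[OF pos el(3)] el by auto
      have "side_solution \<gamma> \<sigma> \<eta> \<epsilon> l (restrict (\<lambda>x. \<gamma> + \<sigma> * \<psi> x) {-(l/2)..l/2})"
        using solution_denormalize[OF hw el(1,2) \<psi>(1)] \<psi>(2) \<delta>[OF pos el(3)] by simp
      moreover have "restrict (\<lambda>x. \<gamma> + \<sigma> * \<psi> x) {-(l/2)..l/2} 0 = \<gamma> + \<sigma> * \<delta> (\<epsilon> / l)"
        using el \<psi>(2) by simp
      ultimately show "\<exists>\<phi>. side_solution \<gamma> \<sigma> \<eta> \<epsilon> l \<phi> \<and> \<phi> 0 = \<gamma> + \<sigma> * \<delta> (\<epsilon> / l)" by blast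
    qed (use r1 b1 b2 hw.A_pos hw.K_pos in \<open>simp_all add: A_eq K_eq D0 H_def\<close>)
  qed
qed

text \<open>
  The exponents of the two constants are Lebesgue integrals over the two halves of \<open>[\<alpha>, \<beta>]\<close>, in the
  variable \<open>t = \<gamma> + \<sigma> s\<close>. The integrand of either one is the function \<open>i\<close> of its well.
\<close>

lemma LBINT_eq_integral_well:
  fixes g :: "real \<Rightarrow> real"
  assumes "\<And>s. s \<in> {0<..<h} \<Longrightarrow> g (\<gamma> + \<sigma> * s) = A * D' s / sqrt (2 * H s) - 1 / s"
    and S: "S = (\<lambda>s. \<gamma> + \<sigma> * s) ` {0<..<h}"
  shows "(LBINT t:S. g t) = integral {0..h} (\<lambda>s. A * D' s / sqrt (2 * H s) - 1 / s)"
proof -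
  obtain k L M m where hw: "half_well J D' F H k h d L M m" and k0: "k 0 = deriv f \<gamma> * D \<gamma>"
    using half_well by metis
  interpret hw: half_well J D' F H k h d L M m by fact
  have A_eq: "hw.A = A"
    unfolding hw.A_def A_def A_coeff_def deriv_deriv_G[OF \<gamma>_in f_\<gamma>] k0 by (simp add: D'_def)
  have i: "hw.i s = A * D' s / sqrt (2 * H s) - 1 / s" for s by (simp add: hw.i_def A_eq)
  have "(LBINT t:S. g t) = (\<integral>t. indicator S t *\<^sub>R g t \<partial>lborel)" by (simp add: set_lebesgue_integral_def)
  also have "\<dots> = (\<integral>s. indicator S (\<gamma> + \<sigma> * s) *\<^sub>R g (\<gamma> + \<sigma> * s) \<partial>lborel)"
    using lborel_integral_real_affine[of \<sigma> "\<lambda>t. indicator S t *\<^sub>R g t" \<gamma>] \<sigma>_sq by simp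
  also have "(\<lambda>s. indicator S (\<gamma> + \<sigma> * s) *\<^sub>R g (\<gamma> + \<sigma> * s)) = (\<lambda>s. indicator {0<..<h} s *\<^sub>R hw.i s)"
  proof
    fix s
    have "\<gamma> + \<sigma> * s \<in> S \<longleftrightarrow> s \<in> {0<..<h}" unfolding S using \<sigma>_sq(4) by auto
    then show "indicator S (\<gamma> + \<sigma> * s) *\<^sub>R g (\<gamma> + \<sigma> * s) = indicator {0<..<h} s *\<^sub>R hw.i s"
      using assms(1)[of s] i by (auto simp: indicator_def)
  qed
  also have "(\<integral>s. indicator {0<..<h} s *\<^sub>R hw.i s \<partial>lborel) = (LBINT s:{0<..<h}. hw.i s)"
    by (simp add: set_lebesgue_integral_def)
  also have "\<dots> = integral {0..h} hw.i"
    using set_borel_integral_eq_integral(2)[OF hw.i_set_integrable] by (simp add: integral_open_interval_real)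
  finally show ?thesis by (simp add: i[abs_def])
qed

end

lemma asymptotic_belowI:
  assumes "0 < r0" and "\<And>r. 0 < r \<Longrightarrow> r < r0 \<Longrightarrow> 0 < M r"
    and "\<And>r. 0 < r \<Longrightarrow> r < r0 \<Longrightarrow> \<bar>q r / M r - 1\<bar> \<le> C * g r"
    and "\<And>\<epsilon> l. 0 < \<epsilon> \<Longrightarrow> 0 < l \<Longrightarrow> \<epsilon> / l < r0 \<Longrightarrow> Q \<epsilon> l = q (\<epsilon> / l)"
  shows "asymptotic_below r0 Q M g"
  unfolding asymptotic_below_def
proof (intro exI conjI allI impI ballI)
  fix r assume "r \<in> {0<..<r0}"
  then show "\<bar>q r / M r - 1\<bar> \<le> C * g r" using assms(3) by simp
next
  fix \<epsilon> l :: real assume el: "0 < \<epsilon>" "0 < l" "\<epsilon> / l < r0"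
  then have "0 < M (\<epsilon> / l)" using assms(2) by simp
  then show "Q \<epsilon> l = M (\<epsilon> / l) * (1 + (q (\<epsilon> / l) / M (\<epsilon> / l) - 1))" using assms(4)[OF el] by simp
qed

section \<open>The expansions\<close>

theorem theorem1:
  fixes I :: "real set" and D f :: "real \<Rightarrow> real" and \<alpha> \<beta> d :: real
  assumes "open I" and "is_interval I"
    and "\<alpha> < \<beta>" and "{\<alpha>..\<beta>} \<subseteq> I"
    and "D C1_differentiable_on I"
    and "d > 0" and "\<And>u. u \<in> I \<Longrightarrow> D u \<ge> d"
    and "f C1_differentiable_on I" and "deriv f C1_differentiable_on I"
    and "f \<alpha> = 0" and "f \<beta> = 0"
    and "deriv f \<alpha> > 0" and "deriv f \<beta> > 0"
    and "(LBINT s=\<alpha>..\<beta>. f s * D s) = 0"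
    and "\<And>u. u \<in> I \<Longrightarrow> u \<noteq> \<alpha> \<Longrightarrow> u \<noteq> \<beta> \<Longrightarrow> potential D f \<alpha> u > 0"
  defines "A\<^sub>\<alpha> \<equiv> A_coeff D f \<alpha> \<alpha>" and "A\<^sub>\<beta> \<equiv> A_coeff D f \<alpha> \<beta>"
    and "K\<^sub>\<alpha> \<equiv> K_alpha D f \<alpha> \<beta>" and "K\<^sub>\<beta> \<equiv> K_beta D f \<alpha> \<beta>"
  shows "(\<exists>\<rho>\<^sub>0 \<eta>. admissible_constants I D f \<alpha> \<beta> \<rho>\<^sub>0 \<eta>) \<and>
    (\<forall>\<rho>\<^sub>0 \<eta>. admissible_constants I D f \<alpha> \<beta> \<rho>\<^sub>0 \<eta> \<longrightarrow>
      (\<exists>r\<^sub>0>0. r\<^sub>0 \<le> \<rho>\<^sub>0 \<and>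
        asymptotic_below r\<^sub>0 (theta_minus I D f \<alpha> \<beta> \<eta>)
          (\<lambda>r. 1 / 2 * A\<^sub>\<alpha>\<^sup>2 * (D \<alpha>)\<^sup>2 * K\<^sub>\<alpha>\<^sup>2 * exp (- A\<^sub>\<alpha> / r))
          (\<lambda>r. 1 / r * exp (- A\<^sub>\<alpha> / (2 * r))) \<and>
        asymptotic_below r\<^sub>0 (theta_plus I D f \<alpha> \<beta> \<eta>)
          (\<lambda>r. 1 / 2 * A\<^sub>\<beta>\<^sup>2 * (D \<beta>)\<^sup>2 * K\<^sub>\<beta>\<^sup>2 * exp (- A\<^sub>\<beta> / r))
          (\<lambda>r. 1 / r * exp (- A\<^sub>\<beta> / (2 * r))) \<and>
        asymptotic_below r\<^sub>0 (delta_minus I D f \<alpha> \<beta> \<eta>)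
          (\<lambda>r. K\<^sub>\<alpha> * exp (- A\<^sub>\<alpha> / (2 * r)))
          (\<lambda>r. 1 / r * exp (- A\<^sub>\<alpha> / (2 * r))) \<and>
        asymptotic_below r\<^sub>0 (delta_plus I D f \<alpha> \<beta> \<eta>)
          (\<lambda>r. K\<^sub>\<beta> * exp (- A\<^sub>\<beta> / (2 * r)))
          (\<lambda>r. 1 / r * exp (- A\<^sub>\<beta> / (2 * r)))))"
proof -
  interpret bistable I D f \<alpha> \<beta> d by standard (use assms(1-15) in auto)
  interpret lower: bistable_well I D f \<alpha> \<beta> d \<alpha> 1 by standard (simp add: well_def)
  interpret upper: bistable_well I D f \<alpha> \<beta> d \<beta> "-1" by standard (simp add: well_def)
  have D_pos: "0 < D \<alpha>" "0 < D \<beta>"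
    using D_ge[of \<alpha>] D_ge[of \<beta>] d_pos lower.\<gamma>_in upper.\<gamma>_in by auto
  have A_eq: "lower.A = A\<^sub>\<alpha>" "upper.A = A\<^sub>\<beta>"
    by (simp_all add: lower.A_def upper.A_def A\<^sub>\<alpha>_def A\<^sub>\<beta>_def)
  have h: "lower.h = (\<beta> - \<alpha>) / 2" "upper.h = (\<beta> - \<alpha>) / 2" by (auto simp: lower.h_def upper.h_def)
  have "K\<^sub>\<alpha> = lower.K"
  proof -
    have "(LBINT t=\<alpha>..mid. A\<^sub>\<alpha> * D t / sqrt (2 * G t) - 1 / (t - \<alpha>))
       = (LBINT t:{\<alpha><..<mid}. A\<^sub>\<alpha> * D t / sqrt (2 * G t) - 1 / (t - \<alpha>))"
      using less by (subst interval_integral_Ioo) auto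
    also have "\<dots> = integral {0..lower.h} (\<lambda>s. lower.A * lower.D' s / sqrt (2 * lower.H s) - 1 / s)"
    proof (rule lower.LBINT_eq_integral_well)
      have "t \<in> (\<lambda>s. \<alpha> + 1 * s) ` {0<..<lower.h} \<longleftrightarrow> t - \<alpha> \<in> {0<..<lower.h}" for t
        by (rule iffI) (auto intro!: image_eqI[of _ _ "t - \<alpha>"])
      then show "{\<alpha><..<mid} = (\<lambda>s. \<alpha> + 1 * s) ` {0<..<lower.h}"
        by (auto simp: h set_eq_iff field_simps)
    qed (simp add: A_eq lower.D'_def lower.H_def)
    finally show ?thesis unfolding K\<^sub>\<alpha>_def K_alpha_def lower.K_def A\<^sub>\<alpha>_def by simp
  qed
  have "K\<^sub>\<beta> = upper.K"
  proof -
    have "(LBINT t=mid..\<beta>. A\<^sub>\<beta> * D t / sqrt (2 * G t) - 1 / (\<beta> - t))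
       = (LBINT t:{mid<..<\<beta>}. A\<^sub>\<beta> * D t / sqrt (2 * G t) - 1 / (\<beta> - t))"
      using less by (subst interval_integral_Ioo) auto
    also have "\<dots> = integral {0..upper.h} (\<lambda>s. upper.A * upper.D' s / sqrt (2 * upper.H s) - 1 / s)"
    proof (rule upper.LBINT_eq_integral_well)
      have "t \<in> (\<lambda>s. \<beta> + - 1 * s) ` {0<..<upper.h} \<longleftrightarrow> \<beta> - t \<in> {0<..<upper.h}" for t
        by (rule iffI) (auto intro!: image_eqI[of _ _ "\<beta> - t"])
      then show "{mid<..<\<beta>} = (\<lambda>s. \<beta> + - 1 * s) ` {0<..<upper.h}"
        by (auto simp: h set_eq_iff field_simps)
    qed (simp add: A_eq upper.D'_def upper.H_def)
    finally show ?thesis unfolding K\<^sub>\<beta>_def K_beta_def upper.K_def A\<^sub>\<beta>_def by simp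
  qed
  note eqs = A_eq \<open>K\<^sub>\<alpha> = lower.K\<close>[symmetric] \<open>K\<^sub>\<beta> = upper.K\<close>[symmetric]
  show ?thesis
  proof (intro conjI allI impI)
    obtain \<eta>1 where \<eta>1: "0 < \<eta>1" "\<And>\<eta>. 0 < \<eta> \<Longrightarrow> \<eta> \<le> \<eta>1 \<Longrightarrow>
       \<exists>\<rho>>0. \<forall>\<epsilon>>0. \<forall>l>0. \<epsilon> / l < \<rho> \<longrightarrow> (\<exists>!\<phi>. side_solution \<alpha> 1 \<eta> \<epsilon> l \<phi>)"
      by (rule lower.side_solution_unique, rule that)
    obtain \<eta>2 where \<eta>2: "0 < \<eta>2" "\<And>\<eta>. 0 < \<eta> \<Longrightarrow> \<eta> \<le> \<eta>2 \<Longrightarrow>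
       \<exists>\<rho>>0. \<forall>\<epsilon>>0. \<forall>l>0. \<epsilon> / l < \<rho> \<longrightarrow> (\<exists>!\<phi>. side_solution \<beta> (-1) \<eta> \<epsilon> l \<phi>)"
      by (rule upper.side_solution_unique, rule that)
    define \<eta> where "\<eta> = min \<eta>1 \<eta>2"
    have \<eta>: "0 < \<eta>" "\<eta> \<le> \<eta>1" "\<eta> \<le> \<eta>2" using \<eta>1 \<eta>2 by (auto simp: \<eta>_def)
    obtain \<rho>1 where \<rho>1: "\<rho>1 > 0"
      "\<forall>\<epsilon>>0. \<forall>l>0. \<epsilon> / l < \<rho>1 \<longrightarrow> (\<exists>!\<phi>. side_solution \<alpha> 1 \<eta> \<epsilon> l \<phi>)"
      using \<eta>1(2)[OF \<eta>(1,2)] by blast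
    obtain \<rho>2 where \<rho>2: "\<rho>2 > 0"
      "\<forall>\<epsilon>>0. \<forall>l>0. \<epsilon> / l < \<rho>2 \<longrightarrow> (\<exists>!\<phi>. side_solution \<beta> (-1) \<eta> \<epsilon> l \<phi>)"
      using \<eta>2(2)[OF \<eta>(1,3)] by blast
    have "admissible_constants I D f \<alpha> \<beta> (min \<rho>1 \<rho>2) \<eta>"
      unfolding admissible_constants_def upper_eq_side lower_eq_side using \<eta> \<rho>1 \<rho>2 by simp
    then show "\<exists>\<rho>\<^sub>0 \<eta>. admissible_constants I D f \<alpha> \<beta> \<rho>\<^sub>0 \<eta>" by blast
  next
    fix \<rho>\<^sub>0 \<eta> assume adm: "admissible_constants I D f \<alpha> \<beta> \<rho>\<^sub>0 \<eta>"
    then have \<rho>0: "0 < \<rho>\<^sub>0" and \<eta>: "0 < \<eta>" by (auto simp: admissible_constants_def)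
    have both: "\<forall>\<epsilon>>0. \<forall>l>0. \<epsilon> / l < \<rho>\<^sub>0 \<longrightarrow>
        (\<exists>!\<phi>. side_solution \<beta> (-1) \<eta> \<epsilon> l \<phi>) \<and> (\<exists>!\<phi>. side_solution \<alpha> 1 \<eta> \<epsilon> l \<phi>)"
      using adm unfolding admissible_constants_def upper_eq_side lower_eq_side by (elim conjE)
    have uniq: "\<exists>!\<phi>. side_solution \<alpha> 1 \<eta> \<epsilon> l \<phi>" "\<exists>!\<phi>. side_solution \<beta> (-1) \<eta> \<epsilon> l \<phi>"
      if "0 < \<epsilon>" "0 < l" "\<epsilon> / l < \<rho>\<^sub>0" for \<epsilon> l
      by (rule conjunct2[OF both[rule_format, OF that]], rule conjunct1[OF both[rule_format, OF that]])
    obtain \<delta>1 r1 C1 where r1: "0 < r1" "0 < lower.A" "0 < lower.K"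
      and sol1: "\<And>\<epsilon> l. 0 < \<epsilon> \<Longrightarrow> 0 < l \<Longrightarrow> \<epsilon> / l < r1 \<Longrightarrow>
         \<exists>\<phi>. side_solution \<alpha> 1 \<eta> \<epsilon> l \<phi> \<and> \<phi> 0 = \<alpha> + 1 * \<delta>1 (\<epsilon> / l)"
      and b1: "\<And>r. 0 < r \<Longrightarrow> r < r1 \<Longrightarrow> \<bar>\<delta>1 r / (lower.K * exp (- lower.A / (2 * r))) - 1\<bar>
          \<le> C1 * (1 / r * exp (- lower.A / (2 * r)))"
        "\<And>r. 0 < r \<Longrightarrow> r < r1 \<Longrightarrow>
          \<bar>G (\<alpha> + 1 * \<delta>1 r) / (1 / 2 * lower.A\<^sup>2 * (D \<alpha>)\<^sup>2 * lower.K\<^sup>2 * exp (- lower.A / r)) - 1\<bar>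
          \<le> C1 * (1 / r * exp (- lower.A / (2 * r)))"
      by (rule lower.side_asymptotics[OF \<eta>], rule that)
    obtain \<delta>2 r2 C2 where r2: "0 < r2" "0 < upper.A" "0 < upper.K"
      and sol2: "\<And>\<epsilon> l. 0 < \<epsilon> \<Longrightarrow> 0 < l \<Longrightarrow> \<epsilon> / l < r2 \<Longrightarrow>
         \<exists>\<phi>. side_solution \<beta> (-1) \<eta> \<epsilon> l \<phi> \<and> \<phi> 0 = \<beta> + -1 * \<delta>2 (\<epsilon> / l)"
      and b2: "\<And>r. 0 < r \<Longrightarrow> r < r2 \<Longrightarrow> \<bar>\<delta>2 r / (upper.K * exp (- upper.A / (2 * r))) - 1\<bar>
          \<le> C2 * (1 / r * exp (- upper.A / (2 * r)))"
        "\<And>r. 0 < r \<Longrightarrow> r < r2 \<Longrightarrow>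
          \<bar>G (\<beta> + -1 * \<delta>2 r) / (1 / 2 * upper.A\<^sup>2 * (D \<beta>)\<^sup>2 * upper.K\<^sup>2 * exp (- upper.A / r)) - 1\<bar>
          \<le> C2 * (1 / r * exp (- upper.A / (2 * r)))"
      by (rule upper.side_asymptotics[OF \<eta>], rule that)
    define r0 where "r0 = Min {\<rho>\<^sub>0, r1, r2}"
    have r0: "0 < r0" "r0 \<le> \<rho>\<^sub>0" "r0 \<le> r1" "r0 \<le> r2" using \<rho>0 r1 r2 by (auto simp: r0_def)
    have minus: "phi_minus I D f \<alpha> \<beta> \<eta> \<epsilon> l 0 = \<alpha> + \<delta>1 (\<epsilon> / l)"
      if el: "0 < \<epsilon>" "0 < l" "\<epsilon> / l < r0" for \<epsilon> l
    proof -
      have lt: "\<epsilon> / l < r1" "\<epsilon> / l < r2" "\<epsilon> / l < \<rho>\<^sub>0" using el r0 by auto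
      obtain \<phi> where \<phi>: "side_solution \<alpha> 1 \<eta> \<epsilon> l \<phi>" "\<phi> 0 = \<alpha> + 1 * \<delta>1 (\<epsilon> / l)"
        using sol1[OF el(1,2) lt(1)] by blast
      have "phi_minus I D f \<alpha> \<beta> \<eta> \<epsilon> l = \<phi>"
        unfolding phi_minus_def lower_eq_side by (rule the1_equality[OF uniq(1)[OF el(1,2) lt(3)], OF \<phi>(1)])
      then show ?thesis using \<phi>(2) by simp
    qed
    have plus: "phi_plus I D f \<alpha> \<beta> \<eta> \<epsilon> l 0 = \<beta> - \<delta>2 (\<epsilon> / l)"
      if el: "0 < \<epsilon>" "0 < l" "\<epsilon> / l < r0" for \<epsilon> l
    proof -
      have lt: "\<epsilon> / l < r1" "\<epsilon> / l < r2" "\<epsilon> / l < \<rho>\<^sub>0" using el r0 by auto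
      obtain \<phi> where \<phi>: "side_solution \<beta> (-1) \<eta> \<epsilon> l \<phi>" "\<phi> 0 = \<beta> + -1 * \<delta>2 (\<epsilon> / l)"
        using sol2[OF el(1,2) lt(2)] by blast
      have "phi_plus I D f \<alpha> \<beta> \<eta> \<epsilon> l = \<phi>"
        unfolding phi_plus_def upper_eq_side by (rule the1_equality[OF uniq(2)[OF el(1,2) lt(3)], OF \<phi>(1)])
      then show ?thesis using \<phi>(2) by simp
    qed
    show "\<exists>r\<^sub>0>0. r\<^sub>0 \<le> \<rho>\<^sub>0 \<and>
        asymptotic_below r\<^sub>0 (theta_minus I D f \<alpha> \<beta> \<eta>)
          (\<lambda>r. 1 / 2 * A\<^sub>\<alpha>\<^sup>2 * (D \<alpha>)\<^sup>2 * K\<^sub>\<alpha>\<^sup>2 * exp (- A\<^sub>\<alpha> / r))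
          (\<lambda>r. 1 / r * exp (- A\<^sub>\<alpha> / (2 * r))) \<and>
        asymptotic_below r\<^sub>0 (theta_plus I D f \<alpha> \<beta> \<eta>)
          (\<lambda>r. 1 / 2 * A\<^sub>\<beta>\<^sup>2 * (D \<beta>)\<^sup>2 * K\<^sub>\<beta>\<^sup>2 * exp (- A\<^sub>\<beta> / r))
          (\<lambda>r. 1 / r * exp (- A\<^sub>\<beta> / (2 * r))) \<and>
        asymptotic_below r\<^sub>0 (delta_minus I D f \<alpha> \<beta> \<eta>)
          (\<lambda>r. K\<^sub>\<alpha> * exp (- A\<^sub>\<alpha> / (2 * r)))
          (\<lambda>r. 1 / r * exp (- A\<^sub>\<alpha> / (2 * r))) \<and>
        asymptotic_below r\<^sub>0 (delta_plus I D f \<alpha> \<beta> \<eta>)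
          (\<lambda>r. K\<^sub>\<beta> * exp (- A\<^sub>\<beta> / (2 * r)))
          (\<lambda>r. 1 / r * exp (- A\<^sub>\<beta> / (2 * r)))"
    proof (intro exI[of _ r0] conjI r0(1,2))
      show "asymptotic_below r0 (theta_minus I D f \<alpha> \<beta> \<eta>)
          (\<lambda>r. 1 / 2 * A\<^sub>\<alpha>\<^sup>2 * (D \<alpha>)\<^sup>2 * K\<^sub>\<alpha>\<^sup>2 * exp (- A\<^sub>\<alpha> / r))
          (\<lambda>r. 1 / r * exp (- A\<^sub>\<alpha> / (2 * r)))"
        by (rule asymptotic_belowI[where q = "\<lambda>r. G (\<alpha> + 1 * \<delta>1 r)" and C = C1])
           (use r0 r1 D_pos b1(2) minus in \<open>auto simp: eqs theta_minus_def\<close>)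
      show "asymptotic_below r0 (theta_plus I D f \<alpha> \<beta> \<eta>)
          (\<lambda>r. 1 / 2 * A\<^sub>\<beta>\<^sup>2 * (D \<beta>)\<^sup>2 * K\<^sub>\<beta>\<^sup>2 * exp (- A\<^sub>\<beta> / r))
          (\<lambda>r. 1 / r * exp (- A\<^sub>\<beta> / (2 * r)))"
        by (rule asymptotic_belowI[where q = "\<lambda>r. G (\<beta> + -1 * \<delta>2 r)" and C = C2])
           (use r0 r2 D_pos b2(2) plus in \<open>auto simp: eqs theta_plus_def\<close>)
      show "asymptotic_below r0 (delta_minus I D f \<alpha> \<beta> \<eta>)
          (\<lambda>r. K\<^sub>\<alpha> * exp (- A\<^sub>\<alpha> / (2 * r)))
          (\<lambda>r. 1 / r * exp (- A\<^sub>\<alpha> / (2 * r)))"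
        by (rule asymptotic_belowI[where q = \<delta>1 and C = C1])
           (use r0 r1 b1(1) minus in \<open>auto simp: eqs delta_minus_def\<close>)
      show "asymptotic_below r0 (delta_plus I D f \<alpha> \<beta> \<eta>)
          (\<lambda>r. K\<^sub>\<beta> * exp (- A\<^sub>\<beta> / (2 * r)))
          (\<lambda>r. 1 / r * exp (- A\<^sub>\<beta> / (2 * r)))"
        by (rule asymptotic_belowI[where q = \<delta>2 and C = C2])
           (use r0 r2 b2(1) plus in \<open>auto simp: eqs delta_plus_def\<close>)
    qed
  qed
qed

end
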